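(* Let $\mathsf{Q}=\mathbb{C}[\mathsf{t}_1,\mathsf{t}_2,\mathsf{t}_3,\mathsf{t}_4,\mathsf{t}_{12},\mathsf{t}_{23},\mathsf{t}_{34},\mathsf{t}_{14}]$ be the $\mathbb{C}$-subalgebra of $\mathbb{C}[\mathcal{X}(F_4)]$ generated by the listed elements. Then $\mathsf{Q}$ is a polynomial ring (in these eight generators), and $\mathbb{C}[\mathcal{X}(F_4)]$ is a free $\mathsf{Q}$-module generated by $\mathsf{A}$, where \begin{align*} \mathsf{A}&=\{1,\mathsf{t}_{13},\mathsf{t}_{24},\mathsf{t}_{13}\mathsf{t}_{24}\}\cup\big\{\mathsf{t}_{13}^k,\ \mathsf{t}_{13}^k\mathsf{t}_{24},\ \mathsf{t}_{24}^k,\ \mathsf{t}_{24}^k\mathsf{t}_{13}\colon k\ge 2\big\}\\ &\quad\cup\big\{\mathsf{t}_{13}^k\mathsf{t}_{123},\ \mathsf{t}_{13}^k\mathsf{t}_{134},\ \mathsf{t}_{24}^k\mathsf{t}_{124},\ \mathsf{t}_{24}^k\mathsf{t}_{234}\colon k\ge 0\big\}. \end{align*} Consequently, $\mathsf{B}$ is a basis for $\mathbb{C}[\mathcal{X}(F_4)]$ as a vector space over $\mathbb{C}$, where $$\mathsf{B}=\big\{\mathsf{t}_1^{i_1}\mathsf{t}_2^{i_2}\mathsf{t}_3^{i_3}\mathsf{t}_4^{i_4}\mathsf{t}_{12}^{i_5}\mathsf{t}_{23}^{i_6}\mathsf{t}_{34}^{i_7}\mathsf{t}_{14}^{i_8}\mathsf{a}\colon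 i_1,\ldots,i_8\ge 0,\ \mathsf{a}\in\mathsf{A}\big\}.$$
   Context: $F_4$ is the free group of rank $4$ with free generators $x_1,\ldots,x_4$. For a finitely presented group $\Gamma$, the character of $\rho\in\hom(\Gamma,{\rm SL}(2,\mathbb{C}))$ is the function $\chi_\rho:\Gamma\to\mathbb{C}$, $x\mapsto{\rm tr}(\rho(x))$; the ${\rm SL}(2,\mathbb{C})$-character variety $\mathcal{X}(\Gamma)$ is the GIT quotient of $\hom(\Gamma,{\rm SL}(2,\mathbb{C}))$ by the conjugation action of ${\rm SL}(2,\mathbb{C})$, and as an affine algebraic set $\mathcal{X}(\Gamma)=\{\chi_\rho\colon\rho\in\hom(\Gamma,{\rm SL}(2,\mathbb{C}))\}$. $\mathbb{C}[\mathcal{X}(\Gamma)]$ is its coordinate ring. For $1\le i_1,\ldots,i_r\le 4$, $\mathsf{t}_{i_1\cdots i_r}\in\mathbb{C}[\mathcal{X}(F_4)]$ is the function $\chi_\rho\mapsto\chi_\rho(x_{i_1}\cdots x_{i_r})={\rm tr}(\rho(x_{i_1})\cdots\rho(x_{i_r}))$. (Identifying $\hom(F_4,{\rm SL}(2,\mathbb{C}))$ with ${\rm SL}(2,\mathbb{C})^4$, $\mathbb{C}[\mathcal{X}(F_4)]$ is the ring of polynomial functions on ${\rm SL}(2,\mathbb{C})^4$ invariant under simultaneous conjugation.) *)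

theory Defs
  imports "HOL-Analysis.Analysis" "HOL-Library.Function_Algebras" "HOL-Library.Poly_Mapping"
begin

typedef SL2 = "{A :: complex^2^2. det A = 1}"
  morphisms mat_of_SL2 Abs_SL2
  by (rule exI[of _ "mat 1"]) simp

setup_lifting type_definition_SL2

instantiation SL2 :: monoid_mult
begin

lift_definition one_SL2 :: SL2 is "mat 1" by simp

lift_definition times_SL2 :: "SL2 \<Rightarrow> SL2 \<Rightarrow> SL2" is "(**)"
  by (simp add: det_mul)

instance
  by standard (transfer, simp add: matrix_mul_assoc)+

end

lift_definition conj_SL2 :: "SL2 \<Rightarrow> SL2 \<Rightarrow> SL2" is "\<lambda>g A. g ** A ** matrix_inv g"
proof -
  fix g A :: "complex^2^2"
  assume "det g = 1" "det A = 1"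
  moreover have "\<exists>h. g ** h = mat 1 \<and> h ** g = mat 1"
    using \<open>det g = 1\<close> invertible_det_nz[of g] by (simp add: invertible_def)
  then have "g ** matrix_inv g = mat 1"
    unfolding matrix_inv_def by (rule someI2_ex) simp
  then have "det g * det (matrix_inv g) = 1"
    by (metis det_I det_mul)
  ultimately show "det (g ** A ** matrix_inv g) = 1"
    by (simp add: det_mul)
qed

text \<open>
  A homomorphism from the free group on $x_1,\ldots,x_4$ to SL(2,C) is identified with the
  4-tuple of images of the generators. The index type \<open>4\<close> has the four elements
  1, 2, 3, 4 (calculating modulo 4, so that 4 and 0 denote the same element).
\<close>

type_synonym rep = "4 \<Rightarrow> SL2"

text \<open>
  Complex-valued functions carry the pointwise ring structure of
  \<^theory>\<open>HOL-Library.Function_Algebras\<close>; scalars enter as constant functions.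
\<close>

definition fun_scale :: "complex \<Rightarrow> ('a \<Rightarrow> complex) \<Rightarrow> 'a \<Rightarrow> complex"
  where "fun_scale c f = (\<lambda>x. c * f x)"

global_interpretation fun_vs: vector_space fun_scale
  by unfold_locales (auto simp: fun_scale_def fun_eq_iff algebra_simps)

definition complex_subalgebra :: "('a \<Rightarrow> complex) set \<Rightarrow> bool"
  where "complex_subalgebra S \<longleftrightarrow>
    (\<forall>c. (\<lambda>_. c) \<in> S) \<and> (\<forall>f\<in>S. \<forall>g\<in>S. f + g \<in> S) \<and> (\<forall>f\<in>S. \<forall>g\<in>S. f * g \<in> S)"

definition polynomial_functions :: "(rep \<Rightarrow> complex) set"
  where "polynomial_functions =
    complex_subalgebra hull {\<lambda>\<rho>. mat_of_SL2 (\<rho> i) $ j $ k | i j k. True}"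

text \<open>
  The coordinate ring of the GIT quotient of \<open>rep\<close> by conjugation. A function on the character
  variety is represented by its pullback to \<open>rep\<close>.
\<close>

definition char_ring :: "(rep \<Rightarrow> complex) set"
  where "char_ring =
    {f \<in> polynomial_functions. \<forall>g \<rho>. f (\<lambda>i. conj_SL2 g (\<rho> i)) = f \<rho>}"

definition tr :: "4 list \<Rightarrow> rep \<Rightarrow> complex"
  where "tr w = (\<lambda>\<rho>. trace (mat_of_SL2 (prod_list (map \<rho> w))))"

definition Q_gens :: "(rep \<Rightarrow> complex) list"
  where "Q_gens =
    [tr [1], tr [2], tr [3], tr [4], tr [1,2], tr [2,3], tr [3,4], tr [1,4]]"

definition Q_ring :: "(rep \<Rightarrow> complex) set"
  where "Q_ring = complex_subalgebra hull (set Q_gens)"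

text \<open>
  Polynomials are finitely supported maps from monomials to coefficients, and monomials are
  finitely supported maps from variables to exponents.
\<close>

definition polynomials_in :: "nat set \<Rightarrow> ((nat \<Rightarrow>\<^sub>0 nat) \<Rightarrow>\<^sub>0 complex) set"
  where "polynomials_in V = {p. \<forall>m \<in> Poly_Mapping.keys p. Poly_Mapping.keys m \<subseteq> V}"

definition poly_eval :: "(nat \<Rightarrow> 'a \<Rightarrow> complex) \<Rightarrow> ((nat \<Rightarrow>\<^sub>0 nat) \<Rightarrow>\<^sub>0 complex) \<Rightarrow> 'a \<Rightarrow> complex"
  where "poly_eval X p =
    (\<Sum>m \<in> Poly_Mapping.keys p. fun_scale (Poly_Mapping.lookup p m)
      (\<Prod>i \<in> Poly_Mapping.keys m. X i ^ Poly_Mapping.lookup m i))"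

text \<open>
  \<open>R\<close> is polynomial in the listed elements: substituting them for the variables, which is always
  a homomorphism of algebras, is an isomorphism from the polynomial ring in as many variables
  onto \<open>R\<close>.
\<close>

definition is_polynomial_ring_in :: "('a \<Rightarrow> complex) set \<Rightarrow> ('a \<Rightarrow> complex) list \<Rightarrow> bool"
  where "is_polynomial_ring_in R xs \<longleftrightarrow>
    bij_betw (poly_eval (\<lambda>i. xs ! i)) (polynomials_in {..<length xs}) R"

text \<open>
  The module \<open>M\<close> over the subring \<open>R\<close> is free with basis \<open>A\<close>. This follows
  \<open>module.span_explicit\<close> and \<open>module.dependent_explicit\<close>, whose scalars form a whole
  type instead of a subring.
\<close>

definition is_free_module_basis :: "'a::comm_ring_1 set \<Rightarrow> 'a set \<Rightarrow> 'a set \<Rightarrow> bool"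
  where "is_free_module_basis R A M \<longleftrightarrow>
    M = {\<Sum>a\<in>T. r a * a | T r. finite T \<and> T \<subseteq> A \<and> (\<forall>a\<in>T. r a \<in> R)} \<and>
    (\<forall>T r. finite T \<and> T \<subseteq> A \<and> (\<forall>a\<in>T. r a \<in> R) \<and> (\<Sum>a\<in>T. r a * a) = 0
      \<longrightarrow> (\<forall>a\<in>T. r a = 0))"

definition A_set :: "(rep \<Rightarrow> complex) set"
  where "A_set =
    {1, tr [1,3], tr [2,4], tr [1,3] * tr [2,4]}
    \<union> (\<Union>k \<in> {2..}. {tr [1,3] ^ k, tr [1,3] ^ k * tr [2,4],
                    tr [2,4] ^ k, tr [2,4] ^ k * tr [1,3]})
    \<union> (\<Union>k. {tr [1,3] ^ k * tr [1,2,3], tr [1,3] ^ k * tr [1,3,4],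
            tr [2,4] ^ k * tr [1,2,4], tr [2,4] ^ k * tr [2,3,4]})"

definition B_set :: "(rep \<Rightarrow> complex) set"
  where "B_set =
    {tr [1] ^ i1 * tr [2] ^ i2 * tr [3] ^ i3 * tr [4] ^ i4 *
     tr [1,2] ^ i5 * tr [2,3] ^ i6 * tr [3,4] ^ i7 * tr [1,4] ^ i8 * a
     | i1 i2 i3 i4 i5 i6 i7 i8 a. a \<in> A_set}"

end

theory Submission
  imports Defs
begin

text \<open>
  \<^emph>\<open>Generation.\<close> An invariant polynomial \<open>f\<close> satisfies \<open>f(g\<rho>g\<inverse>) = f(\<rho>)\<close>; clearing denominators,
  \<open>det(p)\<^sup>N f(\<rho>)\<close> is a sum of products of \<open>N\<close> entries of matrices \<open>p W adj(p)\<close> with words \<open>W\<close>,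
  whose coefficients are polynomials in traces of words. Cayley's \<open>\<Omega>\<close> process in \<open>p\<close> preserves this
  shape, and applied \<open>N\<close> times it returns a nonzero multiple of \<open>f\<close>. So \<open>f\<close> is a polynomial in traces of words, and
  then in \<open>t\<^sub>i\<close>, \<open>t\<^sub>i\<^sub>j\<close>, \<open>t\<^sub>i\<^sub>j\<^sub>k\<close>.

  \<^emph>\<open>Spanning.\<close> The traceless parts of the four matrices are vectors in a quadratic space of dimension 3. Let
  \<open>s\<^sub>i\<^sub>j\<close> be their inner products and \<open>D\<^sub>i\<^sub>j\<^sub>k\<close> their volumes. The vanishing of the \<open>4 \<times> 4\<close> Gram
  determinant has leading term \<open>s\<^sub>1\<^sub>3\<^sup>2 s\<^sub>2\<^sub>4\<^sup>2\<close>, Cramer's rule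
  rewrites \<open>s\<^sub>2\<^sub>4 D\<^sub>1\<^sub>2\<^sub>3\<close>, \<open>s\<^sub>2\<^sub>4 D\<^sub>1\<^sub>3\<^sub>4\<close>, \<open>s\<^sub>1\<^sub>3 D\<^sub>1\<^sub>2\<^sub>4\<close>, \<open>s\<^sub>1\<^sub>3 D\<^sub>2\<^sub>3\<^sub>4\<close>, and products
  of two volumes are Gram minors.

  \<^emph>\<open>Independence.\<close> Generic values of the eight generators of \<open>Q\<close> are attained along sequences of
  representations with \<open>t\<^sub>1\<^sub>3 \<rightarrow> \<infinity>\<close>, on which \<open>t\<^sub>2\<^sub>4\<close>, \<open>D\<^sub>1\<^sub>2\<^sub>3/t\<^sub>1\<^sub>3\<close> and \<open>D\<^sub>1\<^sub>3\<^sub>4/t\<^sub>1\<^sub>3\<close>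
  converge to limits that depend on two free signs. Leading terms in a linear relation then vanish one at
  a time. Transposing all matrices separates the terms with volumes from those without, and the rotation
  \<open>1 \<rightarrow> 2 \<rightarrow> 3 \<rightarrow> 4 \<rightarrow> 1\<close> exchanges \<open>t\<^sub>1\<^sub>3\<close> and \<open>t\<^sub>2\<^sub>4\<close>.
\<close>

subsection \<open>Matrices and subalgebras\<close>

lemmas fun_apply = plus_fun_apply times_fun_apply zero_fun_apply one_fun_apply numeral_fun_apply
  of_nat_fun_apply minus_apply uminus_apply

text \<open>As simplification rules, these turn ring identities between functions into statements about
  \<open>\<lambda>\<close>-abstractions.\<close>

declare fun_apply [simp del]

lemma matmul_2: "(A ** B) $ i $ j = A $ i $ 1 * B $ 1 $ j + A $ i $ 2 * B $ 2 $ j"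
  for A B :: "complex^2^2"
  by (simp add: matrix_matrix_mult_def sum_2)

lemma trace_2: "trace A = A $ 1 $ 1 + A $ 2 $ 2" for A :: "complex^2^2"
  by (simp add: trace_def sum_2)

lemma mat_2_eq_iff: "A = B \<longleftrightarrow> A$1$1 = B$1$1 \<and> A$1$2 = B$1$2 \<and> A$2$1 = B$2$1 \<and> A$2$2 = B$2$2"
  for A B :: "complex^2^2"
  by (auto simp: vec_eq_iff forall_2)

lemma det_mat_of_SL2:
  "mat_of_SL2 A $ 1 $ 1 * mat_of_SL2 A $ 2 $ 2 - mat_of_SL2 A $ 1 $ 2 * mat_of_SL2 A $ 2 $ 1 = 1"
  using mat_of_SL2[of A] by (simp add: det_2)

lemma power_fun_apply: "(f ^ n) x = f x ^ n" for f :: "'a \<Rightarrow> 'b::comm_monoid_mult"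
  by (induction n) (simp_all add: fun_apply)

lemma sum_fun_apply: "(sum F I) x = (\<Sum>i\<in>I. F i x)" for F :: "'i \<Rightarrow> 'a \<Rightarrow> complex"
  by (induction I rule: infinite_finite_induct) (simp_all add: fun_apply)

abbreviation word :: "4 list \<Rightarrow> rep \<Rightarrow> complex^2^2"
  where "word w \<rho> \<equiv> mat_of_SL2 (prod_list (map \<rho> w))"

lemma word_append: "word (u @ v) \<rho> = word u \<rho> ** word v \<rho>"
  by (simp add: times_SL2.rep_eq)

lemma subalgebra_hull: "complex_subalgebra (complex_subalgebra hull S)"
  by (rule hull_in) (auto simp: complex_subalgebra_def)

lemma hull_const: "(\<lambda>_. c) \<in> complex_subalgebra hull S"
  and hull_add: "f \<in> complex_subalgebra hull S \<Longrightarrow> g \<in> complex_subalgebra hull S \<Longrightarrow>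
      f + g \<in> complex_subalgebra hull S"
  and hull_mult: "f \<in> complex_subalgebra hull S \<Longrightarrow> g \<in> complex_subalgebra hull S \<Longrightarrow>
      f * g \<in> complex_subalgebra hull S"
  using subalgebra_hull[of S] by (auto simp: complex_subalgebra_def)

lemma hull_zero: "0 \<in> complex_subalgebra hull S"
  using hull_const[of 0 S] by (simp add: zero_fun_def)

lemma hull_one: "1 \<in> complex_subalgebra hull S"
  using hull_const[of 1 S] by (simp add: one_fun_def)

lemma hull_numeral: "numeral n \<in> complex_subalgebra hull S"
  using hull_const[of "numeral n" S] by (simp add: numeral_fun)

lemma hull_uminus: "f \<in> complex_subalgebra hull S \<Longrightarrow> - f \<in> complex_subalgebra hull S"
  using hull_mult[OF hull_const[of "-1" S], of f] by (simp add: times_fun_def fun_Compl_def)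

lemma hull_diff: "f \<in> complex_subalgebra hull S \<Longrightarrow> g \<in> complex_subalgebra hull S \<Longrightarrow>
    f - g \<in> complex_subalgebra hull S"
  using hull_add[OF _ hull_uminus, of f S g] by simp

lemma hull_power: "f \<in> complex_subalgebra hull S \<Longrightarrow> f ^ n \<in> complex_subalgebra hull S"
  by (induction n) (auto intro: hull_one hull_mult)

lemma hull_sum: "(\<And>i. i \<in> I \<Longrightarrow> f i \<in> complex_subalgebra hull S) \<Longrightarrow> sum f I \<in> complex_subalgebra hull S"
  by (induction I rule: infinite_finite_induct) (auto intro: hull_zero hull_add)

lemma hull_prod: "(\<And>i. i \<in> I \<Longrightarrow> f i \<in> complex_subalgebra hull S) \<Longrightarrow> prod f I \<in> complex_subalgebra hull S"
  by (induction I rule: infinite_finite_induct) (auto intro: hull_one hull_mult)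

lemmas hull_intros = hull_const hull_add hull_mult hull_zero hull_one hull_numeral hull_uminus hull_diff
    hull_power

subsection \<open>Invariants are trace polynomials\<close>

type_synonym matvar_fun = "(2 \<times> 2 \<Rightarrow> complex) \<Rightarrow> rep \<Rightarrow> complex"

text \<open>The coefficients are arbitrary functions of the representation; differentiation in
  \<open>p\<close> treats them as constants.\<close>

inductive matvar_poly :: "matvar_fun \<Rightarrow> bool" where
  const: "matvar_poly (\<lambda>p. c)"
| coord: "matvar_poly (\<lambda>p \<rho>. p k)"
| add: "matvar_poly h \<Longrightarrow> matvar_poly q \<Longrightarrow> matvar_poly (h + q)"
| mult: "matvar_poly h \<Longrightarrow> matvar_poly q \<Longrightarrow> matvar_poly (h * q)"

text \<open>The derivative is taken analytically, so it depends only on the function and not on a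
  polynomial expression chosen for it.\<close>

definition pdiff :: "2 \<times> 2 \<Rightarrow> matvar_fun \<Rightarrow> matvar_fun"
  where "pdiff k h = (\<lambda>p \<rho>. deriv (\<lambda>z. h (p(k := z)) \<rho>) (p k))"

lemma matvar_poly_differentiable:
  "matvar_poly h \<Longrightarrow> (\<lambda>z. h (p(k := z)) \<rho>) field_differentiable at w"
proof (induction rule: matvar_poly.induct)
  case (coord l)
  then show ?case by (cases "l = k") simp_all
next
  case (add h q)
  then show ?case using field_differentiable_add by (auto simp: plus_fun_def)
next
  case (mult h q)
  then show ?case using field_differentiable_mult by (auto simp: times_fun_def)
qed simp

lemma pdiff_const: "pdiff k (\<lambda>p. c) = 0"
  by (simp add: pdiff_def zero_fun_def)

lemma pdiff_coord: "pdiff k (\<lambda>p \<rho>. p l) = (if k = l then 1 else 0)"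
  by (auto simp: pdiff_def zero_fun_def one_fun_def fun_eq_iff fun_apply)

lemma pdiff_add:
  assumes "matvar_poly h" "matvar_poly q"
  shows "pdiff k (h + q) = pdiff k h + pdiff k q"
  using assms by (simp add: pdiff_def plus_fun_def deriv_add matvar_poly_differentiable)

lemma pdiff_mult:
  assumes "matvar_poly h" "matvar_poly q"
  shows "pdiff k (h * q) = h * pdiff k q + pdiff k h * q"
  using assms by (simp add: pdiff_def plus_fun_def times_fun_def deriv_mult matvar_poly_differentiable)

lemma matvar_poly_0: "matvar_poly 0" and matvar_poly_1: "matvar_poly 1"
  using matvar_poly.const[of "\<lambda>_. 0"] matvar_poly.const[of "\<lambda>_. 1"]
      by (simp_all add: zero_fun_def one_fun_def)

lemma matvar_poly_uminus: "matvar_poly h \<Longrightarrow> matvar_poly (- h)"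
  using matvar_poly.mult[OF matvar_poly.const[of "\<lambda>_. -1"], of h] by (simp add: times_fun_def fun_Compl_def)

lemma matvar_poly_diff: "matvar_poly h \<Longrightarrow> matvar_poly q \<Longrightarrow> matvar_poly (h - q)"
  using matvar_poly.add[OF _ matvar_poly_uminus, of h q] by simp

lemma matvar_poly_pdiff: "matvar_poly h \<Longrightarrow> matvar_poly (pdiff k h)"
  by (induction rule: matvar_poly.induct)
    (auto simp: pdiff_const pdiff_coord pdiff_add pdiff_mult intro: matvar_poly.intros matvar_poly_0
        matvar_poly_1)

text \<open>Cayley's \<open>\<Omega>\<close> operator.\<close>

definition omega :: "matvar_fun \<Rightarrow> matvar_fun"
  where "omega h = pdiff (1,1) (pdiff (2,2) h) - pdiff (1,2) (pdiff (2,1) h)"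

text \<open>The mixed terms that arise when the second-order operator \<open>omega\<close> is
  applied to a product.\<close>

definition omega_cross :: "matvar_fun \<Rightarrow> matvar_fun \<Rightarrow> matvar_fun"
  where "omega_cross h q = pdiff (1,1) h * pdiff (2,2) q + pdiff (2,2) h * pdiff (1,1) q
    - pdiff (1,2) h * pdiff (2,1) q - pdiff (2,1) h * pdiff (1,2) q"

lemma omega_const: "omega (\<lambda>p. c) = 0"
  by (simp add: omega_def pdiff_const zero_fun_def)

lemma omega_add: "matvar_poly h \<Longrightarrow> matvar_poly q \<Longrightarrow> omega (h + q) = omega h + omega q"
  by (simp add: omega_def pdiff_add matvar_poly_pdiff)

lemma omega_mult:
  "matvar_poly h \<Longrightarrow> matvar_poly q \<Longrightarrow> omega (h * q) = omega h * q + h * omega q + omega_cross h q"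
  by (simp add: omega_def omega_cross_def pdiff_add pdiff_mult matvar_poly_pdiff matvar_poly.mult
      algebra_simps)

lemma omega_cross_const: "omega_cross (\<lambda>p. c) q = 0"
  by (simp add: omega_cross_def pdiff_const)

lemma omega_cross_add: "matvar_poly h \<Longrightarrow> matvar_poly q \<Longrightarrow>
    omega_cross (h + q) r = omega_cross h r + omega_cross q r"
  by (simp add: omega_cross_def pdiff_add algebra_simps)

lemma omega_cross_mult: "matvar_poly h \<Longrightarrow> matvar_poly q \<Longrightarrow>
    omega_cross (h * q) r = omega_cross h r * q + omega_cross q r * h"
  by (simp add: omega_cross_def pdiff_mult algebra_simps)

text \<open>For an invertible matrix of variables \<open>p\<close>, the entries of \<open>p W adj(p)\<close> are, up to sign and
  order, the values \<open>conj_entry W i j p\<close>.\<close>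

definition conj_entry :: "(rep \<Rightarrow> complex^2^2) \<Rightarrow> 2 \<Rightarrow> 2 \<Rightarrow> matvar_fun"
  where "conj_entry W i j = (\<lambda>p \<rho>.
    p (i,1) * (W \<rho> $ 1 $ 1 * p (j,2) - W \<rho> $ 1 $ 2 * p (j,1))
        + p (i,2) * (W \<rho> $ 2 $ 1 * p (j,2) - W \<rho> $ 2 $ 2 * p (j,1)))"

lemma conj_entry_alt:
  "conj_entry W i j =
    (\<lambda>p \<rho>. p (i,1)) * ((\<lambda>p \<rho>. W \<rho> $ 1 $ 1) * (\<lambda>p \<rho>. p (j,2)) - (\<lambda>p \<rho>. W \<rho> $ 1 $ 2) * (\<lambda>p \<rho>. p (j,1))) +
    (\<lambda>p \<rho>. p (i,2)) * ((\<lambda>p \<rho>. W \<rho> $ 2 $ 1) * (\<lambda>p \<rho>. p (j,2)) - (\<lambda>p \<rho>. W \<rho> $ 2 $ 2) * (\<lambda>p \<rho>. p (j,1)))"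
  by (simp add: conj_entry_def plus_fun_def times_fun_def fun_diff_def)

lemma pdiff_uminus: "matvar_poly h \<Longrightarrow> pdiff k (- h) = - pdiff k h"
  using pdiff_mult[OF matvar_poly.const[of "\<lambda>_. -1"], of h k]
  by (simp add: pdiff_const times_fun_def fun_Compl_def plus_fun_def zero_fun_def)

lemma pdiff_diff: "matvar_poly h \<Longrightarrow> matvar_poly q \<Longrightarrow> pdiff k (h - q) = pdiff k h - pdiff k q"
  using pdiff_add[OF _ matvar_poly_uminus, of h q k] by (simp add: pdiff_uminus)

lemma conj_entry_poly: "matvar_poly (conj_entry W i j)"
  unfolding conj_entry_alt by (intro matvar_poly.intros matvar_poly_diff)

lemma pdiff_conj_entry:
  "pdiff k (conj_entry W i j) =
    (if k = (i,1) then (\<lambda>p \<rho>. W \<rho> $ 1 $ 1 * p (j,2) - W \<rho> $ 1 $ 2 * p (j,1)) else 0) +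
    (if k = (i,2) then (\<lambda>p \<rho>. W \<rho> $ 2 $ 1 * p (j,2) - W \<rho> $ 2 $ 2 * p (j,1)) else 0) +
    (if k = (j,2) then (\<lambda>p \<rho>. p (i,1) * W \<rho> $ 1 $ 1 + p (i,2) * W \<rho> $ 2 $ 1) else 0) -
    (if k = (j,1) then (\<lambda>p \<rho>. p (i,1) * W \<rho> $ 1 $ 2 + p (i,2) * W \<rho> $ 2 $ 2) else 0)"
  unfolding conj_entry_alt
  by (simp add: pdiff_add pdiff_mult pdiff_diff pdiff_coord pdiff_const matvar_poly.intros matvar_poly_diff)
     (auto simp: fun_eq_iff fun_apply algebra_simps)

definition eps :: "2 \<Rightarrow> 2 \<Rightarrow> complex"
  where "eps i j = (if i = j then 0 else if i = 1 then 1 else - 1)"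

text \<open>The contractions produce \<open>VW\<close>, \<open>adj(V)W\<close>, \<open>V adj(W)\<close> and \<open>adj(V)adj(W)\<close>, where \<open>adj(W) = tr(W) - W\<close>.\<close>

lemma omega_cross_conj_entry:
  "omega_cross (conj_entry V i j) (conj_entry W k l) =
    (\<lambda>p \<rho>.
      eps i k * (trace (V \<rho>) * conj_entry W j l p \<rho> - conj_entry (\<lambda>\<rho>. V \<rho> ** W \<rho>) j l p \<rho>)
    - eps j k * conj_entry (\<lambda>\<rho>. V \<rho> ** W \<rho>) i l p \<rho>
    + eps j l * (trace (W \<rho>) * conj_entry V i k p \<rho> - conj_entry (\<lambda>\<rho>. V \<rho> ** W \<rho>) i k p \<rho>)
    - eps i l * (trace (V \<rho>) * trace (W \<rho>) * conj_entry (\<lambda>_. mat 1) j k p \<rho>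
        - trace (V \<rho>) * conj_entry W j k p \<rho> - trace (W \<rho>) * conj_entry V j k p \<rho>
        + conj_entry (\<lambda>\<rho>. V \<rho> ** W \<rho>) j k p \<rho>))"
  using exhaust_2[of i] exhaust_2[of j] exhaust_2[of k] exhaust_2[of l]
  by (elim disjE; simp add: omega_cross_def pdiff_conj_entry;
      simp add: fun_eq_iff fun_apply eps_def conj_entry_def matmul_2 trace_2 mat_def algebra_simps)

text \<open>Here both row indices of a single factor are contracted, which closes the word up into
  its trace.\<close>

lemma omega_conj_entry:
  "omega (conj_entry W i j) = (\<lambda>p \<rho>. eps i j * trace (W \<rho>))"
proof -
  have "pdiff k (\<lambda>p \<rho>. a \<rho> * p u - b \<rho> * p v) =
     (\<lambda>p \<rho>. (if k = u then a \<rho> else 0) - (if k = v then b \<rho> else 0))"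
    and "pdiff k (\<lambda>p \<rho>. p u * a \<rho> + p v * b \<rho>) =
     (\<lambda>p \<rho>. (if k = u then a \<rho> else 0) + (if k = v then b \<rho> else 0))" for k u v and a b :: "rep \<Rightarrow> complex"
  proof -
    show "pdiff k (\<lambda>p \<rho>. a \<rho> * p u - b \<rho> * p v) =
     (\<lambda>p \<rho>. (if k = u then a \<rho> else 0) - (if k = v then b \<rho> else 0))"
    using pdiff_diff[OF matvar_poly.mult[OF matvar_poly.const matvar_poly.coord] matvar_poly.mult[OF
        matvar_poly.const matvar_poly.coord], of k a u b v]
    by (simp add: pdiff_mult matvar_poly.intros pdiff_const pdiff_coord)
       (auto simp: fun_eq_iff fun_apply times_fun_def fun_diff_def)
    show "pdiff k (\<lambda>p \<rho>. p u * a \<rho> + p v * b \<rho>) =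
     (\<lambda>p \<rho>. (if k = u then a \<rho> else 0) + (if k = v then b \<rho> else 0))"
    using pdiff_add[OF matvar_poly.mult[OF matvar_poly.coord matvar_poly.const] matvar_poly.mult[OF
        matvar_poly.coord matvar_poly.const], of k u a v b]
    by (simp add: pdiff_mult matvar_poly.intros pdiff_const pdiff_coord)
       (auto simp: fun_eq_iff fun_apply times_fun_def plus_fun_def)
  qed
  note pdiffs = this
  have polys: "matvar_poly (\<lambda>p \<rho>. a \<rho> * p u - b \<rho> * p v)" "matvar_poly (\<lambda>p \<rho>. p u * a \<rho> + p v * b \<rho>)"
    for u v and a b :: "rep \<Rightarrow> complex"
    using matvar_poly_diff[OF matvar_poly.mult[OF matvar_poly.const matvar_poly.coord] matvar_poly.mult[OF
        matvar_poly.const matvar_poly.coord], of a u b v]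
      matvar_poly.add[OF matvar_poly.mult[OF matvar_poly.coord matvar_poly.const] matvar_poly.mult[OF
          matvar_poly.coord matvar_poly.const], of u a v b]
    by (simp_all add: times_fun_def plus_fun_def fun_diff_def)
  show ?thesis
    using exhaust_2[of i] exhaust_2[of j]
    by (elim disjE; simp add: omega_def pdiff_conj_entry pdiff_const[of _ 0,
        folded zero_fun_def] pdiffs pdiff_add pdiff_diff polys pdiff_uminus;
        simp add: fun_eq_iff fun_apply eps_def trace_2)
qed

section \<open>The shape that the Omega process preserves\<close>

definition trace_ring :: "(rep \<Rightarrow> complex) set"
  where "trace_ring = complex_subalgebra hull (range tr)"

text \<open>Sums of products of exactly \<open>n\<close> conjugated entries, hence homogeneous of
  degree \<open>2 * n\<close> in \<open>p\<close>, with coefficients that are polynomials in traces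
  of words.\<close>

inductive conj_poly :: "nat \<Rightarrow> matvar_fun \<Rightarrow> bool" where
  const: "r \<in> trace_ring \<Longrightarrow> conj_poly 0 (\<lambda>p. r)"
| entry: "conj_poly n h \<Longrightarrow> conj_poly (Suc n) (h * conj_entry (word w) i j)"
| add: "conj_poly n h \<Longrightarrow> conj_poly n q \<Longrightarrow> conj_poly n (h + q)"

lemma conj_poly_matvar_poly: "conj_poly n h \<Longrightarrow> matvar_poly h"
  by (induction rule: conj_poly.induct) (auto intro: matvar_poly.intros conj_entry_poly)

lemma conj_poly_scale: "conj_poly n h \<Longrightarrow> r \<in> trace_ring \<Longrightarrow> conj_poly n ((\<lambda>p. r) * h)"
proof (induction rule: conj_poly.induct)
  case (const r')
  then show ?case using conj_poly.const[of "r * r'"] hull_mult[of r "range tr" r']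
      by (simp add: trace_ring_def times_fun_def)
next
  case (entry n h w i j)
  then show ?case using conj_poly.entry[of n "(\<lambda>p. r) * h" w i j] by (simp add: mult.assoc)
next
  case (add n h q)
  then show ?case using conj_poly.add by (simp add: distrib_left)
qed

lemma conj_poly_0: "conj_poly n 0"
proof (induction n)
  case 0
  show ?case using conj_poly.const[of 0] hull_zero[of "range tr"] by (simp add: trace_ring_def zero_fun_def)
next
  case (Suc n)
  then show ?case using conj_poly.entry[of n 0] by simp
qed

lemma conj_poly_uminus: "conj_poly n h \<Longrightarrow> conj_poly n (- h)"
  using conj_poly_scale[of n h "\<lambda>_. -1"] by (simp add: trace_ring_def hull_const times_fun_def fun_Compl_def)

lemma conj_poly_mult: "conj_poly n h \<Longrightarrow> conj_poly m q \<Longrightarrow> conj_poly (n + m) (h * q)"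
proof (induction n h rule: conj_poly.induct)
  case (const r)
  then show ?case using conj_poly_scale by simp
next
  case (entry n h w i j)
  then show ?case using conj_poly.entry[of "n + m" "h * q" w i j] by (simp add: ac_simps)
next
  case (add n h q')
  then show ?case using conj_poly.add by (simp add: distrib_right)
qed

lemma conj_poly_entry: "conj_poly 1 (conj_entry (word w) i j)"
  using conj_poly.entry[OF conj_poly.const[OF hull_one[of "range tr", folded trace_ring_def]], of w i j]
  by (simp flip: one_fun_def)

lemma trace_word_in: "(\<lambda>\<rho>. trace (word w \<rho>)) \<in> trace_ring"
  unfolding trace_ring_def by (rule hull_inc) (auto simp: tr_def)

lemma conj_poly_omega_cross_entry:
  "conj_poly 1 (omega_cross (conj_entry (word v) i j) (conj_entry (word w) k l))"
proof -
  let ?c = "\<lambda>r. (\<lambda>p::2\<times>2\<Rightarrow>complex. r) :: matvar_fun"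
  let ?e = "\<lambda>i k. ?c (\<lambda>_. eps i k)" and ?tv = "?c (\<lambda>\<rho>. trace (word v \<rho>))" and ?tw =
      "?c (\<lambda>\<rho>. trace (word w \<rho>))"
  \<comment> \<open>Differences are written as sums with negatives and \<open>mat 1\<close> as the
    empty word, to match the closure rules of \<open>conj_poly\<close>.\<close>
  have eq: "omega_cross (conj_entry (word v) i j) (conj_entry (word w) k l) =
     ?e i k * (?tv * conj_entry (word w) j l + - conj_entry (word (v @ w)) j l)
    + - (?e j k * conj_entry (word (v @ w)) i l)
    + ?e j l * (?tw * conj_entry (word v) i k + - conj_entry (word (v @ w)) i k)
    + - (?e i l * (?tv * (?tw * conj_entry (word []) j k)
        + - (?tv * conj_entry (word w) j k) + - (?tw * conj_entry (word v) j k)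
        + conj_entry (word (v @ w)) j k))"
    unfolding omega_cross_conj_entry word_append
    by (simp add: fun_eq_iff fun_apply one_SL2.rep_eq algebra_simps)
  have e: "(\<lambda>_. eps i k) \<in> trace_ring" for i k
    by (simp add: trace_ring_def hull_const)
  show ?thesis unfolding eq
    by (intro conj_poly.add conj_poly_scale conj_poly_uminus conj_poly_entry e trace_word_in)
qed

text \<open>The cross term is a derivation in its first argument, and on a single factor it merges
  two words into one. So \<open>n + 1\<close> factors become \<open>n\<close>.\<close>

lemma conj_poly_omega_cross: "conj_poly n h \<Longrightarrow> conj_poly n (omega_cross h (conj_entry (word w) i j))"
proof (induction rule: conj_poly.induct)
  case (const r)
  show ?case by (simp add: omega_cross_const conj_poly_0)
next
  case (entry n h v k l)
  then show ?case
    using conj_poly.entry[of n "omega_cross h (conj_entry (word w) i j)" v k l]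
      conj_poly_mult[OF conj_poly_omega_cross_entry entry.hyps, of v k l w i j]
    by (simp add: omega_cross_mult conj_poly_matvar_poly conj_entry_poly conj_poly.add)
next
  case (add n h q)
  then show ?case by (simp add: omega_cross_add conj_poly_matvar_poly conj_poly.add)
qed

text \<open>Omega either closes one factor to a trace or merges two factors, so one factor is lost.
  The first conjunct is carried along because \<open>n - 1\<close> is truncated: for
  \<open>n = 0\<close> the term \<open>omega h * conj_entry\<close> has the right number of factors
  only by vanishing.\<close>

lemma conj_poly_omega: "conj_poly n h \<Longrightarrow> (n = 0 \<longrightarrow> omega h = 0) \<and> conj_poly (n - 1) (omega h)"
proof (induction rule: conj_poly.induct)
  case (const r)
  show ?case by (simp add: omega_const conj_poly_0)
next
  case (entry n h w i j)
  have "conj_poly n (omega h * conj_entry (word w) i j)"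
  proof (cases n)
    case 0
    then show ?thesis using entry by (simp add: conj_poly_0)
  next
    case (Suc m)
    then show ?thesis using entry conj_poly.entry by simp
  qed
  moreover have "conj_poly n (h * omega (conj_entry (word w) i j))"
  proof -
    have "(\<lambda>\<rho>. eps i j * trace (word w \<rho>)) \<in> trace_ring"
      using hull_mult[OF hull_const[of "eps i j"] trace_word_in[of w, unfolded trace_ring_def]]
      by (simp add: trace_ring_def times_fun_def)
    from conj_poly_scale[OF entry.hyps this] show ?thesis
      by (simp add: omega_conj_entry mult.commute)
  qed
  ultimately show ?case
    using conj_poly_omega_cross[OF entry.hyps]
    by (simp add: omega_mult conj_poly_matvar_poly[OF entry.hyps] conj_entry_poly conj_poly.add)
next
  case (add n h q)
  then show ?case by (simp add: omega_add conj_poly_matvar_poly conj_poly.add)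
qed

definition det_var :: matvar_fun
  where "det_var = (\<lambda>p \<rho>. p (1,1) * p (2,2) - p (1,2) * p (2,1))"

lemma det_var_eq: "det_var = conj_entry (word []) 1 2"
  by (simp add: det_var_def conj_entry_def one_SL2.rep_eq mat_def fun_eq_iff fun_apply)

lemma conj_poly_det_var: "conj_poly n (det_var ^ n)"
proof (induction n)
  case 0
  show ?case using conj_poly.const[OF hull_one[of "range tr", folded trace_ring_def]]
      by (simp flip: one_fun_def)
next
  case (Suc n)
  then show ?case using conj_poly.entry[of n "det_var ^ n" "[]" 1 2] by (simp add: det_var_eq mult.commute)
qed

lemma matvar_poly_power: "matvar_poly h \<Longrightarrow> matvar_poly (h ^ n)"
  by (induction n) (auto intro: matvar_poly.mult matvar_poly_1)

lemma pdiff_power: "matvar_poly h \<Longrightarrow> pdiff k (h ^ Suc n) = of_nat (Suc n) * h ^ n * pdiff k h"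
proof (induction n)
  case (Suc n)
  then show ?case
    using pdiff_mult[OF Suc.prems matvar_poly_power[OF Suc.prems, of "Suc n"], of k]
    by (simp add: algebra_simps)
qed simp

text \<open>Cayley's identity in size 2. Its numerical factor is nonzero, which permits the division
  in \<open>trace_ring_descend\<close>.\<close>

lemma omega_det_power: "omega (det_var ^ Suc n) = of_nat (Suc n * (n + 2)) * det_var ^ n"
proof (induction n)
  case 0
  show ?case by (simp add: det_var_eq omega_conj_entry one_SL2.rep_eq eps_def trace_2 mat_def fun_eq_iff
      fun_apply numeral_fun)
next
  case (Suc n)
  have det: "matvar_poly det_var" by (simp add: det_var_eq conj_entry_poly)
  have "omega_cross det_var det_var = 2 * det_var"
    unfolding det_var_eq omega_cross_conj_entry
    by (simp add: matmul_2  omega_cross_conj_entry one_SL2.rep_eq eps_def trace_2 mat_def fun_eq_iff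
        fun_apply conj_entry_def numeral_fun)
  moreover have "omega_cross (det_var ^ Suc n) det_var = of_nat (Suc n) * det_var ^ n * omega_cross
      det_var det_var"
    by (simp add: omega_cross_def pdiff_power det algebra_simps del: power_Suc)
  moreover have "omega det_var = 2"
    by (simp add: det_var_eq omega_conj_entry one_SL2.rep_eq eps_def trace_2 mat_def fun_eq_iff fun_apply
        numeral_fun)
  ultimately have "omega (det_var ^ Suc n * det_var) = of_nat (Suc n * (n + 2)) * det_var ^ n * det_var
      + det_var ^ Suc n * 2 + of_nat (Suc n) * det_var ^ n * (2 * det_var)"
    by (simp add: omega_mult matvar_poly_power[OF det] det Suc del: power_Suc of_nat_mult of_nat_Suc)
  then show ?case by (simp add: algebra_simps)
qed

text \<open>Since \<open>f\<close> does not involve \<open>p\<close>, Omega acts only on the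
  determinant power and lowers it by one. At \<open>n = 0\<close> no conjugated entries are left and
  the expression is its own coefficient.\<close>

lemma trace_ring_descend:
  assumes "conj_poly n ((\<lambda>p. f) * det_var ^ n)"
  shows "f \<in> trace_ring"
  using assms
proof (induction n)
  case 0
  have "\<exists>r\<in>trace_ring. h = (\<lambda>p. r)" if "conj_poly n h" "n = 0" for n h
    using that
  proof (induction rule: conj_poly.induct)
    case (add n h q)
    then obtain r s where "r \<in> trace_ring" "s \<in> trace_ring" "h = (\<lambda>p. r)" "q = (\<lambda>p. s)" by auto
    then show ?case by (intro bexI[of _ "r + s"]) (auto simp: plus_fun_def trace_ring_def dest: hull_add)
  qed auto
  from this[OF 0] show ?case by (auto simp: fun_eq_iff fun_apply)
next
  case (Suc n)
  have det: "matvar_poly det_var" by (simp add: det_var_eq conj_entry_poly)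
  let ?N = "of_nat (Suc n * (n + 2)) :: complex"
  have "conj_poly n (omega ((\<lambda>p. f) * det_var ^ Suc n))"
    using conj_poly_omega[OF Suc.prems] by simp
  also have "omega ((\<lambda>p. f) * det_var ^ Suc n) = (\<lambda>p. f) * (of_nat (Suc n * (n + 2)) * det_var ^ n)"
    by (simp add: omega_mult matvar_poly.const matvar_poly_power[OF det] omega_const omega_cross_const
        omega_det_power del: power_Suc)
  finally have "conj_poly n ((\<lambda>p. (\<lambda>\<rho>. inverse ?N)) * ((\<lambda>p. f) * (of_nat (Suc n * (n + 2)) * det_var ^ n)))"
    by (rule conj_poly_scale) (simp add: trace_ring_def hull_const)
  also have "(\<lambda>p. (\<lambda>\<rho>. inverse ?N)) * ((\<lambda>p. f) * (of_nat (Suc n * (n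
      + 2)) * det_var ^ n)) = (\<lambda>p. f) * det_var ^ n"
    \<comment> \<open>The successor of \<open>n * (n+2) + n + 1\<close> is
      \<open>Suc n * (n + 2)\<close>, so \<open>?N\<close> can be inverted.\<close>
    using of_nat_neq_0[of "n * (n+2) + n + 1", where 'a=complex]
    by (simp add: fun_eq_iff fun_apply of_nat_fun del: of_nat_mult of_nat_add of_nat_Suc)
  finally show ?case by (rule Suc.IH)
qed


section \<open>Conjugation as a polynomial substitution\<close>

lemma matrix_inv_SL2:
  "mat_of_SL2 g ** matrix_inv (mat_of_SL2 g) = mat 1" "matrix_inv (mat_of_SL2 g) ** mat_of_SL2 g = mat 1"
proof -
  have "\<exists>h. mat_of_SL2 g ** h = mat 1 \<and> h ** mat_of_SL2 g = mat 1"
    using mat_of_SL2[of g] invertible_det_nz[of "mat_of_SL2 g"] by (simp add: invertible_def)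
  from someI_ex[OF this] show "mat_of_SL2 g ** matrix_inv (mat_of_SL2 g) = mat 1"
    "matrix_inv (mat_of_SL2 g) ** mat_of_SL2 g = mat 1"
    by (simp_all add: matrix_inv_def)
qed

lemma mat_of_conj_SL2:
  fixes g A :: SL2
  defines "G \<equiv> mat_of_SL2 g" and "M \<equiv> mat_of_SL2 A"
  shows "mat_of_SL2 (conj_SL2 g A) $ i $ 1 =
      G $ i $ 1 * (M $ 1 $ 1 * G $ 2 $ 2 - M $ 1 $ 2 * G $ 2 $ 1)
          + G $ i $ 2 * (M $ 2 $ 1 * G $ 2 $ 2 - M $ 2 $ 2 * G $ 2 $ 1)"
    and "mat_of_SL2 (conj_SL2 g A) $ i $ 2 =
      - G $ i $ 1 * (M $ 1 $ 1 * G $ 1 $ 2 - M $ 1 $ 2 * G $ 1 $ 1) - G $ i $ 2 * (M $ 2 $ 1 * G $ 1 $ 2 -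
          M $ 2 $ 2 * G $ 1 $ 1)"
proof -
  \<comment> \<open>The adjugate of \<open>G\<close>, which is its inverse because the determinant
    is 1; it makes the entries of the conjugate polynomial in \<open>G\<close>.\<close>
  define H :: "complex^2^2" where
    "H = (\<chi> i j. if i = j then G $ (if i = 1 then 2 else 1) $ (if i = 1 then 2 else 1) else - G $ i $ j)"
  have "H ** G = mat 1"
    using det_mat_of_SL2[of g]
    by (simp add: mat_2_eq_iff matmul_2 H_def G_def mat_def algebra_simps)
  then have "matrix_inv G = H"
    using matrix_inv_SL2(1)[of g] unfolding G_def by (metis matrix_mul_assoc matrix_mul_lid matrix_mul_rid)
  then have "mat_of_SL2 (conj_SL2 g A) = G ** M ** H"
    by (simp add: conj_SL2.rep_eq G_def M_def)
  then show "mat_of_SL2 (conj_SL2 g A) $ i $ 1 =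
      G $ i $ 1 * (M $ 1 $ 1 * G $ 2 $ 2 - M $ 1 $ 2 * G $ 2 $ 1)
          + G $ i $ 2 * (M $ 2 $ 1 * G $ 2 $ 2 - M $ 2 $ 2 * G $ 2 $ 1)"
    "mat_of_SL2 (conj_SL2 g A) $ i $ 2 =
      - G $ i $ 1 * (M $ 1 $ 1 * G $ 1 $ 2 - M $ 1 $ 2 * G $ 1 $ 1) - G $ i $ 2 * (M $ 2 $ 1 * G $ 1 $ 2 -
          M $ 2 $ 2 * G $ 1 $ 1)"
    by (simp_all add: matmul_2 H_def algebra_simps)
qed

text \<open>Every invertible complex matrix has this form, with \<open>c\<close> a square root of
  its determinant.\<close>

definition scaled_matrix :: "complex \<Rightarrow> SL2 \<Rightarrow> 2 \<times> 2 \<Rightarrow> complex"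
  where "scaled_matrix c g = (\<lambda>(i, k). c * mat_of_SL2 g $ i $ k)"

lemma det_var_scaled_matrix: "det_var (scaled_matrix c g) \<rho> = c\<^sup>2"
proof -
  have "det_var (scaled_matrix c g) \<rho> = c\<^sup>2 * (mat_of_SL2 g $ 1 $ 1 * mat_of_SL2 g $ 2 $ 2 - mat_of_SL2 g
      $ 1 $ 2 * mat_of_SL2 g $ 2 $ 1)"
    by (simp add: det_var_def scaled_matrix_def power2_eq_square algebra_simps)
  then show ?thesis by (simp add: det_mat_of_SL2)
qed

text \<open>Powers of \<open>det g\<close> equalise the degrees in \<open>g\<close>.\<close>

lemma polynomial_function_homogenize:
  assumes "f \<in> polynomial_functions"
  shows "\<exists>n h. conj_poly n h \<and> (\<forall>c g \<rho>. h (scaled_matrix c g) \<rho> = c ^ (2 * n) * f (\<lambda>i. conj_SL2 g (\<rho> i)))"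
proof (rule hull_induct[OF assms[unfolded polynomial_functions_def]])
  let ?P = "\<lambda>f. \<exists>n h. conj_poly n h \<and> (\<forall>c g \<rho>. h (scaled_matrix c g) \<rho> = c ^ (2 * n) * f (\<lambda>i. conj_SL2 g
      (\<rho> i)))"
  fix x :: "rep \<Rightarrow> complex"
  assume "x \<in> {\<lambda>\<rho>. mat_of_SL2 (\<rho> i) $ j $ k |i j k. True}"
  then obtain i j k where x: "x = (\<lambda>\<rho>. mat_of_SL2 (\<rho> i) $ j $ k)" by auto
  \<comment> \<open>The adjugate exchanges the two rows of \<open>g\<close> up to sign, so column 1
    of the conjugate is an entry with second index 2, and column 2 is minus an entry with second
    index 1.\<close>
  have "conj_entry (word [i]) j 2 (scaled_matrix c g) \<rho> = c ^ 2 * (mat_of_SL2 (conj_SL2 g (\<rho> i)) $ j $ 1)"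
    "(- conj_entry (word [i]) j 1) (scaled_matrix c g) \<rho> = c ^ 2 * (mat_of_SL2 (conj_SL2 g (\<rho> i)) $ j $
        2)" for c g \<rho>
    unfolding mat_of_conj_SL2
    by (simp_all add: conj_entry_def scaled_matrix_def fun_apply power2_eq_square algebra_simps)
  then show "?P x"
    using exhaust_2[of k] conj_poly_entry[of "[i]" j 2] conj_poly_uminus[OF conj_poly_entry[of "[i]" j 1]]
    unfolding x by (elim disjE; intro exI[of _ "1::nat"]) auto
next
  let ?P = "\<lambda>f. \<exists>n h. conj_poly n h \<and> (\<forall>c g \<rho>. h (scaled_matrix c g) \<rho> = c ^ (2 * n) * f (\<lambda>i. conj_SL2 g
      (\<rho> i)))"
  show "complex_subalgebra {f. ?P f}"
    unfolding complex_subalgebra_def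
  proof (intro conjI ballI allI)
    fix c :: complex
    have "conj_poly 0 (\<lambda>p \<rho>. c)" by (rule conj_poly.const) (simp add: trace_ring_def hull_const)
    then show "(\<lambda>_. c) \<in> {f. ?P f}" by (intro CollectI exI[of _ 0] exI[of _ "\<lambda>p \<rho>. c"]) simp
  next
    fix f1 f2 assume "f1 \<in> {f. ?P f}" "f2 \<in> {f. ?P f}"
    then obtain n1 h1 n2 h2 where 1: "conj_poly n1 h1"
        "\<And>c g \<rho>. h1 (scaled_matrix c g) \<rho> = c ^ (2 * n1) * f1 (\<lambda>i. conj_SL2 g (\<rho> i))"
      and 2: "conj_poly n2 h2" "\<And>c g \<rho>. h2 (scaled_matrix c g) \<rho> = c ^ (2 * n2) * f2 (\<lambda>i. conj_SL2 g (\<rho> i))"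
      by auto
    show "f1 * f2 \<in> {f. ?P f}"
      using conj_poly_mult[OF 1(1) 2(1)]
      by (intro CollectI exI[of _ "n1 + n2"] exI[of _
          "h1 * h2"]) (simp add: fun_apply 1 2 power_add algebra_simps)
    have "conj_poly (n1 + n2) (h1 * det_var ^ n2 + h2 * det_var ^ n1)"
      using conj_poly_mult[OF 1(1) conj_poly_det_var[of n2]] conj_poly_mult[OF 2(1) conj_poly_det_var[of n1]]
      by (auto intro: conj_poly.add simp: add.commute)
    then show "f1 + f2 \<in> {f. ?P f}"
      by (intro CollectI exI[of _ "n1 + n2"] exI[of _ "h1 * det_var ^ n2 + h2 * det_var ^ n1"])
         (simp add: fun_apply power_fun_apply 1 2 power_add det_var_scaled_matrix algebra_simps flip:
             power_mult)
  qed
qed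

lemma matvar_poly_continuous_line:
  "matvar_poly h \<Longrightarrow> continuous_on UNIV (\<lambda>z. h (\<lambda>k. p k + z * v k) \<rho>)"
  by (induction rule: matvar_poly.induct) (auto simp: fun_apply intro!: continuous_intros)

text \<open>Singular matrices are limits of invertible ones \<open>p + z\<close> with
  \<open>z\<close> a small nonzero scalar, and both sides are continuous along this line.\<close>

lemma matvar_poly_eqI:
  assumes "matvar_poly h" "matvar_poly q" and eq: "\<And>p. det_var p \<rho> \<noteq> 0 \<Longrightarrow> h p \<rho> = q p \<rho>"
  shows "h p \<rho> = q p \<rho>"
proof -
  define L where "L z = (\<lambda>k. p k + z * (if fst k = snd k then 1 else 0))" for z
  have tends: "((\<lambda>z. r (L z) \<rho>) \<longlongrightarrow> r (L 0) \<rho>) (at 0)" if "matvar_poly r" for r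
    using matvar_poly_continuous_line[OF that, of p "\<lambda>k. if fst k = snd k then 1 else 0" \<rho>]
    unfolding L_def[symmetric] by (simp add: continuous_on_def)
  have "det_var (L z) \<rho> = z * (z + (p (1,1) + p (2,2))) + det_var p \<rho>" for z
    by (simp add: L_def det_var_def algebra_simps)
  \<comment> \<open>If \<open>det p = 0\<close>, the determinant factors as
    \<open>z * (z + trace p)\<close> and is nonzero near 0 except at 0; otherwise \<open>p\<close>
    itself is invertible.\<close>
  then have "eventually (\<lambda>z. det_var (L z) \<rho> \<noteq> 0) (at 0) \<or> det_var p \<rho> \<noteq> 0"
    using eventually_conj[OF eventually_neq_at_within[of 0 0 UNIV] eventually_neq_at_within[of "- (p (1,1)
        + p (2,2))" 0 UNIV]]
    by (auto elim!: eventually_mono simp: add_eq_0_iff2)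
  then show ?thesis
  proof
    assume "eventually (\<lambda>z. det_var (L z) \<rho> \<noteq> 0) (at 0)"
    then have "eventually (\<lambda>z. h (L z) \<rho> = q (L z) \<rho>) (at 0)"
      by eventually_elim (rule eq)
    then have "((\<lambda>z. q (L z) \<rho>) \<longlongrightarrow> h (L 0) \<rho>) (at 0)"
      using tends[OF assms(1)] by (rule Lim_transform_eventually[rotated])
    then have "h (L 0) \<rho> = q (L 0) \<rho>"
      using tends[OF assms(2)] tendsto_unique[OF at_neq_bot] by blast
    then show ?thesis by (simp add: L_def)
  qed (rule eq)
qed

text \<open>Invariance turns the homogenised conjugate of \<open>f\<close> into
  \<open>det(p)^n f\<close> at invertible \<open>p\<close>, hence at all \<open>p\<close>; the
  descent then removes the determinant power.\<close>

lemma char_ring_subset_trace_ring: "char_ring \<subseteq> trace_ring"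
proof
  fix f assume "f \<in> char_ring"
  then have f: "f \<in> polynomial_functions" "\<And>g \<rho>. f (\<lambda>i. conj_SL2 g (\<rho> i)) = f \<rho>"
    by (auto simp: char_ring_def)
  obtain n h where h: "conj_poly n h" "\<And>c g \<rho>. h (scaled_matrix c g) \<rho> = c ^ (2 * n) * f \<rho>"
    using polynomial_function_homogenize[OF f(1)] f(2) by auto
  have "h p \<rho> = ((\<lambda>p. f) * det_var ^ n) p \<rho>" for p \<rho>
  proof (rule matvar_poly_eqI[of h _ \<rho> p])
    fix p assume nz: "det_var p \<rho> \<noteq> 0"
    define c where "c = csqrt (det_var p \<rho>)"
    have c: "c\<^sup>2 = det_var p \<rho>" "c \<noteq> 0" using nz by (auto simp: c_def)
    define g where "g = Abs_SL2 (\<chi> i k. p (i, k) / c)"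
    have "det (\<chi> i k. p (i, k) / c :: complex^2^2) = det_var p \<rho> / c\<^sup>2"
      by (simp add: det_2 det_var_def power2_eq_square diff_divide_distrib)
    then have "mat_of_SL2 g = (\<chi> i k. p (i, k) / c)"
      using c nz by (simp add: g_def Abs_SL2_inverse)
    then have "p = scaled_matrix c g"
      using c(2) by (auto simp: scaled_matrix_def)
    then show "h p \<rho> = ((\<lambda>p. f) * det_var ^ n) p \<rho>"
      by (simp add: h(2) fun_apply power_fun_apply det_var_scaled_matrix power_mult)
  next
    show "matvar_poly ((\<lambda>p. f) * det_var ^ n)"
      by (intro matvar_poly.mult matvar_poly.const matvar_poly_power) (simp add: det_var_eq conj_entry_poly)
  qed (rule conj_poly_matvar_poly[OF h(1)])
  then have "h = (\<lambda>p. f) * det_var ^ n" by (simp add: fun_eq_iff)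
  then show "f \<in> trace_ring" using trace_ring_descend h(1) by simp
qed

lemma word_polynomial: "(\<lambda>\<rho>. word w \<rho> $ j $ k) \<in> polynomial_functions"
proof (induction w arbitrary: j)
  case Nil
  show ?case by (simp add: one_SL2.rep_eq polynomial_functions_def hull_const)
next
  case (Cons i w)
  have gen: "(\<lambda>\<rho>. mat_of_SL2 (\<rho> i) $ j $ l) \<in> polynomial_functions" for l
    unfolding polynomial_functions_def by (rule hull_inc) auto
  have "(\<lambda>\<rho>. word (i # w) \<rho> $ j $ k) = (\<lambda>\<rho>. mat_of_SL2 (\<rho> i) $ j $ 1) * (\<lambda>\<rho>. word w \<rho> $ 1 $ k)
      + (\<lambda>\<rho>. mat_of_SL2 (\<rho> i) $ j $ 2) * (\<lambda>\<rho>. word w \<rho> $ 2 $ k)"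
    by (simp add: fun_eq_iff fun_apply times_SL2.rep_eq matmul_2)
  then show ?case using gen Cons.IH unfolding polynomial_functions_def
    by (simp add: hull_add hull_mult)
qed

lemma conj_SL2_mult: "conj_SL2 g (A * B) = conj_SL2 g A * conj_SL2 g B" and conj_SL2_1: "conj_SL2 g 1 = 1"
proof -
  let ?G = "mat_of_SL2 g" and ?A = "mat_of_SL2 A" and ?B = "mat_of_SL2 B"
  have "?G ** ?A ** matrix_inv ?G ** (?G ** ?B ** matrix_inv ?G) = ?G ** ?A ** (matrix_inv ?G ** ?G) ** ?B
      ** matrix_inv ?G"
    by (simp only: matrix_mul_assoc)
  then have "mat_of_SL2 (conj_SL2 g (A * B)) = mat_of_SL2 (conj_SL2 g A * conj_SL2 g B)"
      "mat_of_SL2 (conj_SL2 g 1) = mat_of_SL2 1"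
    using matrix_inv_SL2[of g]
    by (simp_all add: conj_SL2.rep_eq times_SL2.rep_eq one_SL2.rep_eq matrix_mul_assoc)
  then show "conj_SL2 g (A * B) = conj_SL2 g A * conj_SL2 g B" "conj_SL2 g 1 = 1"
    by (simp_all add: mat_of_SL2_inject)
qed

lemma trace_conj_SL2: "trace (mat_of_SL2 (conj_SL2 g A)) = trace (mat_of_SL2 A)"
  by (simp add: conj_SL2.rep_eq trace_mul_sym[of _ "matrix_inv _"] matrix_mul_assoc matrix_inv_SL2)

lemma tr_in_char_ring: "tr w \<in> char_ring"
proof -
  have "tr w = (\<lambda>\<rho>. word w \<rho> $ 1 $ 1) + (\<lambda>\<rho>. word w \<rho> $ 2 $ 2)"
    by (simp add: tr_def fun_eq_iff fun_apply trace_2)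
  then have "tr w \<in> polynomial_functions"
    using word_polynomial[of w] by (simp add: polynomial_functions_def hull_add)
  moreover have "prod_list (map (\<lambda>i. conj_SL2 g (\<rho> i)) w) = conj_SL2 g (prod_list (map \<rho> w))" for g \<rho>
    by (induction w) (simp_all add: conj_SL2_mult conj_SL2_1)
  ultimately show ?thesis
    by (simp add: char_ring_def tr_def trace_conj_SL2)
qed

lemma polynomial_functions_subalgebra: "complex_subalgebra polynomial_functions"
  unfolding polynomial_functions_def by (rule subalgebra_hull)

lemma char_ring_eq_trace_ring: "char_ring = trace_ring"
proof
  have "complex_subalgebra char_ring"
    using polynomial_functions_subalgebra
    by (auto simp: complex_subalgebra_def char_ring_def fun_apply)
  then show "trace_ring \<subseteq> char_ring"
    unfolding trace_ring_def using tr_in_char_ring by (intro hull_minimal) auto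
qed (rule char_ring_subset_trace_ring)

subsection \<open>Traces of words in terms of traces of short words\<close>

definition gens :: "(rep \<Rightarrow> complex) set"
  where "gens = set Q_gens \<union> {tr [1,3], tr [2,4], tr [1,2,3], tr [1,2,4], tr [1,3,4], tr [2,3,4]}"

definition fund_ring :: "(rep \<Rightarrow> complex) set"
  where "fund_ring = complex_subalgebra hull gens"

lemma fund_ring_gens: "f \<in> gens \<Longrightarrow> f \<in> fund_ring"
  by (simp add: fund_ring_def hull_inc)

lemmas fund_ring_intros = hull_intros[where S = gens, folded fund_ring_def]

lemma tr_Nil: "tr [] = 2"
  by (simp add: tr_def one_SL2.rep_eq trace_2 mat_def fun_eq_iff fun_apply)

lemma tr_swap: "tr [i, j] = tr [j, i]"
  by (simp add: tr_def times_SL2.rep_eq trace_2 matmul_2 algebra_simps)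

lemma tr_cycle: "tr [i, j, k] = tr [j, k, i]"
  by (simp add: tr_def times_SL2.rep_eq trace_2 matmul_2 algebra_simps)

text \<open>This and \<open>tr_square2\<close> are traces of the Cayley-Hamilton identity
  \<open>A^2 = tr(A) A - 1\<close>, without and with a further factor.\<close>

lemma tr_square: "tr [i, i] = tr [i] * tr [i] - 2"
proof
  fix \<rho> :: rep
  show "tr [i, i] \<rho> = (tr [i] * tr [i] - 2) \<rho>"
    using det_mat_of_SL2[of "\<rho> i"]
    by (simp add: tr_def fun_apply times_SL2.rep_eq trace_2 matmul_2) algebra
qed

lemma tr_square2: "tr [i, i, j] = tr [i] * tr [i, j] - tr [j]"
proof
  fix \<rho> :: rep
  show "tr [i, i, j] \<rho> = (tr [i] * tr [i, j] - tr [j]) \<rho>"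
    using det_mat_of_SL2[of "\<rho> i"]
    by (simp add: tr_def fun_apply times_SL2.rep_eq trace_2 matmul_2) algebra
qed

text \<open>The sum over the two cyclic orders of a triple is a polynomial in shorter traces, so one
  order of each triple suffices among the generators.\<close>

lemma tr_reverse:
  "tr [k, j, i] = tr [i] * tr [j, k] + tr [j] * tr [i, k]
      + tr [k] * tr [i, j] - tr [i] * tr [j] * tr [k] - tr [i, j, k]"
  by (simp add: tr_def fun_eq_iff fun_apply times_SL2.rep_eq trace_2 matmul_2 algebra_simps)

text \<open>Write \<open>A\<close>, \<open>B\<close>, \<open>C\<close> as scalar plus traceless part; for traceless \<open>a\<close>, \<open>b\<close>, \<open>c\<close> one has
  \<open>2abc = tr(ab)c - tr(ac)b + tr(bc)a + tr(abc)\<close>.\<close>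

lemma tr_reduce:
  "2 * tr (i # j # k # w) = tr [i] * tr (j # k # w) + tr [j] * tr (i # k # w) + tr [k] * tr (i # j # w)
    + (tr [i, j] - tr [i] * tr [j]) * tr (k # w) - tr [i, k] * tr (j # w)
        + (tr [j, k] - tr [j] * tr [k]) * tr (i # w)
    + (tr [i, j, k] - tr [i] * tr [j, k] - tr [k] * tr [i, j] + tr [i] * tr [j] * tr [k]) * tr w"
  by (simp add: tr_def fun_eq_iff fun_apply times_SL2.rep_eq trace_2 matmul_2 algebra_simps)

lemma tr_1_in: "tr [i] \<in> fund_ring"
  using exhaust_4[of i] by (elim disjE) (auto intro!: fund_ring_gens simp: gens_def Q_gens_def)

lemma tr_2_in: "tr [i, j] \<in> fund_ring"
proof -
  have "i = j \<or> tr [i, j] \<in> gens \<or> tr [j, i] \<in> gens"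
    using exhaust_4[of i] exhaust_4[of j] by (elim disjE) (simp_all add: gens_def Q_gens_def)
  moreover have "tr [i] * tr [i] - 2 \<in> fund_ring"
    by (intro fund_ring_intros tr_1_in)
  ultimately show ?thesis
    using tr_swap[of i j] tr_square[of i] by (auto intro: fund_ring_gens)
qed

lemma tr_3_in: "tr [i, j, k] \<in> fund_ring"
proof -
  have rev: "tr [k, j, i] \<in> fund_ring" if "tr [i, j, k] \<in> fund_ring" for i j k
    unfolding tr_reverse[of k j i] using that by (intro fund_ring_intros tr_1_in tr_2_in)
  have rep: "tr [i, i, j] \<in> fund_ring" for i j
    unfolding tr_square2 by (intro fund_ring_intros tr_1_in tr_2_in)
  \<comment> \<open>Either a letter repeats, and a cyclic shift brings the repetition to the front,
    or the word permutes one of the four increasing triples.\<close>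
  have "i = j \<or> j = k \<or> k = i \<or> (\<exists>(a,b,c) \<in> {(1,2,3),(1,2,4),(1,3,4),(2,3,4)}.
     (i,j,k) \<in> {(a,b,c),(b,c,a),(c,a,b),(c,b,a),(b,a,c),(a,c,b)})"
    using exhaust_4[of i] exhaust_4[of j] exhaust_4[of k] by (elim disjE) simp_all
  moreover have "\<forall>(a,b,c) \<in> {(1,2,3),(1,2,4),(1,3,4),(2,3,4)}. tr [a,b,c] \<in> fund_ring"
    by (auto intro!: fund_ring_gens simp: gens_def)
  moreover have "tr [a,b,c] \<in> fund_ring \<Longrightarrow> (i,j,k) \<in> {(a,b,c),(b,c,a),(c,a,b),(c,b,a),(b,a,c),(a,c,b)} \<Longrightarrow>
      ?thesis" for a b c
    using rev[of a b c] tr_cycle[of a b c] tr_cycle[of b c a] tr_cycle[of c b a] tr_cycle[of b a c] by auto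
  ultimately show ?thesis
    using rep[of i k] rep[of j i] rep[of k j] tr_cycle[of i j k] tr_cycle[of j k i] by fastforce
qed

lemma tr_in_fund_ring: "tr w \<in> fund_ring"
proof (induction "length w" arbitrary: w rule: less_induct)
  case less
  consider "w = []" | i where "w = [i]" | i j where "w = [i,
      j]" | i j k v where "w = i # j # k # v" "v = [] \<or> v \<noteq> []"
    by (metis list.exhaust)
  then show ?case
  proof cases
    case (4 i j k v)
    \<comment> \<open>For \<open>v = []\<close> the identity \<open>tr_reduce\<close> contains
      \<open>2 * tr [i, j, k]\<close> on both sides and reduces nothing, so triples are a base
      case.\<close>
    then consider "v = []" | "v \<noteq> []" by blast
    then show ?thesis
    proof cases
      case 1
      then show ?thesis using 4 tr_3_in by simp
    next
      case 2
      have IH: "tr (j # k # v) \<in> fund_ring" "tr (i # k # v) \<in> fund_ring" "tr (i # j # v) \<in> fund_ring"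
        "tr (k # v) \<in> fund_ring" "tr (j # v) \<in> fund_ring" "tr (i # v) \<in> fund_ring" "tr v \<in> fund_ring"
        using 4 by (auto intro: less)
      have "2 * tr w \<in> fund_ring"
        unfolding 4(1) tr_reduce by (intro fund_ring_intros IH tr_1_in tr_2_in tr_3_in)
      from fund_ring_intros(3)[OF fund_ring_intros(1)[of "1/2"] this]
      show ?thesis by (simp add: times_fun_def fun_apply)
    qed
  qed (auto intro: tr_1_in tr_2_in simp: tr_Nil fund_ring_intros)
qed

subsection \<open>The spanning set\<close>

text \<open>The span is built one summand at a time, with repeated vectors allowed, which gives
  short inductions; \<open>rspan_explicit\<close> collects the summands afterwards.\<close>

inductive_set rspan :: "'a::comm_ring_1 set \<Rightarrow> 'a set \<Rightarrow> 'a set" for R V where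
  zero: "0 \<in> rspan R V"
| step: "r \<in> R \<Longrightarrow> v \<in> V \<Longrightarrow> h \<in> rspan R V \<Longrightarrow> r * v + h \<in> rspan R V"

lemma rspan_add: "h \<in> rspan R V \<Longrightarrow> h' \<in> rspan R V \<Longrightarrow> h + h' \<in> rspan R V"
  by (induction rule: rspan.induct) (auto simp: add.assoc intro: rspan.step)

lemma rspan_smult: "r \<in> R \<Longrightarrow> v \<in> V \<Longrightarrow> r * v \<in> rspan R V"
  using rspan.step[OF _ _ rspan.zero, of r R v V] by simp

lemma rspan_base: "1 \<in> R \<Longrightarrow> v \<in> V \<Longrightarrow> v \<in> rspan R V"
  using rspan_smult[of 1 R v V] by simp

lemma rspan_scale:
  assumes "\<And>r s. r \<in> R \<Longrightarrow> s \<in> R \<Longrightarrow> r * s \<in> R" "h \<in> rspan R V" "r \<in> R"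
  shows "r * h \<in> rspan R V"
  using assms(2)
proof induction
  case (step s v h)
  then have "(r * s) * v + r * h \<in> rspan R V" by (intro rspan.step assms(1,3))
  then show ?case by (simp add: algebra_simps)
qed (simp add: rspan.zero)

text \<open>Multiplication by \<open>z\<close> is linear over \<open>R\<close>, so its effect on a
  span is controlled by its effect on the spanning vectors.\<close>

lemma rspan_mult_closed:
  assumes "\<And>r s. r \<in> R \<Longrightarrow> s \<in> R \<Longrightarrow> r * s \<in> R" "\<And>v. v \<in> V \<Longrightarrow> z * v \<in> rspan R W" "h \<in> rspan R V"
  shows "z * h \<in> rspan R W"
  using assms(3)
proof induction
  case (step r v h)
  then have "r * (z * v) + z * h \<in> rspan R W"
    using rspan_scale[OF assms(1) assms(2)] by (blast intro: rspan_add)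
  then show ?case by (simp add: algebra_simps)
qed (simp add: rspan.zero)

lemma rspan_subset:
  assumes "\<And>r s. r \<in> R \<Longrightarrow> s \<in> R \<Longrightarrow> r * s \<in> R" "V \<subseteq> rspan R W"
  shows "rspan R V \<subseteq> rspan R W"
  using rspan_mult_closed[of R V 1 W] assms by auto

lemma Q_ring_mult: "r \<in> Q_ring \<Longrightarrow> s \<in> Q_ring \<Longrightarrow> r * s \<in> Q_ring"
  by (simp add: Q_ring_def hull_mult)

lemmas Q_ring_intros = hull_intros[where S = "set Q_gens", folded Q_ring_def]

lemma Q_ring_tr: "tr [1] \<in> Q_ring" "tr [2] \<in> Q_ring" "tr [3] \<in> Q_ring" "tr [4] \<in> Q_ring"
  "tr [1,2] \<in> Q_ring" "tr [2,3] \<in> Q_ring" "tr [3,4] \<in> Q_ring" "tr [1,4] \<in> Q_ring"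
  by (simp_all add: Q_ring_def hull_inc Q_gens_def)

section \<open>Inner products and volumes of the traceless parts\<close>

definition gram :: "4 \<Rightarrow> 4 \<Rightarrow> rep \<Rightarrow> complex"
  where "gram i j = tr [i, j] - (\<lambda>_. 1/2) * (tr [i] * tr [j])"

text \<open>With \<open>a\<close>, \<open>b\<close>, \<open>c\<close> the traceless parts,
  \<open>gram\<close> is \<open>tr(ab)\<close> and this is \<open>2 tr(abc)\<close>, twice the
  determinant of the coordinates: scalar parts cancel in the difference.\<close>

definition vol :: "4 \<Rightarrow> 4 \<Rightarrow> 4 \<Rightarrow> rep \<Rightarrow> complex"
  where "vol i j k = tr [i, j, k] - tr [k, j, i]"

abbreviation X where "X \<equiv> tr [1,3]"
abbreviation Y where "Y \<equiv> tr [2,4]"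

text \<open>The traceless part of \<open>A\<close> has rows \<open>(cu A, cv A)\<close> and \<open>(cw A, - cu A)\<close>.\<close>

definition cu :: "SL2 \<Rightarrow> complex" where "cu A = (mat_of_SL2 A $ 1 $ 1 - mat_of_SL2 A $ 2 $ 2) / 2"
definition cv :: "SL2 \<Rightarrow> complex" where "cv A = mat_of_SL2 A $ 1 $ 2"
definition cw :: "SL2 \<Rightarrow> complex" where "cw A = mat_of_SL2 A $ 2 $ 1"

lemma gram_coords: "gram i j \<rho> = 2 * cu (\<rho> i) * cu (\<rho> j) + cv (\<rho> i) * cw (\<rho> j) + cw (\<rho> i) * cv (\<rho> j)"
  by (simp add: gram_def tr_def fun_apply times_SL2.rep_eq trace_2 matmul_2 cu_def cv_def cw_def field_simps)

lemma vol_coords: "vol i j k \<rho> = 2 * (cu (\<rho> i) * (cv (\<rho> j) * cw (\<rho> k) - cw (\<rho> j) * cv (\<rho> k))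
   - cv (\<rho> i) * (cu (\<rho> j) * cw (\<rho> k) - cw (\<rho> j) * cu (\<rho> k))
       + cw (\<rho> i) * (cu (\<rho> j) * cv (\<rho> k) - cv (\<rho> j) * cu (\<rho> k)))"
  by (simp add: vol_def tr_def fun_apply times_SL2.rep_eq trace_2 matmul_2 cu_def cv_def cw_def field_simps)

lemma gram_sym: "gram i j = gram j i"
  by (simp add: gram_def tr_swap[of i j] mult.commute)

text \<open>Four vectors in dimension 3 satisfy a linear relation whose coefficients are their
  volumes up to sign; this is its inner product with the vector of index \<open>p\<close>.\<close>

lemma cramer:
  "gram p i * vol j k l - gram p j * vol i k l + gram p k * vol i j l - gram p l * vol i j k = 0"
  by (simp add: fun_eq_iff fun_apply gram_coords vol_coords algebra_simps)

text \<open>A product of two determinants is a Gram determinant divided by the determinant -2 of the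
  form. Each volume is twice a determinant, which leaves the factor -2.\<close>

lemma vol_mult:
  "vol i j k * vol l m n = - (2 * (gram i l * (gram j m * gram k n - gram j n * gram k m)
     - gram i m * (gram j l * gram k n - gram j n * gram k l)
         + gram i n * (gram j l * gram k m - gram j m * gram k l)))"
  by (simp add: fun_eq_iff fun_apply gram_coords vol_coords algebra_simps)

lemma two_mult_fun_eq_0: "2 * f = 0 \<Longrightarrow> f = 0" for f :: "'a \<Rightarrow> complex"
  by (simp add: fun_eq_iff fun_apply)

text \<open>The \<open>4 \<times> 4\<close> Gram determinant vanishes; this is its expansion, solved for the leading term.\<close>

lemma gram_det:
  "(gram 1 3)\<^sup>2 * (gram 2 4)\<^sup>2 =
    gram 2 2 * gram 4 4 * (gram 1 3)\<^sup>2 + gram 1 1 * gram 3 3 * (gram 2 4)\<^sup>2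
    + 2 * (gram 1 2 * gram 3 4 + gram 2 3 * gram 1 4) * gram 1 3 * gram 2 4
    - 2 * (gram 1 2 * gram 2 3 * gram 4 4 + gram 3 4 * gram 1 4 * gram 2 2) * gram 1 3
    - 2 * (gram 1 2 * gram 1 4 * gram 3 3 + gram 2 3 * gram 3 4 * gram 1 1) * gram 2 4
    + ((gram 1 2)\<^sup>2 * gram 3 3 * gram 4 4 + (gram 2 3)\<^sup>2 * gram 1 1 * gram 4 4
        + (gram 3 4)\<^sup>2 * gram 1 1 * gram 2 2
      + (gram 1 4)\<^sup>2 * gram 2 2 * gram 3 3 - gram 1 1 * gram 2 2 * gram 3 3 * gram 4 4 - (gram 1 2)\<^sup>2 *
          (gram 3 4)\<^sup>2
      - (gram 2 3)\<^sup>2 * (gram 1 4)\<^sup>2 + 2 * gram 1 2 * gram 2 3 * gram 3 4 * gram 1 4)"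
    (is "?l = ?r")
proof -
  \<comment> \<open>Multiplying Cramer's relation by a further volume turns each term into a Gram
    minor: up to the factor -2 this is the expansion of the Gram determinant along its first
    row.\<close>
  have "0 = (gram 1 1 * vol 2 3 4 - gram 1 2 * vol 1 3 4
      + gram 1 3 * vol 1 2 4 - gram 1 4 * vol 1 2 3) * vol 2 3 4"
    by (simp add: cramer)
  also have "\<dots> = gram 1 1 * (vol 2 3 4 * vol 2 3 4) - gram 1 2 * (vol 1 3 4 * vol 2 3 4)
      + gram 1 3 * (vol 1 2 4 * vol 2 3 4) - gram 1 4 * (vol 1 2 3 * vol 2 3 4)"
    by (simp add: algebra_simps)
  also have "\<dots> = - 2 * (?l - ?r)"
    unfolding vol_mult gram_sym[of 2 1] gram_sym[of 3 1] gram_sym[of 4 1] gram_sym[of 3 2] gram_sym[of 4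
        2] gram_sym[of 4 3]
    by (simp add: algebra_simps power2_eq_square)
  finally have "2 * (?l - ?r) = 0" by simp
  then have "?l - ?r = 0" by (rule two_mult_fun_eq_0)
  then show ?thesis by simp
qed

lemma gram_diag: "gram i i = (\<lambda>_. 1/2) * (tr [i] * tr [i]) - 2"
  unfolding gram_def tr_square by (simp add: fun_eq_iff fun_apply)

lemma gram_Q_ring: "gram i i \<in> Q_ring" "gram 1 2 \<in> Q_ring" "gram 2 3 \<in> Q_ring" "gram 3 4 \<in> Q_ring"
    "gram 1 4 \<in> Q_ring"
proof -
  have "tr [i] \<in> Q_ring" using exhaust_4[of i] Q_ring_tr by auto
  then show "gram i i \<in> Q_ring" unfolding gram_diag by (intro Q_ring_intros)
qed (unfold gram_def; intro Q_ring_intros Q_ring_tr)+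

text \<open>The reductions below use \<open>vol\<close> in place of \<open>t\<^sub>i\<^sub>j\<^sub>k\<close>, since it changes sign under transposition of
  matrices and so separates from the symmetric part.\<close>

abbreviation vols where "vols \<equiv> {vol 1 2 3, vol 1 3 4, vol 1 2 4, vol 2 3 4}"

text \<open>The families overlap for small \<open>k\<close>, which is harmless for a spanning
  set.\<close>

definition A_vol :: "(rep \<Rightarrow> complex) set"
  where "A_vol = (\<Union>k. {X ^ k, X ^ k * Y, Y ^ k, Y ^ k * X, X ^ k * vol 1 2 3, X ^ k * vol 1 3 4,
    Y ^ k * vol 1 2 4, Y ^ k * vol 2 3 4})"

lemma A_volI: "X ^ k \<in> A_vol" "X ^ k * Y \<in> A_vol" "Y ^ k \<in> A_vol" "Y ^ k * X \<in> A_vol"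
    "X ^ k * vol 1 2 3 \<in> A_vol"
  "X ^ k * vol 1 3 4 \<in> A_vol" "Y ^ k * vol 1 2 4 \<in> A_vol" "Y ^ k * vol 2 3 4 \<in> A_vol"
  by (auto simp: A_vol_def)

lemma A_span: "v \<in> A_vol \<Longrightarrow> v \<in> rspan Q_ring A_vol"
  by (rule rspan_base) (rule Q_ring_intros)

lemma A_span_scale: "r \<in> Q_ring \<Longrightarrow> h \<in> rspan Q_ring A_vol \<Longrightarrow> r * h \<in> rspan Q_ring A_vol"
  by (rule rspan_scale[OF Q_ring_mult])

text \<open>\<open>X\<close> and \<open>Y\<close> differ from \<open>gram 1 3\<close> and
  \<open>gram 2 4\<close> by elements of \<open>Q_ring\<close>, so \<open>gram_det\<close> becomes a
  rule that rewrites the leading monomial by monomials of lower total degree.\<close>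

lemma XY_reduce:
  obtains c1 c2 c3 c4 c5 c6 c7 c8 where "{c1,c2,c3,c4,c5,c6,c7,c8} \<subseteq> Q_ring"
    "X\<^sup>2 * Y\<^sup>2 = c1 * (X\<^sup>2 * Y) + c2 * (X * Y\<^sup>2) + c3 * X\<^sup>2 + c4 * Y\<^sup>2 + c5 * (X * Y) + c6 * X + c7 * Y + c8"
proof -
  define h where "h = (\<lambda>_. 1/2) * (tr [1] * tr [3])"
  define k where "k = (\<lambda>_. 1/2) * (tr [2] * tr [4])"
  have hk: "h \<in> Q_ring" "k \<in> Q_ring" unfolding h_def k_def by (intro Q_ring_intros Q_ring_tr)+
  have "gram 1 3 = X - h" "gram 2 4 = Y - k" by (simp_all add: gram_def h_def k_def)
  note eq = this
  define d1 where "d1 = gram 2 2 * gram 4 4"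
  define d2 where "d2 = gram 1 1 * gram 3 3"
  define d3 where "d3 = 2 * (gram 1 2 * gram 3 4 + gram 2 3 * gram 1 4)"
  define d4 where "d4 = 2 * (gram 1 2 * gram 2 3 * gram 4 4 + gram 3 4 * gram 1 4 * gram 2 2)"
  define d5 where "d5 = 2 * (gram 1 2 * gram 1 4 * gram 3 3 + gram 2 3 * gram 3 4 * gram 1 1)"
  define d6 where "d6 = (gram 1 2)\<^sup>2 * gram 3 3 * gram 4 4 + (gram 2 3)\<^sup>2 * gram 1 1 * gram 4 4
      + (gram 3 4)\<^sup>2 * gram 1 1 * gram 2 2
      + (gram 1 4)\<^sup>2 * gram 2 2 * gram 3 3 - gram 1 1 * gram 2 2 * gram 3 3 * gram 4 4 - (gram 1 2)\<^sup>2 *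
          (gram 3 4)\<^sup>2
      - (gram 2 3)\<^sup>2 * (gram 1 4)\<^sup>2 + 2 * gram 1 2 * gram 2 3 * gram 3 4 * gram 1 4"
  have d_in: "d1 \<in> Q_ring" "d2 \<in> Q_ring" "d3 \<in> Q_ring" "d4 \<in> Q_ring" "d5 \<in> Q_ring" "d6 \<in> Q_ring"
    unfolding d1_def d2_def d3_def d4_def d5_def d6_def by (intro Q_ring_intros gram_Q_ring)+
  have d: "(X - h)\<^sup>2 * (Y - k)\<^sup>2 = d1 * (X - h)\<^sup>2 + d2 * (Y - k)\<^sup>2
      + d3 * (X - h) * (Y - k) - d4 * (X - h) - d5 * (Y - k) + d6"
    using gram_det unfolding eq d1_def d2_def d3_def d4_def d5_def d6_def .
  show ?thesis
  proof
    show "X\<^sup>2 * Y\<^sup>2 = (2 * k) * (X\<^sup>2 * Y) + (2 * h) * (X * Y\<^sup>2) + (d1 - k\<^sup>2) * X\<^sup>2 + (d2 - h\<^sup>2) * Y\<^sup>2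
        + (d3 - 4 * h * k) * (X * Y)
       + (2 * h * k\<^sup>2 - 2 * h * d1 - d3 * k - d4) * X + (2 * k * h\<^sup>2 - 2 * k * d2 - d3 * h - d5) * Y
       + (d1 * h\<^sup>2 + d2 * k\<^sup>2 + d3 * h * k + d4 * h + d5 * k + d6 - h\<^sup>2 * k\<^sup>2)"
      using d by (simp add: power2_eq_square algebra_simps)
    show "{2 * k, 2 * h, d1 - k\<^sup>2, d2 - h\<^sup>2, d3 - 4 * h * k, 2 * h * k\<^sup>2 - 2 * h * d1 - d3 * k - d4,
      2 * k * h\<^sup>2 - 2 * k * d2 - d3 * h - d5, d1 * h\<^sup>2 + d2 * k\<^sup>2 + d3 * h * k + d4 * h + d5 * k
          + d6 - h\<^sup>2 * k\<^sup>2} \<subseteq> Q_ring"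
      unfolding insert_subset by (intro conjI Q_ring_intros d_in hk empty_subsetI)
  qed
qed

text \<open>Induction on the total degree: \<open>XY_reduce\<close> applies until one of the
  exponents is at most 1, and such monomials lie in \<open>A_vol\<close>.\<close>

lemma XY_in_A_span: "X ^ i * Y ^ j \<in> rspan Q_ring A_vol"
proof (induction "i + j" arbitrary: i j rule: less_induct)
  case less
  consider "i = 0" | "i = 1" | "j = 0" | "j = 1" | i' j' where "i = i' + 2" "j = j' + 2"
    by (metis add_2_eq_Suc' not0_implies_Suc One_nat_def)
  then show ?case
  proof cases
    case (5 i' j')
    obtain c1 c2 c3 c4 c5 c6 c7 c8 where c: "{c1,c2,c3,c4,c5,c6,c7,c8} \<subseteq> Q_ring"
      "X\<^sup>2 * Y\<^sup>2 = c1 * (X\<^sup>2 * Y) + c2 * (X * Y\<^sup>2) + c3 * X\<^sup>2 + c4 * Y\<^sup>2 + c5 * (X * Y) + c6 * X + c7 * Y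
          + c8"
      by (rule XY_reduce)
    have "X ^ i * Y ^ j = X ^ i' * Y ^ j' * (X\<^sup>2 * Y\<^sup>2)"
      by (simp add: 5 power_add power2_eq_square algebra_simps)
    also have "\<dots> = c1 * (X ^ (i' + 2) * Y ^ (j' + 1)) + c2 * (X ^ (i' + 1) * Y ^ (j' + 2)) + c3 * (X ^ (i'
        + 2) * Y ^ j')
       + c4 * (X ^ i' * Y ^ (j' + 2)) + c5 * (X ^ (i' + 1) * Y ^ (j' + 1)) + c6 * (X ^ (i' + 1) * Y ^ j')
       + c7 * (X ^ i' * Y ^ (j' + 1)) + c8 * (X ^ i' * Y ^ j')"
      unfolding c(2) by (simp add: power2_eq_square algebra_simps)
    also have "\<dots> \<in> rspan Q_ring A_vol"
      using 5 by (intro rspan_add A_span_scale less c(1)[THEN subsetD]) simp_all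
    finally show ?thesis .
  next
    case 1
    then show ?thesis using A_volI(3)[THEN A_span, of j] by simp
  next
    case 2
    then show ?thesis using A_volI(4)[THEN A_span, of j] by (simp add: mult.commute)
  next
    case 3
    then show ?thesis using A_volI(1)[THEN A_span, of i] by simp
  next
    case 4
    then show ?thesis using A_volI(2)[THEN A_span, of i] by simp
  qed
qed

text \<open>Cramer's relation with \<open>p = 2, 4, 1, 3\<close> in the four cases contains one Gram
  entry outside \<open>Q_ring\<close>, and that entry multiplies \<open>e\<close>.\<close>

lemma vol_reduce:
  assumes "(z, e) \<in> {(Y, vol 1 2 3), (Y, vol 1 3 4), (X, vol 1 2 4), (X, vol 2 3 4)}"
  obtains c1 c2 c3 c4 where "{c1, c2, c3, c4} \<subseteq> Q_ring"
    "z * e = c1 * vol 1 2 3 + c2 * vol 1 3 4 + c3 * vol 1 2 4 + c4 * vol 2 3 4"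
proof -
  note that_thesis = that
  define h where "h = (\<lambda>_. 1/2) * (tr [1] * tr [3])"
  define k where "k = (\<lambda>_. 1/2) * (tr [2] * tr [4])"
  have hk: "h \<in> Q_ring" "k \<in> Q_ring" unfolding h_def k_def by (intro Q_ring_intros Q_ring_tr)+
  have eq: "gram 1 3 = X - h" "gram 2 4 = Y - k" "gram 3 1 = X - h" "gram 4 2 = Y - k"
    unfolding gram_sym[of 3 1] gram_sym[of 4 2] by (simp_all add: gram_def h_def k_def)
  note c = cramer[of _ 1 2 3 4, unfolded gram_sym[of 2 1] gram_sym[of 3 2] gram_sym[of 4 1] gram_sym[of 4 3]]
  note cr = c[of 1, unfolded eq] c[of 2, unfolded eq gram_sym[of 2 1]] c[of 3,
      unfolded eq gram_sym[of 3 2]] c[of 4, unfolded eq gram_sym[of 4 1] gram_sym[of 4 3]]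
  have n: "- gram i i \<in> Q_ring" for i by (intro Q_ring_intros gram_Q_ring)
  have 1: ?thesis if "z = Y" "e = vol 1 2 3"
  proof (rule that_thesis)
    show "z * e = k * vol 1 2 3 + (- gram 2 2) * vol 1 3 4 + gram 2 3 * vol 1 2 4 + gram 1 2 * vol 2 3 4"
      using cr(2) by (simp add: that algebra_simps)
  qed (use hk n gram_Q_ring in simp)
  have 2: ?thesis if "z = Y" "e = vol 1 3 4"
  proof (rule that_thesis)
    show "z * e = (- gram 4 4) * vol 1 2 3 + k * vol 1 3 4 + gram 3 4 * vol 1 2 4 + gram 1 4 * vol 2 3 4"
      using cr(4) by (simp add: that algebra_simps)
  qed (use hk n gram_Q_ring in simp)
  have 3: ?thesis if "z = X" "e = vol 1 2 4"
  proof (rule that_thesis)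
    show "z * e = gram 1 4 * vol 1 2 3 + gram 1 2 * vol 1 3 4 + h * vol 1 2 4 + (- gram 1 1) * vol 2 3 4"
      using cr(1) by (simp add: that algebra_simps)
  qed (use hk n gram_Q_ring in simp)
  have 4: ?thesis if "z = X" "e = vol 2 3 4"
  proof (rule that_thesis)
    show "z * e = gram 3 4 * vol 1 2 3 + gram 2 3 * vol 1 3 4 + (- gram 3 3) * vol 1 2 4 + h * vol 2 3 4"
      using cr(3) by (simp add: that algebra_simps)
  qed (use hk n gram_Q_ring in simp)
  show ?thesis using assms 1 2 3 4 by auto
qed

text \<open>A factor \<open>Y\<close> next to a volume containing the indices 1 and 3, or
  \<open>X\<close> next to one containing 2 and 4, is removed by \<open>vol_reduce\<close>. The new
  volumes may be of the other kind, so the induction on \<open>i + j\<close> covers all of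
  them.\<close>

lemma XY_vol_in_A_span: "e \<in> vols \<Longrightarrow> X ^ i * Y ^ j * e \<in> rspan Q_ring A_vol"
proof (induction "i + j" arbitrary: i j e rule: less_induct)
  case less
  have red: "X ^ a * Y ^ b * (z * e) \<in> rspan Q_ring A_vol" if lt: "a + b < i + j"
    and ze: "(z, e) \<in> {(Y, vol 1 2 3), (Y, vol 1 3 4), (X, vol 1 2 4), (X, vol 2 3 4)}" for a b z e
  proof -
    obtain c1 c2 c3 c4 where c: "{c1, c2, c3, c4} \<subseteq> Q_ring"
      "z * e = c1 * vol 1 2 3 + c2 * vol 1 3 4 + c3 * vol 1 2 4 + c4 * vol 2 3 4"
      using ze by (rule vol_reduce)
    have "X ^ a * Y ^ b * (z * e) = c1 * (X ^ a * Y ^ b * vol 1 2 3) + c2 * (X ^ a * Y ^ b * vol 1 3 4)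
      + c3 * (X ^ a * Y ^ b * vol 1 2 4) + c4 * (X ^ a * Y ^ b * vol 2 3 4)"
      unfolding c(2) by (simp add: algebra_simps)
    also have "\<dots> \<in> rspan Q_ring A_vol"
      using c(1) lt by (intro rspan_add A_span_scale less) auto
    finally show ?thesis .
  qed
  consider "e \<in> {vol 1 2 3, vol 1 3 4}" | "e \<in> {vol 1 2 4, vol 2 3 4}" using less.prems by auto
  then show ?case
  proof cases
    case 1
    show ?thesis
    proof (cases j)
      case 0
      then show ?thesis using 1 A_volI(5,6)[of i] by (auto intro: A_span)
    next
      case (Suc j')
      then show ?thesis using red[of i j' Y e] 1 by (auto simp: algebra_simps)
    qed
  next
    case 2
    show ?thesis
    proof (cases i)
      case 0
      then show ?thesis using 2 A_volI(7,8)[of j] by (auto intro: A_span)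
    next
      case (Suc i')
      then show ?thesis using red[of i' j X e] 2 by (auto simp: algebra_simps)
    qed
  qed
qed

text \<open>The multipliers of the span. They form a subalgebra, so that stability of the span under
  multiplication has to be checked only for the ring generators.\<close>

definition A_mult :: "(rep \<Rightarrow> complex) set"
  where "A_mult = {f. \<forall>h \<in> rspan Q_ring A_vol. f * h \<in> rspan Q_ring A_vol}"

lemma A_mult_subalgebra: "complex_subalgebra A_mult"
  unfolding complex_subalgebra_def A_mult_def
  by (auto simp: distrib_right mult.assoc intro: rspan_add A_span_scale Q_ring_intros)

lemma hull_A_mult: "A_mult = complex_subalgebra hull A_mult"
  using A_mult_subalgebra by (rule hull_same[symmetric])

lemmas A_mult_intros = hull_intros[where S = A_mult, folded hull_A_mult]

lemma A_vol_cases: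
  assumes "v \<in> A_vol"
  obtains i j where "v = X ^ i * Y ^ j" | i j e where "e \<in> vols" "v = X ^ i * Y ^ j * e"
proof -
  have "(\<exists>i j. v = X ^ i * Y ^ j) \<or> (\<exists>i j. \<exists>e\<in>vols. v = X ^ i * Y ^ j * e)"
    using assms unfolding A_vol_def
    apply (elim UN_E insertE emptyE)
    subgoal for k by (rule disjI1, rule exI[of _ k], rule exI[of _ 0], simp)
    subgoal for k by (rule disjI1, rule exI[of _ k], rule exI[of _ 1], simp)
    subgoal for k by (rule disjI1, rule exI[of _ 0], rule exI[of _ k], simp)
    subgoal for k by (rule disjI1, rule exI[of _ 1], rule exI[of _ k], simp add: mult.commute)
    subgoal for k by (rule disjI2, rule exI[of _ k], rule exI[of _ 0], simp)
    subgoal for k by (rule disjI2, rule exI[of _ k], rule exI[of _ 0], simp)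
    subgoal for k by (rule disjI2, rule exI[of _ 0], rule exI[of _ k], simp)
    subgoal for k by (rule disjI2, rule exI[of _ 0], rule exI[of _ k], simp)
    done
  then show ?thesis using that by blast
qed

lemma Q_ring_A_mult: "r \<in> Q_ring \<Longrightarrow> r \<in> A_mult"
  by (simp add: A_mult_def A_span_scale)

lemma A_multI: "(\<And>v. v \<in> A_vol \<Longrightarrow> z * v \<in> rspan Q_ring A_vol) \<Longrightarrow> z \<in> A_mult"
  unfolding A_mult_def by (auto intro: rspan_mult_closed[OF Q_ring_mult])

lemma X_A_mult: "X \<in> A_mult" and Y_A_mult: "Y \<in> A_mult"
proof -
  have "X * v \<in> rspan Q_ring A_vol \<and> Y * v \<in> rspan Q_ring A_vol" if "v \<in> A_vol" for v
    using that
  proof (cases rule: A_vol_cases)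
    case (1 i j)
    then show ?thesis using XY_in_A_span[of "Suc i" j] XY_in_A_span[of i "Suc j"] by (simp add: mult_ac)
  next
    case (2 i j e)
    then show ?thesis using XY_vol_in_A_span[of e "Suc i" j] XY_vol_in_A_span[of e i "Suc j"]
        by (simp add: mult_ac)
  qed
  then show "X \<in> A_mult" "Y \<in> A_mult" by (auto intro: A_multI)
qed

lemma gram_A_mult: "gram i j \<in> A_mult"
proof -
  have "gram 1 3 \<in> A_mult" "gram 2 4 \<in> A_mult"
    unfolding gram_def by (intro A_mult_intros X_A_mult Y_A_mult Q_ring_A_mult Q_ring_tr)+
  moreover note gram_Q_ring[THEN Q_ring_A_mult]
  ultimately show ?thesis
    using exhaust_4[of i] exhaust_4[of j] gram_sym[of i j] by (elim disjE; simp)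
qed

lemma vol_mult_A_mult: "vol i j k * vol l m n \<in> A_mult"
  unfolding vol_mult by (intro A_mult_intros gram_A_mult)

lemma vol_A_mult: "e \<in> vols \<Longrightarrow> e \<in> A_mult"
proof (rule A_multI)
  fix v assume e: "e \<in> vols" and "v \<in> A_vol"
  from this(2) show "e * v \<in> rspan Q_ring A_vol"
  proof (cases rule: A_vol_cases)
    case (1 i j)
    then show ?thesis using XY_vol_in_A_span[OF e, of i j] by (simp add: mult_ac)
  next
    case (2 i j e')
    have "e * e' \<in> A_mult" using e 2(1) by (auto intro: vol_mult_A_mult)
    then have "(e * e') * (X ^ i * Y ^ j) \<in> rspan Q_ring A_vol"
      using XY_in_A_span by (simp add: A_mult_def)
    then show ?thesis by (simp add: 2 mult_ac)
  qed
qed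

text \<open>By \<open>tr_reverse\<close> this is \<open>tr [i, j, k] + tr [k, j, i]\<close>, the
  part of \<open>2 * tr [i, j, k]\<close> that is invariant under reversal.\<close>

definition vol_sym :: "4 \<Rightarrow> 4 \<Rightarrow> 4 \<Rightarrow> rep \<Rightarrow> complex"
  where "vol_sym i j k = tr [i] * tr [j, k] + tr [j] * tr [i, k]
      + tr [k] * tr [i, j] - tr [i] * tr [j] * tr [k]"

lemma vol_sym: "2 * tr [i, j, k] = vol i j k + vol_sym i j k"
  unfolding vol_def vol_sym_def tr_reverse[of k j i] by simp

lemma tr3_eq: "tr [i, j, k] = (\<lambda>_. 1/2) * (vol i j k + vol_sym i j k)"
  unfolding vol_sym[symmetric] by (simp add: fun_eq_iff fun_apply)

lemma fund_ring_subset_A_vol_span: "fund_ring \<subseteq> rspan Q_ring A_vol"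
proof -
  have "tr [i, j, k] \<in> A_mult" if "vol i j k \<in> vols" "tr [j, k] \<in> A_mult" "tr [i, k] \<in> A_mult" "tr [i,
      j] \<in> A_mult" for i j k
  proof -
    have "tr [l] \<in> A_mult" for l using exhaust_4[of l] Q_ring_tr by (auto intro: Q_ring_A_mult)
    then show ?thesis
      unfolding tr3_eq vol_sym_def using that vol_A_mult by (intro A_mult_intros)
  qed
  then have "gens \<subseteq> A_mult"
    using X_A_mult Y_A_mult Q_ring_tr[THEN Q_ring_A_mult] by (simp add: gens_def Q_gens_def)
  then have "fund_ring \<subseteq> A_mult"
    unfolding fund_ring_def using A_mult_subalgebra by (rule hull_minimal)
  \<comment> \<open>The span contains 1, so it contains its multipliers.\<close>
  moreover have "f \<in> rspan Q_ring A_vol" if "f \<in> A_mult" for f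
    using that XY_in_A_span[of 0 0] by (auto simp: A_mult_def dest!: bspec[where x = 1])
  ultimately show ?thesis by auto
qed

lemma A_setI: "X ^ k \<in> A_set" "X ^ k * Y \<in> A_set" "Y ^ k \<in> A_set" "Y ^ k * X \<in> A_set"
  "X ^ k * tr [1,2,3] \<in> A_set"
  "X ^ k * tr [1,3,4] \<in> A_set" "Y ^ k * tr [1,2,4] \<in> A_set" "Y ^ k * tr [2,3,4] \<in> A_set"
proof -
  have k: "k = 0 \<or> k = 1 \<or> k \<in> {2..}" by auto
  show "X ^ k \<in> A_set" "X ^ k * Y \<in> A_set" "Y ^ k \<in> A_set" "Y ^ k * X \<in> A_set"
    using k by (elim disjE; auto simp: A_set_def mult.commute)+
qed (auto simp: A_set_def)

text \<open>A volume is \<open>2 * tr [i, j, l]\<close> minus its symmetric part, which is linear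
  over \<open>Q_ring\<close> in the same variable \<open>z\<close> whose powers multiply that
  volume. The correction therefore consists of powers of \<open>z\<close>.\<close>

lemma A_vol_subset_span: "A_vol \<subseteq> rspan Q_ring A_set"
proof
  fix v assume "v \<in> A_vol"
  have base: "w \<in> A_set \<Longrightarrow> w \<in> rspan Q_ring A_set" for w by (rule rspan_base) (rule Q_ring_intros)
  have odd: "z ^ k * vol i j l \<in> rspan Q_ring A_set"
    if "z ^ k * tr [i, j, l] \<in> A_set" "vol_sym i j l = p
        + q * z" "p \<in> Q_ring" "q \<in> Q_ring" "\<And>k. z ^ k \<in> A_set" for z k i j l p q
  proof -
    have vol: "vol i j l = 2 * tr [i, j, l] - (p + q * z)" using vol_sym[of i j l] that(2)
        by (simp add: algebra_simps)
    have "z ^ k * vol i j l = 2 * (z ^ k * tr [i, j, l]) + (- p * z ^ k + - q * z ^ Suc k)"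
      unfolding vol by (simp add: algebra_simps)
    also have "\<dots> \<in> rspan Q_ring A_set"
      using that by (intro rspan_add rspan_smult Q_ring_intros)
    finally show ?thesis .
  qed
  have v: "vol_sym 1 2 3 = (tr [1] * tr [2,3] + tr [3] * tr [1,2] - tr [1] * tr [2] * tr [3]) + tr [2] * X"
    "vol_sym 1 3 4 = (tr [1] * tr [3,4] + tr [3] * tr [1,4] - tr [1] * tr [3] * tr [4]) + tr [4] * X"
    "vol_sym 1 2 4 = (tr [2] * tr [1,4] + tr [4] * tr [1,2] - tr [1] * tr [2] * tr [4]) + tr [1] * Y"
    "vol_sym 2 3 4 = (tr [2] * tr [3,4] + tr [4] * tr [2,3] - tr [2] * tr [3] * tr [4]) + tr [3] * Y"
    by (simp_all add: vol_sym_def)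
  have "X ^ k * vol 1 2 3 \<in> rspan Q_ring A_set" "X ^ k * vol 1 3 4 \<in> rspan Q_ring A_set"
    "Y ^ k * vol 1 2 4 \<in> rspan Q_ring A_set" "Y ^ k * vol 2 3 4 \<in> rspan Q_ring A_set" for k
    by (rule odd[OF _ v(1)] odd[OF _ v(2)] odd[OF _ v(3)] odd[OF _ v(4)]; intro A_setI Q_ring_intros
        Q_ring_tr)+
  then show "v \<in> rspan Q_ring A_set"
    using \<open>v \<in> A_vol\<close> A_setI[THEN base] unfolding A_vol_def by auto
qed

lemma fund_ring_subset_span: "fund_ring \<subseteq> rspan Q_ring A_set"
  using fund_ring_subset_A_vol_span rspan_subset[OF Q_ring_mult A_vol_subset_span] by auto

subsection \<open>Polynomials vanishing on a grid\<close>

text \<open>Induction on the number of variables: as a polynomial in the last variable the sum has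
  infinitely many roots, so its coefficient at degree \<open>e m n\<close> vanishes, and this is the
  sum over \<open>K'\<close> in the other variables.\<close>

lemma monomials_independent_on_grid:
  fixes e :: "'b \<Rightarrow> nat \<Rightarrow> nat" and c :: "'b \<Rightarrow> complex"
  assumes "infinite G" "finite K"
    and "\<And>m m'. m \<in> K \<Longrightarrow> m' \<in> K \<Longrightarrow> (\<And>i. i < n \<Longrightarrow> e m i = e m' i) \<Longrightarrow> m = m'"
    and "\<And>v. (\<And>i. i < n \<Longrightarrow> v i \<in> G) \<Longrightarrow> (\<Sum>m\<in>K. c m * (\<Prod>i<n. v i ^ e m i)) = 0"
    and "m \<in> K"
  shows "c m = 0"
  using assms(2-5)
proof (induction n arbitrary: K m)
  case 0
  then have "K = {m}" by auto
  then show ?case using "0.prems"(3) by simp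
next
  case (Suc n)
  define K' where "K' = {m' \<in> K. e m' n = e m n}"
  show ?case
  proof (rule Suc.IH[of K' m])
    fix v :: "nat \<Rightarrow> complex" assume v: "\<And>i. i < n \<Longrightarrow> v i \<in> G"
    define P where "P = (\<Sum>m\<in>K. monom (c m * (\<Prod>i<n. v i ^ e m i)) (e m n))"
    have "poly P z = 0" if "z \<in> G" for z
    proof -
      have "(\<Sum>m\<in>K. c m * (\<Prod>i<Suc n. (v(n := z)) i ^ e m i)) = 0"
        using v that by (intro Suc.prems(3)) auto
      then show ?thesis by (simp add: P_def poly_sum poly_monom mult_ac)
    qed
    then have "infinite {z. poly P z = 0}"
      using infinite_super[of G "{z. poly P z = 0}"] \<open>infinite G\<close> by blast
    then have "P = 0" using poly_roots_finite by blast
    then have "coeff P (e m n) = 0" by simp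
    then show "(\<Sum>m\<in>K'. c m * (\<Prod>i<n. v i ^ e m i)) = 0"
      using Suc.prems(1) by (simp add: P_def coeff_sum K'_def if_distrib sum.inter_filter cong: if_cong)
  next
    fix m1 m2 assume "m1 \<in> K'" "m2 \<in> K'" "\<And>i. i < n \<Longrightarrow> e m1 i = e m2 i"
    then show "m1 = m2" by (intro Suc.prems(2)) (auto simp: K'_def less_Suc_eq)
  qed (use Suc.prems in \<open>auto simp: K'_def\<close>)
qed

section \<open>The evaluation map of the polynomial ring\<close>

abbreviation monomial :: "(nat \<Rightarrow> 'a \<Rightarrow> complex) \<Rightarrow> (nat \<Rightarrow>\<^sub>0 nat) \<Rightarrow> 'a \<Rightarrow> complex"
  where "monomial V m \<equiv> \<Prod>i \<in> Poly_Mapping.keys m. V i ^ Poly_Mapping.lookup m i"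

lemma monomial_superset:
  "finite I \<Longrightarrow> Poly_Mapping.keys m \<subseteq> I \<Longrightarrow> monomial V m = (\<Prod>i\<in>I. V i ^ Poly_Mapping.lookup m i)"
  by (rule prod.mono_neutral_left) (auto simp: in_keys_iff)

lemma monomial_add_single:
  "monomial V (m + Poly_Mapping.single i 1) = V i * monomial V m"
proof -
  let ?I = "insert i (Poly_Mapping.keys m)"
  have "Poly_Mapping.keys (m + Poly_Mapping.single i 1) \<subseteq> ?I"
    using Poly_Mapping.keys_add[of m "Poly_Mapping.single i 1"] by auto
  then have "monomial V (m + Poly_Mapping.single i 1) = (\<Prod>l\<in>?I. V l ^ Poly_Mapping.lookup (m
      + Poly_Mapping.single i 1) l)"
    by (intro monomial_superset) auto
  also have "\<dots> = (\<Prod>l\<in>?I. V l ^ Poly_Mapping.lookup m l * (if l = i then V l else 1))"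
    by (intro prod.cong) (auto simp: lookup_add lookup_single)
  also have "\<dots> = (\<Prod>l\<in>?I. V l ^ Poly_Mapping.lookup m l) * V i"
    by (simp add: prod.distrib)
  also have "(\<Prod>l\<in>?I. V l ^ Poly_Mapping.lookup m l) = monomial V m"
    by (rule monomial_superset[symmetric]) auto
  finally show ?thesis by (simp add: mult.commute)
qed

lemma poly_eval_superset:
  "finite K \<Longrightarrow> Poly_Mapping.keys p \<subseteq> K \<Longrightarrow>
    poly_eval V p = (\<Sum>m\<in>K. fun_scale (Poly_Mapping.lookup p m) (monomial V m))"
  unfolding poly_eval_def by (rule sum.mono_neutral_left) (auto simp: in_keys_iff fun_scale_def zero_fun_def)

lemma poly_eval_add: "poly_eval V (p + q) = poly_eval V p + poly_eval V q"
proof -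
  let ?K = "Poly_Mapping.keys p \<union> Poly_Mapping.keys q"
  have "Poly_Mapping.keys (p + q) \<subseteq> ?K" by (rule Poly_Mapping.keys_add)
  then show ?thesis
    by (simp add: poly_eval_superset[of ?K] lookup_add sum.distrib fun_vs.scale_left_distrib)
qed

lemma poly_eval_single: "poly_eval V (Poly_Mapping.single m c) = fun_scale c (monomial V m)"
  by (simp add: poly_eval_superset[of "{m}"])

lemma poly_eval_0: "poly_eval V 0 = 0"
  by (simp add: poly_eval_def)

lemma fun_scale_eq: "fun_scale c f = (\<lambda>_. c) * f"
  by (simp add: fun_scale_def times_fun_def)

text \<open>For the harder inclusion, the multipliers \<open>Z\<close> of the image form a
  subalgebra containing the generators, since multiplying by a generator only shifts monomials. This
  bypasses multiplicativity of \<open>poly_eval\<close>.\<close>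

lemma poly_eval_image:
  "poly_eval (\<lambda>i. xs ! i) ` polynomials_in {..<length xs} = complex_subalgebra hull (set xs)"
    (is "?Im = ?H")
proof
  show "?Im \<subseteq> ?H"
    unfolding poly_eval_def fun_scale_eq
  proof (intro image_subsetI hull_sum hull_mult hull_const hull_prod hull_power)
    fix p m i assume "p \<in> polynomials_in {..<length xs}" "m \<in> Poly_Mapping.keys p" "i \<in> Poly_Mapping.keys m"
    then have "i < length xs" by (auto simp: polynomials_in_def)
    then show "xs ! i \<in> ?H" by (simp add: hull_inc)
  qed
next
  have add: "f + g \<in> ?Im" if fg: "f \<in> ?Im" "g \<in> ?Im" for f g
  proof -
    obtain p q where "f = poly_eval ((!) xs) p" "g = poly_eval ((!) xs) q" and pq:
        "p \<in> polynomials_in {..<length xs}" "q \<in> polynomials_in {..<length xs}"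
      using fg by auto
    then have "f + g = poly_eval ((!) xs) (p + q)" by (simp add: poly_eval_add)
    moreover have "p + q \<in> polynomials_in {..<length xs}"
      using pq Poly_Mapping.keys_add[of p q] unfolding polynomials_in_def by blast
    ultimately show ?thesis by blast
  qed
  have zero: "0 \<in> ?Im"
    by (rule image_eqI[of _ _ 0]) (auto simp: poly_eval_0 polynomials_in_def)
  have sum: "sum F I \<in> ?Im" if "\<And>i. i \<in> I \<Longrightarrow> F i \<in> ?Im" for F and I :: "(nat \<Rightarrow>\<^sub>0 nat) set"
    using that by (induction I rule: infinite_finite_induct) (auto intro: add zero simp del: image_iff)
  have mono: "fun_scale c (monomial ((!) xs) m) \<in> ?Im" if "Poly_Mapping.keys m \<subseteq> {..<length xs}" for c m
    using that by (intro image_eqI[of _ _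
        "Poly_Mapping.single m c"]) (auto simp: poly_eval_single polynomials_in_def split: if_splits)
  define Z where "Z = {f. \<forall>h \<in> ?Im. f * h \<in> ?Im}"
  have "complex_subalgebra Z"
    unfolding complex_subalgebra_def
  proof (intro conjI ballI allI)
    fix c show "(\<lambda>_. c) \<in> Z"
      unfolding Z_def
    proof (intro CollectI ballI)
      fix h assume "h \<in> ?Im"
      then obtain p where p: "h = poly_eval ((!) xs) p" "p \<in> polynomials_in {..<length xs}" by auto
      have "(\<lambda>_. c) * h = (\<Sum>m\<in>Poly_Mapping.keys p. fun_scale (c * Poly_Mapping.lookup p m) (monomial ((!)
          xs) m))"
        unfolding p(1) poly_eval_def sum_distrib_left
        by (intro sum.cong refl) (simp add: fun_scale_def times_fun_def mult_ac)
      moreover have "Poly_Mapping.keys m \<subseteq> {..<length xs}" if "m \<in> Poly_Mapping.keys p" for m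
        using that p(2) by (auto simp: polynomials_in_def)
      ultimately show "(\<lambda>_. c) * h \<in> ?Im" by (simp only:) (intro sum mono)
    qed
  next
    fix f g assume "f \<in> Z" "g \<in> Z"
    then show "f + g \<in> Z" "f * g \<in> Z"
      unfolding Z_def by (auto simp: distrib_right mult.assoc simp del: image_iff intro!: add)
  qed
  moreover have "set xs \<subseteq> Z"
  proof
    fix f assume "f \<in> set xs"
    then obtain i where i: "i < length xs" "f = xs ! i" by (auto simp: in_set_conv_nth)
    show "f \<in> Z"
      unfolding Z_def
    proof (intro CollectI ballI)
      fix h assume "h \<in> ?Im"
      then obtain p where p: "h = poly_eval ((!) xs) p" "p \<in> polynomials_in {..<length xs}" by auto
      have "f * h = (\<Sum>m\<in>Poly_Mapping.keys p. fun_scale (Poly_Mapping.lookup p m) (monomial ((!) xs) (m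
          + Poly_Mapping.single i 1)))"
        unfolding p(1) i(2) poly_eval_def sum_distrib_left monomial_add_single
        by (intro sum.cong refl) (simp add: fun_scale_def times_fun_def mult_ac)
      moreover have "Poly_Mapping.keys (m
          + Poly_Mapping.single i 1) \<subseteq> {..<length xs}" if "m \<in> Poly_Mapping.keys p" for m
        using that p(2) i(1) Poly_Mapping.keys_add[of m "Poly_Mapping.single i 1"]
            by (fastforce simp: polynomials_in_def split: if_splits)
      ultimately show "f * h \<in> ?Im" by (simp only:) (intro sum mono)
    qed
  qed
  ultimately have "?H \<subseteq> Z" by (intro hull_minimal)
  moreover have "1 \<in> ?Im" using mono[of 0 1] by (simp add: fun_scale_def one_fun_def)
  ultimately show "?H \<subseteq> ?Im" unfolding Z_def by (force simp del: image_iff)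
qed

text \<open>The value of the polynomial at \<open>\<rho>\<close> depends only on the values
  \<open>V i \<rho>\<close>, so one zero above each grid point is enough.\<close>

lemma poly_eval_grid_zero:
  assumes "p \<in> polynomials_in {..<n}" "infinite G"
    and "\<And>v. (\<And>i. i < n \<Longrightarrow> v i \<in> G) \<Longrightarrow> \<exists>\<rho>. (\<forall>i<n. V i \<rho> = v i) \<and> poly_eval V p \<rho> = 0"
  shows "p = 0"
proof (rule ccontr)
  assume "p \<noteq> 0"
  then obtain m where m: "m \<in> Poly_Mapping.keys p" by (metis all_not_in_conv keys_eq_empty)
  have "Poly_Mapping.lookup p m = 0"
  proof (rule monomials_independent_on_grid[OF assms(2) finite_keys _ _ m,
      where e = Poly_Mapping.lookup and n = n])
    fix m1 m2 assume "m1 \<in> Poly_Mapping.keys p" "m2 \<in> Poly_Mapping.keys p" "\<And>i. i < n \<Longrightarrow>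
        Poly_Mapping.lookup m1 i = Poly_Mapping.lookup m2 i"
    moreover from this have "Poly_Mapping.lookup m1 i = Poly_Mapping.lookup m2 i" if "\<not> i < n" for i
      using assms(1) that by (metis (mono_tags,
          lifting) in_keys_iff lessThan_iff mem_Collect_eq polynomials_in_def subsetD)
    ultimately show "m1 = m2" by (intro poly_mapping_eqI) blast
  next
    fix v :: "nat \<Rightarrow> complex" assume "\<And>i. i < n \<Longrightarrow> v i \<in> G"
    then obtain \<rho> where \<rho>: "\<And>i. i < n \<Longrightarrow> V i \<rho> = v i" "poly_eval V p \<rho> = 0" using assms(3) by blast
    have "poly_eval V p \<rho> = (\<Sum>m\<in>Poly_Mapping.keys p. Poly_Mapping.lookup p m * (\<Prod>i<n. v i ^
        Poly_Mapping.lookup m i))"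
    proof -
      have "monomial V m \<rho> = (\<Prod>i<n. v i ^ Poly_Mapping.lookup m i)" if "m \<in> Poly_Mapping.keys p" for m
      proof -
        have "monomial V m = (\<Prod>i<n. V i ^ Poly_Mapping.lookup m i)"
          using that assms(1) by (intro monomial_superset) (auto simp: polynomials_in_def)
        moreover have "prod f {..<n} \<rho> = (\<Prod>i<n. f i \<rho>)" for f :: "nat \<Rightarrow> 'a \<Rightarrow> complex"
          by (induction n) (simp_all add: fun_apply)
        ultimately show ?thesis using \<rho>(1) by (simp add: power_fun_apply)
      qed
      then show ?thesis unfolding poly_eval_def by (simp add: fun_scale_def sum_fun_apply)
    qed
    with \<rho>(2) show "(\<Sum>m\<in>Poly_Mapping.keys p. Poly_Mapping.lookup p m * (\<Prod>i<n. v i ^ Poly_Mapping.lookup m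
        i)) = 0" by simp
  qed
  then show False using m by (simp add: in_keys_iff)
qed

subsection \<open>Representations with prescribed traces\<close>

text \<open>The root on the branch of \<open>w\<close> comes from the principal root of
  \<open>r n / w^2\<close>, which tends to 1, where \<open>csqrt\<close> is continuous.\<close>

lemma sqrt_sequence:
  fixes r :: "nat \<Rightarrow> complex"
  assumes "r \<longlonglongrightarrow> w\<^sup>2" "w \<noteq> 0"
  obtains s where "\<And>n. (s n)\<^sup>2 = r n" "s \<longlonglongrightarrow> w"
proof
  show "(w * csqrt (r n / w\<^sup>2))\<^sup>2 = r n" for n
    using assms(2) by (simp add: power_mult_distrib)
  have "(\<lambda>n. r n / w\<^sup>2) \<longlonglongrightarrow> 1"
    using tendsto_divide[OF assms(1) tendsto_const[of "w\<^sup>2"]] assms(2) by simp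
  then have "(\<lambda>n. csqrt (r n / w\<^sup>2)) \<longlonglongrightarrow> csqrt 1"
    by (rule isCont_tendsto_compose[rotated]) (rule continuous_at_csqrt, simp)
  from tendsto_mult[OF tendsto_const[of w] this] show "(\<lambda>n. w * csqrt (r n / w\<^sup>2)) \<longlonglongrightarrow> w" by simp
qed

definition mk_SL2 :: "complex \<Rightarrow> complex \<Rightarrow> complex \<Rightarrow> complex \<Rightarrow> SL2"
  where "mk_SL2 a b c d = Abs_SL2 (vector [vector [a, b], vector [c, d]])"

lemma mat_of_mk_SL2:
  assumes "a * d - b * c = 1"
  shows "mat_of_SL2 (mk_SL2 a b c d) $ 1 $ 1 = a" "mat_of_SL2 (mk_SL2 a b c d) $ 1 $ 2 = b"
    "mat_of_SL2 (mk_SL2 a b c d) $ 2 $ 1 = c" "mat_of_SL2 (mk_SL2 a b c d) $ 2 $ 2 = d"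
proof -
  have "mat_of_SL2 (mk_SL2 a b c d) = vector [vector [a, b], vector [c, d]]"
    unfolding mk_SL2_def using assms by (intro Abs_SL2_inverse) (simp add: det_2)
  then show "mat_of_SL2 (mk_SL2 a b c d) $ 1 $ 1 = a" "mat_of_SL2 (mk_SL2 a b c d) $ 1 $ 2 = b"
    "mat_of_SL2 (mk_SL2 a b c d) $ 2 $ 1 = c" "mat_of_SL2 (mk_SL2 a b c d) $ 2 $ 2 = d" by simp_all
qed

definition mk_rep :: "SL2 \<Rightarrow> SL2 \<Rightarrow> SL2 \<Rightarrow> SL2 \<Rightarrow> rep"
  where "mk_rep A B C D i = (if i = 1 then A else if i = 2 then B else if i = 3 then C else D)"

lemma mk_rep_simps: "mk_rep A B C D 1 = A" "mk_rep A B C D 2 = B" "mk_rep A B C D 3 = C"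
    "mk_rep A B C D 4 = D"
  by (simp_all add: mk_rep_def)

text \<open>Solves \<open>a + d = \<tau>\<close> and \<open>l * a + m * d = \<xi>\<close>, the
  conditions on the diagonal of a matrix with trace \<open>\<tau>\<close> whose product with
  \<open>diag(l, m)\<close> has trace \<open>\<xi>\<close>.\<close>

lemma diagonal_entries:
  fixes l m \<xi> \<tau> :: complex
  assumes "l * m = 1" "l - m \<noteq> 0"
  shows "(\<xi> - \<tau> * m) / (l - m) + (l * \<tau> - \<xi>) / (l - m) = \<tau>"
    and "l * ((\<xi> - \<tau> * m) / (l - m)) + m * ((l * \<tau> - \<xi>) / (l - m)) = \<xi>"
proof -
  have "(\<xi> - \<tau> * m) / (l - m) + (l * \<tau> - \<xi>) / (l - m) = (\<tau> * (l - m)) / (l - m)"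
    by (simp add: algebra_simps flip: add_divide_distrib)
  then show "(\<xi> - \<tau> * m) / (l - m) + (l * \<tau> - \<xi>) / (l - m) = \<tau>" using assms(2) by simp
  have "l * (\<xi> - \<tau> * m) + m * (l * \<tau> - \<xi>) = \<xi> * (l - m)"
    using assms(1) by (simp add: algebra_simps)
  then have "l * ((\<xi> - \<tau> * m) / (l - m)) + m * ((l * \<tau> - \<xi>) / (l - m)) = (\<xi> * (l - m)) / (l - m)"
    by (simp flip: add_divide_distrib)
  then show "l * ((\<xi> - \<tau> * m) / (l - m)) + m * ((l * \<tau> - \<xi>) / (l - m)) = \<xi>" using assms(2) by simp
qed

text \<open>The matrices are \<open>A\<^sub>1 = diag(l, m)\<close>, \<open>A\<^sub>3\<close> with upper right entry 1 and \<open>tr(A\<^sub>1A\<^sub>3) = x\<close>; then the diagonal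
  of \<open>A\<^sub>2\<close> is fixed by two trace conditions and its other entries by the quadratic equation that is solved by \<open>s2\<close>.
  Likewise for \<open>A\<^sub>4\<close> with \<open>s4\<close>.\<close>

lemma rep_with_traces:
  fixes t1 t2 t3 t4 t12 t23 t34 t14 x s2 s4 l m :: complex
  assumes l: "l + m = t1" "l * m = 1" "l - m \<noteq> 0"
  defines "k \<equiv> l - m"
  defines "a \<equiv> (t12 - t2 * m) / k" and "d \<equiv> (l * t2 - t12) / k"
    and "a' \<equiv> (t14 - t4 * m) / k" and "d' \<equiv> (l * t4 - t14) / k"
    and "p \<equiv> (x - t3 * m) / k" and "s \<equiv> (l * t3 - x) / k"
  defines "e \<equiv> p * s - 1"
  defines "K \<equiv> t23 - a * p - d * s" and "K' \<equiv> t34 - a' * p - d' * s"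
  assumes e: "e \<noteq> 0" and s2: "s2\<^sup>2 = K\<^sup>2 - 4 * e * (a * d - 1)" and s4: "s4\<^sup>2 = K'\<^sup>2 - 4 * e * (a' * d' - 1)"
  obtains \<rho> where "tr [1] \<rho> = t1" "tr [2] \<rho> = t2" "tr [3] \<rho> = t3" "tr [4] \<rho> = t4"
    "tr [1,2] \<rho> = t12" "tr [2,3] \<rho> = t23" "tr [3,4] \<rho> = t34" "tr [1,4] \<rho> = t14"
    "X \<rho> = x" "Y \<rho> = a * a' + d * d' + (K * K' + s2 * s4) / (2 * e)"
    "vol 1 2 3 \<rho> = k * s2" "vol 1 3 4 \<rho> = k * s4"
proof -
  have k0: "k \<noteq> 0" using l by (simp add: k_def)
  \<comment> \<open>\<open>b * e\<close> and \<open>c\<close> are the roots of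
    \<open>z^2 - K z + e (a d - 1)\<close>: their sum prescribes \<open>tr [2,3]\<close> and their
    product gives determinant 1. The roots are exchanged for the fourth matrix, so that
    \<open>vol 1 3 4\<close> is \<open>k * s4\<close> with a positive sign.\<close>
  define b where "b = (K + s2) / (2 * e)"
  define c where "c = (K - s2) / 2"
  define b' where "b' = (K' - s4) / (2 * e)"
  define c' where "c' = (K' + s4) / 2"
  have be: "2 * (b * e) = K + s2" "2 * (b' * e) = K' - s4" using e by (simp_all add: b_def b'_def)
  have c2: "2 * c = K - s2" "2 * c' = K' + s4" by (simp_all add: c_def c'_def)
  have "4 * e * (b * c) = (2 * (b * e)) * (2 * c)" by simp
  also have "\<dots> = K\<^sup>2 - s2\<^sup>2" unfolding be c2 by (simp add: power2_eq_square algebra_simps)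
  also have "\<dots> = 4 * e * (a * d - 1)" by (simp add: s2)
  finally have bc: "b * c = a * d - 1" using e by simp
  have "4 * e * (b' * c') = (2 * (b' * e)) * (2 * c')" by simp
  also have "\<dots> = K'\<^sup>2 - s4\<^sup>2" unfolding be c2 by (simp add: power2_eq_square algebra_simps)
  also have "\<dots> = 4 * e * (a' * d' - 1)" by (simp add: s4)
  finally have bc': "b' * c' = a' * d' - 1" using e by simp
  have diag: "a + d = t2" "l * a + m * d = t12" "a' + d' = t4" "l * a' + m * d' = t14" "p + s = t3" "l * p
      + m * s = x"
    unfolding a_def d_def a'_def d'_def p_def s_def k_def by (rule diagonal_entries[OF l(2,3)])+
  define \<rho> where "\<rho> = mk_rep (mk_SL2 l 0 0 m) (mk_SL2 a b c d) (mk_SL2 p 1 e s) (mk_SL2 a' b' c' d')"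
  have "l * m - 0 * 0 = 1" "a * d - b * c = 1" "p * s - 1 * e = 1" "a' * d' - b' * c' = 1"
    using l(2) bc bc' by (simp_all add: e_def)
  note mats = this[THEN mat_of_mk_SL2(1)] this[THEN mat_of_mk_SL2(2)] this[THEN mat_of_mk_SL2(3)]
      this[THEN mat_of_mk_SL2(4)]
  have "2 * (b * e + c) = 2 * K" "2 * (b' * e + c') = 2 * K'"
    using be c2 by (simp_all add: distrib_left)
  then have Ks: "b * e + c = K" "b' * e + c' = K'" unfolding mult_cancel_left by simp_all
  have "2 * (b * e - c) = 2 * s2" "2 * (c' - b' * e) = 2 * s4"
    using be c2 by (simp_all add: right_diff_distrib)
  then have vols: "b * e - c = s2" "c' - b' * e = s4" unfolding mult_cancel_left by simp_all
  show ?thesis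
  proof (rule that[of \<rho>])
    note tr_mats = tr_def \<rho>_def mk_rep_simps times_SL2.rep_eq trace_2 matmul_2 mats
    show "tr [1] \<rho> = t1" "tr [2] \<rho> = t2" "tr [3] \<rho> = t3" "tr [4] \<rho> = t4" "tr [1,2] \<rho> = t12"
        "tr [1,4] \<rho> = t14" "X \<rho> = x"
      using l(1) diag by (simp_all add: tr_mats)
    show "tr [2,3] \<rho> = t23" "tr [3,4] \<rho> = t34"
      using Ks unfolding K_def K'_def by (simp_all add: tr_mats algebra_simps)
    have "2 * (2 * e * (b * c' + c * b')) = (2 * (b * e)) * (2 * c') + (2 * c) * (2 * (b' * e))"
      by (simp add: algebra_simps)
    also have "\<dots> = 2 * (K * K' + s2 * s4)" unfolding be c2 by (simp add: algebra_simps)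
    finally have "2 * e * (b * c' + c * b') = K * K' + s2 * s4" unfolding mult_cancel_left by simp
    then have "b * c' + c * b' = (K * K' + s2 * s4) / (2 * e)" using e
        by (simp add: eq_divide_eq mult.commute)
    then show "Y \<rho> = a * a' + d * d' + (K * K' + s2 * s4) / (2 * e)" by (simp add: tr_mats algebra_simps)
    have "vol 1 2 3 \<rho> = k * (b * e - c)" "vol 1 3 4 \<rho> = k * (c' - b' * e)"
      by (simp_all add: vol_def fun_apply tr_mats k_def algebra_simps)
    then show "vol 1 2 3 \<rho> = k * s2" "vol 1 3 4 \<rho> = k * s4" unfolding vols by simp_all
  qed
qed

text \<open>For index 1 the condition gives distinct eigenvalues \<open>l\<close> and
  \<open>m\<close>; for 2 and 4 it makes the square roots \<open>s2\<close> and \<open>s4\<close>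
  nonzero.\<close>

definition generic :: "rep \<Rightarrow> bool"
  where "generic \<rho> \<longleftrightarrow> (\<forall>i. (tr [i] \<rho>)\<^sup>2 \<noteq> 4)"

text \<open>\<open>s2\<close> and \<open>s4\<close> are square roots of \<open>t\<^sub>2\<^sup>2 - 4\<close> and \<open>t\<^sub>4\<^sup>2 - 4\<close>; their signs can be chosen independently.\<close>

definition escape :: "rep \<Rightarrow> complex \<Rightarrow> complex \<Rightarrow> (nat \<Rightarrow> rep) \<Rightarrow> bool"
  where "escape \<rho> s2 s4 R \<longleftrightarrow>
    (\<forall>\<^sub>F n in sequentially. (\<forall>r\<in>Q_ring. r (R n) = r \<rho>) \<and> X (R n) = of_nat n) \<and>
    (\<lambda>n. Y (R n)) \<longlonglongrightarrow> (tr [2] \<rho> * tr [4] \<rho> - s2 * s4) / 2 \<and>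
    (\<lambda>n. vol 1 2 3 (R n) / of_nat n) \<longlonglongrightarrow> s2 \<and> (\<lambda>n. vol 1 3 4 (R n) / of_nat n) \<longlonglongrightarrow> s4"

text \<open>Put \<open>x = n\<close> in \<open>rep_with_traces\<close>. Then \<open>p\<close> and
  \<open>s\<close> grow like \<open>n / w\<close> and \<open>- n / w\<close>, and \<open>e\<close>
  like \<open>- n^2 / w^2\<close>. The radicand of \<open>s2\<close> divided by \<open>n^2\<close>
  tends to \<open>((d - a)^2 + 4 (a d - 1)) / w^2 = (s2 / w)^2\<close>, because \<open>a + d\<close>
  is the trace \<open>q 1\<close>; likewise for \<open>s4\<close>.\<close>

lemma reps_with_traces_at_infinity:
  fixes q :: "nat \<Rightarrow> complex"
  assumes "(q 0)\<^sup>2 \<noteq> 4" "(q 1)\<^sup>2 \<noteq> 4" "(q 3)\<^sup>2 \<noteq> 4" "s2\<^sup>2 = (q 1)\<^sup>2 - 4" "s4\<^sup>2 = (q 3)\<^sup>2 - 4"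
  obtains R :: "nat \<Rightarrow> rep" where
    "\<forall>\<^sub>F n in sequentially. (\<forall>i<8. (Q_gens ! i) (R n) = q i) \<and> X (R n) = of_nat n"
    "(\<lambda>n. Y (R n)) \<longlonglongrightarrow> (q 1 * q 3 - s2 * s4) / 2"
    "(\<lambda>n. vol 1 2 3 (R n) / of_nat n) \<longlonglongrightarrow> s2" "(\<lambda>n. vol 1 3 4 (R n) / of_nat n) \<longlonglongrightarrow> s4"
proof -
  \<comment> \<open>\<open>l\<close> and \<open>m\<close> are the eigenvalues of the first matrix
    and \<open>w\<close> is their difference.\<close>
  define w where "w = csqrt ((q 0)\<^sup>2 - 4)"
  have w: "w\<^sup>2 = (q 0)\<^sup>2 - 4" by (simp add: w_def)
  define l where "l = (q 0 + w) / 2"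
  define m where "m = (q 0 - w) / 2"
  have k: "l - m = w" by (simp add: l_def m_def field_simps)
  have w0: "w \<noteq> 0" using w assms(1) by auto
  have "l * m = ((q 0)\<^sup>2 - w\<^sup>2) / 4" by (simp add: l_def m_def power2_eq_square algebra_simps)
  then have lm: "l + m = q 0" "l * m = 1" unfolding w by (simp_all add: l_def m_def field_simps)
  define a where "a = (q 4 - q 1 * m) / w"
  define d where "d = (l * q 1 - q 4) / w"
  define a' where "a' = (q 7 - q 3 * m) / w"
  define d' where "d' = (l * q 3 - q 7) / w"
  have ad: "a + d = q 1" "a' + d' = q 3"
    unfolding a_def d_def a'_def d'_def k[symmetric] by (rule diagonal_entries[OF lm(2)], simp add: k w0)+
  define p where "p n = (of_nat n - q 2 * m) / w" for n :: nat
  define s where "s n = (l * q 2 - of_nat n) / w" for n :: nat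
  define e where "e n = p n * s n - 1" for n
  define K where "K n = q 5 - a * p n - d * s n" for n
  define K' where "K' n = q 6 - a' * p n - d' * s n" for n
  have inv: "(\<lambda>n. c / of_nat n) \<longlonglongrightarrow> 0" for c :: complex
    by (rule tendsto_divide_0[OF tendsto_const tendsto_of_nat])
  have nz: "\<forall>\<^sub>F n in sequentially. (of_nat n :: complex) \<noteq> 0"
    using eventually_gt_at_top[of 0] by eventually_elim simp
  have p: "(\<lambda>n. p n / of_nat n) \<longlonglongrightarrow> 1 / w"
  proof (rule Lim_transform_eventually)
    show "(\<lambda>n. (1 - (q 2 * m) / of_nat n) / w) \<longlonglongrightarrow> 1 / w"
      using tendsto_divide[OF tendsto_diff[OF tendsto_const[of 1] inv] tendsto_const w0] by simp
    show "\<forall>\<^sub>F n in sequentially. (1 - (q 2 * m) / of_nat n) / w = p n / of_nat n"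
      using nz by eventually_elim (simp add: p_def field_simps)
  qed
  have s: "(\<lambda>n. s n / of_nat n) \<longlonglongrightarrow> - 1 / w"
  proof (rule Lim_transform_eventually)
    show "(\<lambda>n. ((l * q 2) / of_nat n - 1) / w) \<longlonglongrightarrow> - 1 / w"
      using tendsto_divide[OF tendsto_diff[OF inv tendsto_const[of 1]] tendsto_const w0] by simp
    show "\<forall>\<^sub>F n in sequentially. ((l * q 2) / of_nat n - 1) / w = s n / of_nat n"
      using nz by eventually_elim (simp add: s_def field_simps)
  qed
  have e: "(\<lambda>n. e n / (of_nat n)\<^sup>2) \<longlonglongrightarrow> - 1 / w\<^sup>2"
  proof (rule Lim_transform_eventually)
    show "(\<lambda>n. (p n / of_nat n) * (s n / of_nat n) - (1 / of_nat n) * (1 / of_nat n)) \<longlonglongrightarrow> - 1 / w\<^sup>2"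
      using tendsto_diff[OF tendsto_mult[OF p s] tendsto_mult[OF inv[of 1] inv[of 1]]]
          by (simp add: power2_eq_square)
    show "\<forall>\<^sub>F n in sequentially. (p n / of_nat n) * (s n / of_nat n) - (1 / of_nat n) * (1 / of_nat n) = e
        n / (of_nat n)\<^sup>2"
      by (simp add: e_def power2_eq_square diff_divide_distrib)
  qed
  have Klim: "(\<lambda>n. (c - \<alpha> * p n - \<beta> * s n) / of_nat n) \<longlonglongrightarrow> (\<beta> - \<alpha>) / w" for c \<alpha> \<beta>
  proof (rule Lim_transform_eventually)
    show "(\<lambda>n. c / of_nat n - \<alpha> * (p n / of_nat n) - \<beta> * (s n / of_nat n)) \<longlonglongrightarrow> (\<beta> - \<alpha>) / w"
      using tendsto_diff[OF tendsto_diff[OF inv tendsto_mult[OF tendsto_const p]] tendsto_mult[OF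
          tendsto_const s], of c \<alpha> \<beta>]
      by (simp add: diff_divide_distrib)
    show "\<forall>\<^sub>F n in sequentially. c / of_nat n - \<alpha> * (p n / of_nat n) - \<beta> * (s n / of_nat n) = (c - \<alpha> * p n
        - \<beta> * s n) / of_nat n"
      by (simp add: diff_divide_distrib)
  qed
  have K: "(\<lambda>n. K n / of_nat n) \<longlonglongrightarrow> (d - a) / w" and K': "(\<lambda>n. K' n / of_nat n) \<longlonglongrightarrow> (d' - a') / w"
    unfolding K_def K'_def by (rule Klim)+
  \<comment> \<open>The root is taken after division by \<open>n^2\<close>, where the radicand has a
    nonzero limit, and then scaled back by \<open>n\<close>. At \<open>n = 0\<close> the division is
    void, hence \<open>n > 0\<close>.\<close>
  have root: "\<exists>S. (\<forall>n>0. (S n)\<^sup>2 = (C n)\<^sup>2 - 4 * e n * (\<alpha> * \<beta> - 1)) \<and> (\<lambda>n. S n / of_nat n) \<longlonglongrightarrow> \<sigma> / w"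
    if C: "(\<lambda>n. C n / of_nat n) \<longlonglongrightarrow> (\<beta> - \<alpha>) / w" and \<sigma>: "\<sigma>\<^sup>2 = (\<alpha> + \<beta>)\<^sup>2 - 4" "\<sigma> \<noteq> 0" for C \<alpha> \<beta> \<sigma>
  proof -
    have "(\<lambda>n. (C n / of_nat n)\<^sup>2 - 4 * (e n / (of_nat n)\<^sup>2) * (\<alpha> * \<beta> - 1)) \<longlonglongrightarrow> ((\<beta> - \<alpha>) / w)\<^sup>2 - 4 * (- 1 /
        w\<^sup>2) * (\<alpha> * \<beta> - 1)"
      by (intro tendsto_intros C e)
    also have "((\<beta> - \<alpha>) / w)\<^sup>2 - 4 * (- 1 / w\<^sup>2) * (\<alpha> * \<beta> - 1) = ((\<beta> - \<alpha>)\<^sup>2 + 4 * (\<alpha> * \<beta> - 1)) / w\<^sup>2"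
      by (simp add: power_divide add_divide_distrib)
    also have "(\<beta> - \<alpha>)\<^sup>2 + 4 * (\<alpha> * \<beta> - 1) = \<sigma>\<^sup>2"
      unfolding \<sigma> by (simp add: power2_eq_square algebra_simps)
    also have "\<sigma>\<^sup>2 / w\<^sup>2 = (\<sigma> / w)\<^sup>2" by (simp add: power_divide)
    finally have lim: "(\<lambda>n. (C n / of_nat n)\<^sup>2 - 4 * (e n / (of_nat n)\<^sup>2) * (\<alpha> * \<beta> - 1)) \<longlonglongrightarrow> (\<sigma> / w)\<^sup>2" .
    have "\<sigma> / w \<noteq> 0" using \<sigma>(2) w0 by simp
    from sqrt_sequence[OF lim this] obtain S where
      S: "\<And>n. (S n)\<^sup>2 = (C n / of_nat n)\<^sup>2 - 4 * (e n / (of_nat n)\<^sup>2) * (\<alpha> * \<beta> - 1)" "S \<longlonglongrightarrow> \<sigma> / w"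
      by blast
    show ?thesis
    proof (intro exI conjI allI impI)
      fix n :: nat assume "n > 0"
      then show "(of_nat n * S n)\<^sup>2 = (C n)\<^sup>2 - 4 * e n * (\<alpha> * \<beta> - 1)"
        by (simp add: power_mult_distrib S power_divide right_diff_distrib)
    next
      show "(\<lambda>n. of_nat n * S n / of_nat n) \<longlonglongrightarrow> \<sigma> / w"
      proof (rule Lim_transform_eventually[OF S(2)])
        show "\<forall>\<^sub>F n in sequentially. S n = of_nat n * S n / of_nat n"
          using nz by eventually_elim simp
      qed
    qed
  qed
  have s0: "s2 \<noteq> 0" "s4 \<noteq> 0" using assms by auto
  obtain S2 where S2: "\<And>n. n > 0 \<Longrightarrow> (S2 n)\<^sup>2 = (K n)\<^sup>2 - 4 * e n * (a * d - 1)"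
      "(\<lambda>n. S2 n / of_nat n) \<longlonglongrightarrow> s2 / w"
    using root[OF K] assms(4) s0 unfolding ad by blast
  obtain S4 where S4: "\<And>n. n > 0 \<Longrightarrow> (S4 n)\<^sup>2 = (K' n)\<^sup>2 - 4 * e n * (a' * d' - 1)"
      "(\<lambda>n. S4 n / of_nat n) \<longlonglongrightarrow> s4 / w"
    using root[OF K'] assms(5) s0 unfolding ad by blast
  define good where "good n \<rho> \<longleftrightarrow> (\<forall>i<8. (Q_gens ! i) \<rho> = q i) \<and> X \<rho> = of_nat n \<and>
     Y \<rho> = a * a' + d * d' + (K n * K' n + S2 n * S4 n) / (2 * e n) \<and> vol 1 2 3 \<rho> = w * S2 n \<and>
         vol 1 3 4 \<rho> = w * S4 n" for n \<rho>
  have ex: "\<exists>\<rho>. good n \<rho>" if n: "n > 0" "e n \<noteq> 0" for n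
  proof -
    have 8: "(\<forall>i<8. P i) \<longleftrightarrow> P 7 \<and> P 6 \<and> P 5 \<and> P 4 \<and> P 3 \<and> P 2 \<and> P 1 \<and> P (0::nat)" for P
      by (simp add: eval_nat_numeral All_less_Suc)
    note rep = rep_with_traces[OF lm, where x = "of_nat n" and ?t2.0 = "q 1" and ?t3.0 = "q 2" and ?t4.0 =
        "q 3"
        and ?t12.0 = "q 4" and ?t23.0 = "q 5" and ?t34.0 = "q 6" and ?t14.0 = "q 7" and ?s2.0 =
            "S2 n" and ?s4.0 = "S4 n",
        unfolded k, folded a_def d_def a'_def d'_def p_def s_def, folded e_def K_def K'_def]
    show ?thesis
    proof (rule rep[OF w0 n(2) S2(1)[OF n(1)] S4(1)[OF n(1)]])
      fix \<rho>
      assume "tr [1] \<rho> = q 0" "tr [2] \<rho> = q 1" "tr [3] \<rho> = q 2" "tr [4] \<rho> = q 3"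
        "tr [1,2] \<rho> = q 4" "tr [2,3] \<rho> = q 5" "tr [3,4] \<rho> = q 6" "tr [1,4] \<rho> = q 7" "X \<rho> = of_nat n"
        "Y \<rho> = a * a' + d * d' + (K n * K' n
            + S2 n * S4 n) / (2 * e n)" "vol 1 2 3 \<rho> = w * S2 n" "vol 1 3 4 \<rho> = w * S4 n"
      then have "good n \<rho>" unfolding good_def 8 by (simp add: Q_gens_def)
      then show ?thesis by blast
    qed
  qed
  \<comment> \<open>The value is arbitrary at the early \<open>n\<close> where no good
    representation is known; \<open>e n\<close> is eventually nonzero.\<close>
  define R where "R n = (SOME \<rho>. good n \<rho>)" for n
  have "\<forall>\<^sub>F n in sequentially. e n / (of_nat n)\<^sup>2 \<noteq> 0"
    by (rule tendsto_imp_eventually_ne[OF e]) (simp add: w0)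
  then have e_nz: "\<forall>\<^sub>F n in sequentially. e n \<noteq> 0 \<and> n > 0"
    by eventually_elim auto
  then have R: "\<forall>\<^sub>F n in sequentially. good n (R n)"
  proof eventually_elim
    case (elim n)
    then show ?case unfolding R_def using ex by (intro someI_ex[of "good n"]) auto
  qed
  show ?thesis
  proof (rule that[of R])
    show "\<forall>\<^sub>F n in sequentially. (\<forall>i<8. (Q_gens ! i) (R n) = q i) \<and> X (R n) = of_nat n"
      using R by eventually_elim (simp add: good_def)
    have "(\<lambda>n. a * a' + d * d' + ((K n / of_nat n) * (K' n / of_nat n)
        + (S2 n / of_nat n) * (S4 n / of_nat n)) / (2 * (e n / (of_nat n)\<^sup>2)))
      \<longlonglongrightarrow> a * a' + d * d' + ((d - a) / w * ((d' - a') / w) + s2 / w * (s4 / w)) / (2 * (- 1 / w\<^sup>2))"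
      using w0 by (intro tendsto_intros K K' S2(2) S4(2) e) auto
    \<comment> \<open>The terms without square roots combine to
      \<open>(a + d) * (a' + d') / 2\<close>.\<close>
    also have "a * a' + d * d' + ((d - a) / w * ((d' - a') / w)
        + s2 / w * (s4 / w)) / (2 * (- 1 / w\<^sup>2)) = (q 1 * q 3 - s2 * s4) / 2"
      unfolding ad[symmetric] using w0 by (simp add: field_simps power2_eq_square)
    finally show "(\<lambda>n. Y (R n)) \<longlonglongrightarrow> (q 1 * q 3 - s2 * s4) / 2"
    proof (rule Lim_transform_eventually)
      show "\<forall>\<^sub>F n in sequentially. a * a' + d * d' + ((K n / of_nat n) * (K' n / of_nat n)
          + (S2 n / of_nat n) * (S4 n / of_nat n)) / (2 * (e n / (of_nat n)\<^sup>2)) = Y (R n)"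
        using R e_nz by eventually_elim (simp add: good_def field_simps power2_eq_square)
    qed
    have "(\<lambda>n. w * (S2 n / of_nat n)) \<longlonglongrightarrow> w * (s2 / w)" "(\<lambda>n. w * (S4 n / of_nat n)) \<longlonglongrightarrow> w * (s4 / w)"
      by (intro tendsto_intros S2(2) S4(2))+
    then have "(\<lambda>n. w * (S2 n / of_nat n)) \<longlonglongrightarrow> s2" "(\<lambda>n. w * (S4 n / of_nat n)) \<longlonglongrightarrow> s4"
      using w0 by simp_all
    moreover have "\<forall>\<^sub>F n in sequentially. w * (S2 n / of_nat n) = vol 1 2 3 (R n) / of_nat n"
      "\<forall>\<^sub>F n in sequentially. w * (S4 n / of_nat n) = vol 1 3 4 (R n) / of_nat n"
      using R by (eventually_elim; simp add: good_def)+
    ultimately show "(\<lambda>n. vol 1 2 3 (R n) / of_nat n) \<longlonglongrightarrow> s2" "(\<lambda>n. vol 1 3 4 (R n) / of_nat n) \<longlonglongrightarrow> s4"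
      by (blast intro: Lim_transform_eventually)+
  qed
qed

lemma Q_ring_eqI:
  assumes "r \<in> Q_ring" "\<And>f. f \<in> set Q_gens \<Longrightarrow> f \<rho> = f \<rho>'"
  shows "r \<rho> = r \<rho>'"
  by (rule hull_induct[OF assms(1)[unfolded Q_ring_def], of "\<lambda>r. r \<rho> = r \<rho>'"])
     (auto simp: assms(2) complex_subalgebra_def fun_apply)

lemma escape_exists:
  assumes "generic \<rho>" "s2\<^sup>2 = (tr [2] \<rho>)\<^sup>2 - 4" "s4\<^sup>2 = (tr [4] \<rho>)\<^sup>2 - 4"
  obtains R where "escape \<rho> s2 s4 R"
proof -
  define q where "q i = (Q_gens ! i) \<rho>" for i
  have q: "q 0 = tr [1] \<rho>" "q 1 = tr [2] \<rho>" "q 3 = tr [4] \<rho>" by (simp_all add: q_def Q_gens_def)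
  have h: "(q 0)\<^sup>2 \<noteq> 4" "(q 1)\<^sup>2 \<noteq> 4" "(q 3)\<^sup>2 \<noteq> 4" "s2\<^sup>2 = (q 1)\<^sup>2 - 4" "s4\<^sup>2 = (q 3)\<^sup>2 - 4"
    using assms unfolding q generic_def by simp_all
  obtain R where R: "\<forall>\<^sub>F n in sequentially. (\<forall>i<8. (Q_gens ! i) (R n) = q i) \<and> X (R n) = of_nat n"
    "(\<lambda>n. Y (R n)) \<longlonglongrightarrow> (q 1 * q 3 - s2 * s4) / 2"
    "(\<lambda>n. vol 1 2 3 (R n) / of_nat n) \<longlonglongrightarrow> s2" "(\<lambda>n. vol 1 3 4 (R n) / of_nat n) \<longlonglongrightarrow> s4"
    by (rule reps_with_traces_at_infinity[OF h])
  have "\<forall>\<^sub>F n in sequentially. (\<forall>r\<in>Q_ring. r (R n) = r \<rho>) \<and> X (R n) = of_nat n"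
    using R(1)
  proof eventually_elim
    case (elim n)
    have "length Q_gens = 8" by (simp add: Q_gens_def)
    then have "f (R n) = f \<rho>" if "f \<in> set Q_gens" for f
      using that elim unfolding q_def by (metis in_set_conv_nth)
    then show ?case using elim by (auto intro: Q_ring_eqI)
  qed
  then show ?thesis using that R(2-4) unfolding escape_def q by blast
qed

lemma infinite_generic_values: "infinite {z :: complex. z\<^sup>2 \<noteq> 4}"
proof -
  have "{z :: complex. z\<^sup>2 = 4} \<subseteq> {2, -2}"
    using power2_eq_iff[of _ "2::complex"] by auto
  then have "finite {z :: complex. z\<^sup>2 = 4}" by (rule finite_subset) simp
  then have "infinite (UNIV - {z :: complex. z\<^sup>2 = 4})"
    by (intro Diff_infinite_finite) (simp_all add: infinite_UNIV_char_0)
  then show ?thesis by (simp add: set_diff_eq)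
qed

text \<open>The eight generators attain all values with squares different from 4, an infinite grid,
  and representations attaining them are generic. This is algebraic independence, tested on generic
  representations only.\<close>

lemma Q_poly_zero:
  assumes "p \<in> polynomials_in {..<8}" "\<And>\<rho>. generic \<rho> \<Longrightarrow> poly_eval (\<lambda>i. Q_gens ! i) p \<rho> = 0"
  shows "p = 0"
proof (rule poly_eval_grid_zero[OF assms(1) infinite_generic_values])
  fix v :: "nat \<Rightarrow> complex" assume v: "\<And>i. i < 8 \<Longrightarrow> v i \<in> {z. z\<^sup>2 \<noteq> 4}"
  obtain R where R: "\<forall>\<^sub>F n in sequentially. (\<forall>i<8. (Q_gens ! i) (R n) = v i) \<and> X (R n) = of_nat n"
    using reps_with_traces_at_infinity[of v "csqrt ((v 1)\<^sup>2 - 4)"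
        "csqrt ((v 3)\<^sup>2 - 4)"] v[of 0] v[of 1] v[of 3] by auto
  then obtain n where n: "\<forall>i<8. (Q_gens ! i) (R n) = v i"
    using eventually_happens'[OF sequentially_bot R] by auto
  have "tr [1] (R n) = v 0" "tr [2] (R n) = v 1" "tr [3] (R n) = v 2" "tr [4] (R n) = v 3"
    using n[rule_format, of 0] n[rule_format, of 1] n[rule_format, of 2] n[rule_format, of 3]
        by (simp_all add: Q_gens_def)
  then have "generic (R n)"
    using v[of 0] v[of 1] v[of 2] v[of 3] by (auto simp: generic_def forall_4)
  then show "\<exists>\<rho>. (\<forall>i<8. (Q_gens ! i) \<rho> = v i) \<and> poly_eval (\<lambda>i. Q_gens ! i) p \<rho> = 0"
    using n assms(2) by blast
qed

lemma length_Q_gens: "length Q_gens = 8"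
  by (simp add: Q_gens_def)

lemma Q_ring_eq_poly_eval: "Q_ring = poly_eval (\<lambda>i. Q_gens ! i) ` polynomials_in {..<8}"
  using poly_eval_image[of Q_gens] unfolding Q_ring_def length_Q_gens by simp

lemma Q_ring_zeroI:
  assumes "r \<in> Q_ring" "\<And>\<rho>. generic \<rho> \<Longrightarrow> r \<rho> = 0"
  shows "r = 0"
proof -
  obtain p where p: "p \<in> polynomials_in {..<8}" "r = poly_eval (\<lambda>i. Q_gens ! i) p"
    using assms(1) unfolding Q_ring_eq_poly_eval by auto
  then have "p = 0" using assms(2) by (intro Q_poly_zero) auto
  then show ?thesis using p(2) by (simp add: poly_eval_0)
qed

subsection \<open>Linear independence\<close>

text \<open>Divided by \<open>n^k\<close>, the relation tends to \<open>L k = 0\<close>: lower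
  powers have bounded coefficients and the remainder is negligible.\<close>

lemma lead_coeff:
  fixes c :: "nat \<Rightarrow> nat \<Rightarrow> complex"
  assumes "\<And>j. j \<le> k \<Longrightarrow> c j \<longlonglongrightarrow> L j" "(\<lambda>n. h n / of_nat n ^ k) \<longlonglongrightarrow> 0"
    and "\<forall>\<^sub>F n in sequentially. (\<Sum>j\<le>k. of_nat n ^ j * c j n) + h n = 0"
  shows "L k = 0"
proof -
  have pow: "(\<lambda>n. of_nat n ^ j / of_nat n ^ k :: complex) \<longlonglongrightarrow> (if j = k then 1 else 0)" if "j \<le> k" for j
  proof -
    have "(\<lambda>n. (1 / of_nat n :: complex) ^ (k - j)) \<longlonglongrightarrow> 0 ^ (k - j)"
      by (intro tendsto_power tendsto_divide_0[OF tendsto_const tendsto_of_nat])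
    moreover have "\<forall>\<^sub>F n in sequentially. (1 / of_nat n :: complex) ^ (k - j) = of_nat n ^ j / of_nat n ^ k"
      using eventually_gt_at_top[of 0]
    proof eventually_elim
      case (elim n)
      then have "(of_nat n :: complex) ^ (k - j) = of_nat n ^ k / of_nat n ^ j"
        using that by (intro power_diff) auto
      then show ?case by (simp add: power_divide)
    qed
    ultimately show ?thesis using that by (auto simp: power_0_left intro: Lim_transform_eventually)
  qed
  have "(\<lambda>n. (\<Sum>j\<le>k. of_nat n ^ j / of_nat n ^ k * c j n)
      + h n / of_nat n ^ k) \<longlonglongrightarrow> (\<Sum>j\<le>k. (if j = k then 1 else 0) * L j) + 0"
    by (intro tendsto_add tendsto_sum tendsto_mult pow assms(1,2)) auto
  also have "(\<Sum>j\<le>k. (if j = k then 1 else 0) * L j) + 0 = L k"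
    by (simp add: if_distrib[of "\<lambda>x. x * _"] cong: if_cong)
  finally have "(\<lambda>n. (\<Sum>j\<le>k. of_nat n ^ j / of_nat n ^ k * c j n) + h n / of_nat n ^ k) \<longlonglongrightarrow> L k" .
  moreover have "\<forall>\<^sub>F n in sequentially. (\<Sum>j\<le>k. of_nat n ^ j / of_nat n ^ k * c j n) + h n / of_nat n ^ k = 0"
    using assms(3)
  proof eventually_elim
    case (elim n)
    have "(\<Sum>j\<le>k. of_nat n ^ j / of_nat n ^ k * c j n) + h n / of_nat n ^ k = ((\<Sum>j\<le>k. of_nat n ^ j * c j n)
        + h n) / of_nat n ^ k"
      by (simp add: sum_divide_distrib add_divide_distrib)
    then show ?case by (simp add: elim)
  qed
  ultimately have "(\<lambda>n. 0) \<longlonglongrightarrow> L k" by (rule Lim_transform_eventually)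
  then show ?thesis by (simp add: LIMSEQ_const_iff)
qed

lemma inverse_nat_tendsto: "(\<lambda>n. c / of_nat n) \<longlonglongrightarrow> (0 :: complex)"
  by (rule tendsto_divide_0[OF tendsto_const tendsto_of_nat])

text \<open>Take the largest \<open>K\<close> with \<open>u K\<close> or \<open>v K\<close> nonzero.
  Along an escaping sequence the coefficients are eventually constant and \<open>X = n\<close>,
  while \<open>H\<close> is negligible against \<open>n^(m + k0)\<close>; so
  \<open>u K * a + v K * b\<close> vanishes at \<open>\<rho>\<close>. Both signs of
  \<open>s4\<close> give two equations, and \<open>ndg\<close> says that their determinant is
  nonzero. Hence \<open>u K\<close> and \<open>v K\<close> vanish at generic representations, and so
  identically.\<close>

lemma leading_terms_vanish:
  fixes e1 e2 H :: "rep \<Rightarrow> complex"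
  assumes Q: "\<And>k. u k \<in> Q_ring" "\<And>k. v k \<in> Q_ring"
    and rel: "\<And>\<rho>. (\<Sum>k<N. X \<rho> ^ k * (u k \<rho> * e1 \<rho> + v k \<rho> * e2 \<rho>)) + H \<rho> = 0"
    and lim: "\<And>\<rho> s2 s4 R. generic \<rho> \<Longrightarrow> escape \<rho> s2 s4 R \<Longrightarrow>
      (\<lambda>n. e1 (R n) / of_nat n ^ m) \<longlonglongrightarrow> a \<rho> s2 s4 \<and> (\<lambda>n. e2 (R n) / of_nat n ^ m) \<longlonglongrightarrow> b \<rho> s2 s4 \<and>
      (\<lambda>n. H (R n) / of_nat n ^ (m + k0)) \<longlonglongrightarrow> 0"
    and ndg: "\<And>\<rho> s2 s4. generic \<rho> \<Longrightarrow> s2 \<noteq> 0 \<Longrightarrow> s4 \<noteq> 0 \<Longrightarrow>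
      a \<rho> s2 s4 * b \<rho> s2 (- s4) \<noteq> a \<rho> s2 (- s4) * b \<rho> s2 s4"
    and "k0 \<le> k" "k < N"
  shows "u k = 0 \<and> v k = 0"
proof (rule ccontr)
  assume *: "\<not> (u k = 0 \<and> v k = 0)"
  define S where "S = {k. k0 \<le> k \<and> k < N \<and> \<not> (u k = 0 \<and> v k = 0)}"
  have S: "finite S" "S \<noteq> {}" using * assms(6,7) by (auto simp: S_def)
  define K where "K = Max S"
  have K: "K \<in> S" "\<And>j. j \<in> S \<Longrightarrow> j \<le> K" using S by (auto simp: K_def)
  have high: "u j = 0 \<and> v j = 0" if "K < j" "j < N" for j
  proof (rule ccontr)
    assume "\<not> (u j = 0 \<and> v j = 0)"
    moreover have "k0 \<le> j" using that K(1) by (simp add: S_def)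
    ultimately have "j \<in> S" using that by (simp add: S_def)
    then show False using K(2) that by fastforce
  qed
  have rel': "(\<Sum>j\<le>K. X \<rho> ^ j * (u j \<rho> * e1 \<rho> + v j \<rho> * e2 \<rho>)) + H \<rho> = 0" for \<rho>
  proof -
    have "(\<Sum>j<N. X \<rho> ^ j * (u j \<rho> * e1 \<rho> + v j \<rho> * e2 \<rho>)) = (\<Sum>j\<le>K. X \<rho> ^ j * (u j \<rho> * e1 \<rho> + v j \<rho> * e2 \<rho>))"
      using K(1) high by (intro sum.mono_neutral_right) (auto simp: S_def fun_apply)
    then show ?thesis using rel[of \<rho>] by simp
  qed
  have lead: "u K \<rho> * a \<rho> s2 s4 + v K \<rho> * b \<rho> s2 s4 = 0" if \<rho>: "generic \<rho>" and R:
      "escape \<rho> s2 s4 R" for \<rho> s2 s4 R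
  proof (rule lead_coeff[of K "\<lambda>j n. u j \<rho> * (e1 (R n) / of_nat n ^ m) + v j \<rho> * (e2 (R n) / of_nat n ^ m)"
        "\<lambda>j. u j \<rho> * a \<rho> s2 s4 + v j \<rho> * b \<rho> s2 s4" "\<lambda>n. H (R n) / of_nat n ^ m"])
    fix j
    show "(\<lambda>n. u j \<rho> * (e1 (R n) / of_nat n ^ m) + v j \<rho> * (e2 (R n) / of_nat n ^ m)) \<longlonglongrightarrow> u j \<rho> * a \<rho> s2 s4
        + v j \<rho> * b \<rho> s2 s4"
      using lim[OF \<rho> R] by (intro tendsto_intros) auto
  next
    have "(\<lambda>n. H (R n) / of_nat n ^ (m + k0) * (1 / of_nat n) ^ (K - k0)) \<longlonglongrightarrow> 0 * 0 ^ (K - k0)"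
      using lim[OF \<rho> R] by (intro tendsto_mult tendsto_power inverse_nat_tendsto) auto
    moreover have "H (R n) / of_nat n ^ (m
        + k0) * (1 / of_nat n) ^ (K - k0) = H (R n) / of_nat n ^ m / of_nat n ^ K" for n
    proof -
      have "(of_nat n :: complex) ^ K = of_nat n ^ k0 * of_nat n ^ (K - k0)"
        using K(1) by (simp add: S_def flip: power_add)
      then show ?thesis by (simp add: power_add power_divide)
    qed
    ultimately show "(\<lambda>n. H (R n) / of_nat n ^ m / of_nat n ^ K) \<longlonglongrightarrow> 0" by simp
  next
    have "\<forall>\<^sub>F n in sequentially. (\<forall>r\<in>Q_ring. r (R n) = r \<rho>) \<and> X (R n) = of_nat n" using R
        by (simp add: escape_def)
    then show "\<forall>\<^sub>F n in sequentially. (\<Sum>j\<le>K. of_nat n ^ j * (u j \<rho> * (e1 (R n) / of_nat n ^ m)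
        + v j \<rho> * (e2 (R n) / of_nat n ^ m)))
        + H (R n) / of_nat n ^ m = 0"
    proof eventually_elim
      case (elim n)
      then have "u j (R n) = u j \<rho>" "v j (R n) = v j \<rho>" for j using Q by auto
      then have "(\<Sum>j\<le>K. of_nat n ^ j * (u j \<rho> * (e1 (R n) / of_nat n ^ m)
          + v j \<rho> * (e2 (R n) / of_nat n ^ m))) + H (R n) / of_nat n ^ m
        = ((\<Sum>j\<le>K. X (R n) ^ j * (u j (R n) * e1 (R n) + v j (R n) * e2 (R n))) + H (R n)) / of_nat n ^ m"
        using elim by (simp add: add_divide_distrib sum_divide_distrib distrib_left)
      then show ?case by (simp add: rel')
    qed
  qed
  have "u K \<rho> = 0 \<and> v K \<rho> = 0" if \<rho>: "generic \<rho>" for \<rho>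
  proof -
    define s2 where "s2 = csqrt ((tr [2] \<rho>)\<^sup>2 - 4)"
    define s4 where "s4 = csqrt ((tr [4] \<rho>)\<^sup>2 - 4)"
    have s: "s2\<^sup>2 = (tr [2] \<rho>)\<^sup>2 - 4" "s4\<^sup>2 = (tr [4] \<rho>)\<^sup>2 - 4" "(- s4)\<^sup>2 = (tr [4] \<rho>)\<^sup>2 - 4"
      by (simp_all add: s2_def s4_def)
    have nz: "s2 \<noteq> 0" "s4 \<noteq> 0" using \<rho> by (auto simp: s2_def s4_def generic_def)
    obtain R where R: "escape \<rho> s2 s4 R" using escape_exists[OF \<rho> s(1,2)] by blast
    obtain R' where R': "escape \<rho> s2 (- s4) R'" using escape_exists[OF \<rho> s(1,3)] by blast
    note l = lead[OF \<rho> R] lead[OF \<rho> R'] and n = ndg[OF \<rho> nz]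
    define U V where "U = u K \<rho>" and "V = v K \<rho>"
    define a1 a2 b1 b2 where "a1 = a \<rho> s2 s4" and "a2 = a \<rho> s2 (- s4)" and "b1 = b \<rho> s2 s4" and
        "b2 = b \<rho> s2 (- s4)"
    have l': "U * a1 + V * b1 = 0" "U * a2 + V * b2 = 0" and n': "a1 * b2 - a2 * b1 \<noteq> 0"
      using l n by (simp_all add: U_def V_def a1_def a2_def b1_def b2_def)
    have "U * (a1 * b2 - a2 * b1) = (U * a1 + V * b1) * b2 - (U * a2 + V * b2) * b1"
        by (simp add: algebra_simps)
    moreover have "V * (a1 * b2 - a2 * b1) = (U * a2 + V * b2) * a1 - (U * a1 + V * b1) * a2"
        by (simp add: algebra_simps)
    ultimately have "U = 0" "V = 0" using l' n' by simp_all
    then show ?thesis by (simp add: U_def V_def)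
  qed
  then have "u K = 0 \<and> v K = 0" using Q_ring_zeroI Q by blast
  then show False using K(1) by (simp add: S_def)
qed

lemma escape_convergent:
  assumes "escape \<rho> s2 s4 R"
  shows "r \<in> Q_ring \<Longrightarrow> (\<lambda>n. r (R n)) \<longlonglongrightarrow> r \<rho>"
    and "(\<lambda>n. Y (R n)) \<longlonglongrightarrow> (tr [2] \<rho> * tr [4] \<rho> - s2 * s4) / 2"
  using assms by (auto simp: escape_def intro!: tendsto_eventually elim: eventually_mono)

text \<open>The square of such a volume is a Gram determinant that does not involve
  \<open>gram 1 3\<close>, so it converges along the sequence.\<close>

lemma vol_over_n_tendsto_0:
  assumes R: "escape \<rho> s2 s4 R" and ijk: "(i, j, k) \<in> {(1,2,4), (2,3,4)}"
  shows "(\<lambda>n. vol i j k (R n) / of_nat n) \<longlonglongrightarrow> 0"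
proof -
  have Q: "convergent (\<lambda>n. r (R n))" if "r \<in> Q_ring" for r
    using escape_convergent(1)[OF R that] by (rule convergentI)
  have "convergent (\<lambda>n. (Y - (\<lambda>_. 1/2) * (tr [2] * tr [4])) (R n))"
    using Q[OF Q_ring_tr(2)] Q[OF Q_ring_tr(4)] convergentI[OF escape_convergent(2)[OF R]] unfolding fun_apply
    by (intro convergent_diff convergent_mult convergent_const)
  then have g24: "convergent (\<lambda>n. gram 2 4 (R n))" by (simp add: gram_def)
  have g: "convergent (\<lambda>n. gram p q (R n))" if "{p, q} \<subseteq> {i, j, k}" for p q
  proof -
    have "gram p q \<in> {gram p p, gram 1 2, gram 2 3, gram 3 4, gram 1 4, gram 2 4}"
      using that ijk exhaust_4[of p] exhaust_4[of q] gram_sym[of p q] by (elim disjE; auto)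
    then show ?thesis using g24 Q[OF gram_Q_ring(1)[of p]] gram_Q_ring(2-5)[THEN Q] by auto
  qed
  have "convergent (\<lambda>n. (vol i j k * vol i j k) (R n))"
    unfolding vol_mult fun_apply
    by (intro convergent_minus_iff[THEN iffD1] convergent_diff convergent_add convergent_mult
        convergent_const g) auto
  then obtain L where "(\<lambda>n. (vol i j k * vol i j k) (R n)) \<longlonglongrightarrow> L" by (auto simp: convergent_def)
  from tendsto_mult[OF this tendsto_mult[OF inverse_nat_tendsto[of 1] inverse_nat_tendsto[of 1]]]
  have "(\<lambda>n. (vol i j k (R n) / of_nat n)\<^sup>2) \<longlonglongrightarrow> 0"
    by (simp add: power2_eq_square fun_apply)
  from tendsto_real_sqrt[OF tendsto_norm[OF this]] have "(\<lambda>n. norm (vol i j k (R n) / of_nat n)) \<longlonglongrightarrow> 0"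
    by (simp add: norm_power)
  then show ?thesis by (rule tendsto_norm_zero_cancel)
qed

text \<open>The volumes in the first sum grow like \<open>s2 * n\<close> and \<open>s4 * n\<close>,
  whereas the second sum is negligible against \<open>n\<close> because \<open>Y\<close> stays
  bounded.\<close>

lemma vol_terms_vanish_X:
  assumes Q: "\<And>k. u k \<in> Q_ring" "\<And>k. v k \<in> Q_ring" "\<And>k. w k \<in> Q_ring" "\<And>k. z k \<in> Q_ring"
    and rel: "\<And>\<rho>. (\<Sum>k<N. X \<rho> ^ k * (u k \<rho> * vol 1 2 3 \<rho> + v k \<rho> * vol 1 3 4 \<rho>))
      + (\<Sum>k<N. Y \<rho> ^ k * (w k \<rho> * vol 1 2 4 \<rho> + z k \<rho> * vol 2 3 4 \<rho>)) = 0"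
    and "k < N"
  shows "u k = 0 \<and> v k = 0"
proof (rule leading_terms_vanish[where m = 1 and ?k0.0 = 0 and a = "\<lambda>\<rho> s2 s4. s2" and b = "\<lambda>\<rho> s2 s4. s4",
    OF Q(1,2) rel])
  fix \<rho> s2 s4 R assume R: "escape \<rho> s2 s4 R"
  have "(\<lambda>n. \<Sum>k<N. Y (R n) ^ k * (w k (R n) * (vol 1 2 4 (R n) / of_nat n)
      + z k (R n) * (vol 2 3 4 (R n) / of_nat n)))
    \<longlonglongrightarrow> (\<Sum>k<N. ((tr [2] \<rho> * tr [4] \<rho> - s2 * s4) / 2) ^ k * (w k \<rho> * 0 + z k \<rho> * 0))"
    by (intro tendsto_intros escape_convergent[OF R] Q vol_over_n_tendsto_0[OF R]) auto
  then have "(\<lambda>n. (\<Sum>k<N. Y (R n) ^ k * (w k (R n) * vol 1 2 4 (R n)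
      + z k (R n) * vol 2 3 4 (R n))) / of_nat n) \<longlonglongrightarrow> 0"
    by (simp add: sum_divide_distrib add_divide_distrib distrib_left)
  then show "(\<lambda>n. vol 1 2 3 (R n) / of_nat n ^ 1) \<longlonglongrightarrow> s2 \<and> (\<lambda>n. vol 1 3 4 (R n) / of_nat n ^ 1) \<longlonglongrightarrow> s4 \<and>
    (\<lambda>n. (\<Sum>k<N. Y (R n) ^ k * (w k (R n) * vol 1 2 4 (R n) + z k (R n) * vol 2 3 4 (R n))) / of_nat n ^ (1
        + 0)) \<longlonglongrightarrow> 0"
    using R by (simp add: escape_def)
qed (use assms in auto)

text \<open>The second sum can grow like \<open>n\<close>, so it hides the coefficients of
  \<open>X^0\<close> and \<open>X^1\<close>; hence \<open>2 \<le> k\<close> unless that sum is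
  empty. The limits of 1 and \<open>Y\<close> are separated by the sign of
  \<open>s2 * s4\<close>.\<close>

lemma even_terms_vanish_X:
  assumes Q: "\<And>k. u k \<in> Q_ring" "\<And>k. v k \<in> Q_ring" "\<And>k. w k \<in> Q_ring" "\<And>k. z k \<in> Q_ring"
    and rel: "\<And>\<rho>. (\<Sum>k<N. X \<rho> ^ k * (u k \<rho> + v k \<rho> * Y \<rho>)) + (\<Sum>k<M. Y \<rho> ^ k * (w k \<rho> + z k \<rho> * X \<rho>)) = 0"
    and k: "M = 0 \<or> 2 \<le> k" "k < N"
  shows "u k = 0 \<and> v k = 0"
proof (rule leading_terms_vanish[where m = 0 and ?k0.0 = "if M = 0 then 0 else 2" and a =
    "\<lambda>_ _ _. 1" and ?e1.0 = "\<lambda>_. 1"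
      and b = "\<lambda>\<rho> s2 s4. (tr [2] \<rho> * tr [4] \<rho> - s2 * s4) / 2", OF Q(1,2)])
  fix \<rho> s2 s4 R assume R: "escape \<rho> s2 s4 R"
  have "(\<lambda>n. \<Sum>k<M. Y (R n) ^ k * (w k (R n) * (1 / of_nat n) * (1 / of_nat n) + z k (R n) * (1 / of_nat n)))
    \<longlonglongrightarrow> (\<Sum>k<M. ((tr [2] \<rho> * tr [4] \<rho> - s2 * s4) / 2) ^ k * (w k \<rho> * 0 * 0 + z k \<rho> * 0))"
    by (intro tendsto_intros escape_convergent[OF R] Q inverse_nat_tendsto)
  moreover have "\<forall>\<^sub>F n in sequentially. (\<Sum>k<M. Y (R n) ^ k * (w k (R n) * (1 / of_nat n) * (1 / of_nat n)
      + z k (R n) * (1 / of_nat n)))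
     = (\<Sum>k<M. Y (R n) ^ k * (w k (R n) + z k (R n) * X (R n))) / of_nat n ^ 2"
    using R[unfolded escape_def, THEN conjunct1] eventually_gt_at_top[of 0]
    by eventually_elim (simp add: sum_divide_distrib power2_eq_square field_simps)
  ultimately have "(\<lambda>n. (\<Sum>k<M. Y (R n) ^ k * (w k (R n) + z k (R n) * X (R n))) / of_nat n ^ 2) \<longlonglongrightarrow> 0"
    by (auto intro: Lim_transform_eventually)
  then show "(\<lambda>n. 1 / of_nat n ^ 0) \<longlonglongrightarrow> (1::complex) \<and>
      (\<lambda>n. Y (R n) / of_nat n ^ 0) \<longlonglongrightarrow> (tr [2] \<rho> * tr [4] \<rho> - s2 * s4) / 2 \<and>
    (\<lambda>n. (\<Sum>k<M. Y (R n) ^ k * (w k (R n) + z k (R n) * X (R n))) / of_nat n ^ (0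
        + (if M = 0 then 0 else 2))) \<longlonglongrightarrow> 0"
    using escape_convergent(2)[OF R] by simp
qed (use rel k in auto)

section \<open>Symmetries: transposition and rotation of the indices\<close>

definition transp :: "rep \<Rightarrow> rep"
  where "transp \<rho> = (\<lambda>i. Abs_SL2 (transpose (mat_of_SL2 (\<rho> i))))"

lemma mat_of_transp: "mat_of_SL2 (transp \<rho> i) $ j $ k = mat_of_SL2 (\<rho> i) $ k $ j"
proof -
  have "mat_of_SL2 (transp \<rho> i) = transpose (mat_of_SL2 (\<rho> i))"
    unfolding transp_def using mat_of_SL2[of "\<rho> i"] by (intro Abs_SL2_inverse) simp
  then show ?thesis by (simp add: transpose_def)
qed

text \<open>Transposition reverses products. It fixes \<open>X\<close>, \<open>Y\<close> and
  \<open>Q_ring\<close> and negates the volumes.\<close>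

lemma tr_transp:
  "tr [i] (transp \<rho>) = tr [i] \<rho>" "tr [i, j] (transp \<rho>) = tr [i, j] \<rho>" "tr [i, j, k] (transp \<rho>) = tr [k, j,
      i] \<rho>"
  by (simp_all add: tr_def times_SL2.rep_eq trace_2 matmul_2 mat_of_transp algebra_simps)

lemma Q_ring_transp: "r \<in> Q_ring \<Longrightarrow> r (transp \<rho>) = r \<rho>"
  by (erule Q_ring_eqI) (auto simp: Q_gens_def tr_transp)

text \<open>Index arithmetic is modulo 4, so this is a cyclic rotation.\<close>

definition rotate_rep :: "rep \<Rightarrow> rep"
  where "rotate_rep \<rho> = (\<lambda>i. \<rho> (i + 1))"

lemma tr_rotate: "tr w (rotate_rep \<rho>) = tr (map (\<lambda>i. i + 1) w) \<rho>"
  by (simp add: tr_def rotate_rep_def comp_def)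

lemma five_eq_one: "(5::4) = 1"
  by simp

lemma rotate_simps:
  "X (rotate_rep \<rho>) = Y \<rho>" "Y (rotate_rep \<rho>) = X \<rho>"
  "vol 1 2 3 (rotate_rep \<rho>) = vol 2 3 4 \<rho>" "vol 1 3 4 (rotate_rep \<rho>) = vol 1 2 4 \<rho>"
  "vol 1 2 4 (rotate_rep \<rho>) = vol 1 2 3 \<rho>" "vol 2 3 4 (rotate_rep \<rho>) = vol 1 3 4 \<rho>"
  by (simp_all add: vol_def fun_apply tr_rotate five_eq_one tr_swap[of 3 1]
      tr_cycle[of 2 3 1] tr_cycle[of 3 1 2] tr_cycle[of 3 2 1] tr_cycle[of 2 1 3]
      tr_cycle[of 2 4 1] tr_cycle[of 4 1 2] tr_cycle[of 4 2 1] tr_cycle[of 2 1 4]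
      tr_cycle[of 3 4 1] tr_cycle[of 4 1 3] tr_cycle[of 4 3 1] tr_cycle[of 3 1 4]
      tr_cycle[of 3 4 2] tr_cycle[of 4 2 3] tr_cycle[of 4 3 2] tr_cycle[of 3 2 4])

lemma Q_ring_rotate: "r \<in> Q_ring \<Longrightarrow> r \<circ> rotate_rep \<in> Q_ring"
proof -
  assume r: "r \<in> Q_ring"
  show ?thesis
  proof (rule hull_induct[OF r[unfolded Q_ring_def], of "\<lambda>r. r \<circ> rotate_rep \<in> Q_ring"])
    have "tr w \<circ> rotate_rep = tr (map (\<lambda>i. i + 1) w)" for w by (simp add: fun_eq_iff tr_rotate)
    then show "x \<circ> rotate_rep \<in> Q_ring" if "x \<in> set Q_gens" for x
      using that Q_ring_tr tr_swap[of 2 1] tr_swap[of 4 1] by (auto simp: Q_gens_def five_eq_one)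
    have "(f + g) \<circ> rotate_rep = (f \<circ> rotate_rep)
        + (g \<circ> rotate_rep)" "(f * g) \<circ> rotate_rep = (f \<circ> rotate_rep) * (g \<circ> rotate_rep)"
      "(\<lambda>_. c) \<circ> rotate_rep = (\<lambda>_. c)"
      for f g :: "rep \<Rightarrow> complex" and c :: complex by (simp_all add: fun_eq_iff fun_apply)
    then show "complex_subalgebra {r. r \<circ> rotate_rep \<in> Q_ring}"
      by (auto simp: complex_subalgebra_def intro: Q_ring_intros)
  qed
qed

lemma rotate_zero: "r \<circ> rotate_rep = 0 \<Longrightarrow> r = 0" for r :: "rep \<Rightarrow> complex"
proof
  fix \<rho> :: rep
  assume "r \<circ> rotate_rep = 0"
  then have "(r \<circ> rotate_rep) (\<lambda>i. \<rho> (i - 1)) = 0" by (simp add: fun_apply)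
  then show "r \<rho> = 0 \<rho>" by (simp add: rotate_rep_def fun_apply)
qed

lemma vol_terms_vanish_Y:
  assumes Q: "\<And>k. u k \<in> Q_ring" "\<And>k. v k \<in> Q_ring" "\<And>k. w k \<in> Q_ring" "\<And>k. z k \<in> Q_ring"
    and rel: "\<And>\<rho>. (\<Sum>k<N. X \<rho> ^ k * (u k \<rho> * vol 1 2 3 \<rho> + v k \<rho> * vol 1 3 4 \<rho>))
      + (\<Sum>k<N. Y \<rho> ^ k * (w k \<rho> * vol 1 2 4 \<rho> + z k \<rho> * vol 2 3 4 \<rho>)) = 0"
    and "k < N"
  shows "w k = 0 \<and> z k = 0"
proof -
  have "w k \<circ> rotate_rep = 0 \<and> z k \<circ> rotate_rep = 0"
  \<comment> \<open>\<open>u\<close> and \<open>v\<close> trade places because rotation sends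
    \<open>vol 1 2 3\<close> to \<open>vol 2 3 4\<close> and \<open>vol 1 3 4\<close> to
    \<open>vol 1 2 4\<close>.\<close>
  proof (rule vol_terms_vanish_X[where u = "\<lambda>k. w k \<circ> rotate_rep" and v = "\<lambda>k. z k \<circ> rotate_rep"
        and w = "\<lambda>k. v k \<circ> rotate_rep" and z = "\<lambda>k. u k \<circ> rotate_rep", OF _ _ _ _ _ \<open>k < N\<close>])
    fix \<rho>
    show "(\<Sum>k<N. X \<rho> ^ k * ((w k \<circ> rotate_rep) \<rho> * vol 1 2 3 \<rho> + (z k \<circ> rotate_rep) \<rho> * vol 1 3 4 \<rho>))
      + (\<Sum>k<N. Y \<rho> ^ k * ((v k \<circ> rotate_rep) \<rho> * vol 1 2 4 \<rho> + (u k \<circ> rotate_rep) \<rho> * vol 2 3 4 \<rho>)) = 0"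
      using rel[of "rotate_rep \<rho>"] by (simp add: rotate_simps add.commute)
  qed (intro Q_ring_rotate Q)+
  then show ?thesis by (auto intro: rotate_zero)
qed

lemma even_terms_vanish_Y:
  assumes Q: "\<And>k. u k \<in> Q_ring" "\<And>k. v k \<in> Q_ring" "\<And>k. w k \<in> Q_ring" "\<And>k. z k \<in> Q_ring"
    and rel: "\<And>\<rho>. (\<Sum>k<N. X \<rho> ^ k * (u k \<rho> + v k \<rho> * Y \<rho>)) + (\<Sum>k<M. Y \<rho> ^ k * (w k \<rho> + z k \<rho> * X \<rho>)) = 0"
    and k: "2 \<le> k" "k < M"
  shows "w k = 0 \<and> z k = 0"
proof -
  have "w k \<circ> rotate_rep = 0 \<and> z k \<circ> rotate_rep = 0"
  proof (rule even_terms_vanish_X[where u = "\<lambda>k. w k \<circ> rotate_rep" and v =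
      "\<lambda>k. z k \<circ> rotate_rep" and M = N and N = M
        and w = "\<lambda>k. u k \<circ> rotate_rep" and z = "\<lambda>k. v k \<circ> rotate_rep"])
    fix \<rho>
    show "(\<Sum>k<M. X \<rho> ^ k * ((w k \<circ> rotate_rep) \<rho> + (z k \<circ> rotate_rep) \<rho> * Y \<rho>))
      + (\<Sum>k<N. Y \<rho> ^ k * ((u k \<circ> rotate_rep) \<rho> + (v k \<circ> rotate_rep) \<rho> * X \<rho>)) = 0"
      using rel[of "rotate_rep \<rho>"] by (simp add: rotate_simps add.commute)
  qed (use k in \<open>auto intro: Q_ring_rotate Q\<close>)
  then show ?thesis by (auto intro: rotate_zero)
qed

text \<open>Eight families indexed by \<open>c\<close>. The families led by powers of
  \<open>Y\<close> start at exponent 2, since 1, \<open>X\<close>, \<open>Y\<close> and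
  \<open>X * Y\<close> already occur in the first two; thus no element is listed twice.\<close>

definition A_elem :: "nat \<times> nat \<Rightarrow> rep \<Rightarrow> complex"
  where "A_elem = (\<lambda>(c, k). [X ^ k, X ^ k * Y, Y ^ (k + 2), Y ^ (k
      + 2) * X, X ^ k * tr [1,2,3], X ^ k * tr [1,3,4],
    Y ^ k * tr [1,2,4], Y ^ k * tr [2,3,4]] ! c)"

lemma A_elem_independent_rect:
  assumes Q: "\<And>c k. r (c, k) \<in> Q_ring" and zero: "(\<Sum>i\<in>{..<8}\<times>{..<N}. r i * A_elem i) = 0"
    and "c < 8" "k < N"
  shows "r (c, k) = 0"
proof -
  have "(\<Sum>i\<in>{..<8}\<times>{..<N}. r i * A_elem i) = (\<Sum>k<N. \<Sum>c<8. r (c, k) * A_elem (c, k))"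
    by (subst sum.swap) (simp add: sum.cartesian_product split_def)
  also have "\<dots> = (\<Sum>k<N. (r (0,k) * X ^ k + r (1,k) * (X ^ k * Y) + r (2,k) * Y ^ (k + 2)
      + r (3,k) * (Y ^ (k + 2) * X)
      + r (4,k) * (X ^ k * tr [1,2,3]) + r (5,k) * (X ^ k * tr [1,3,4]) + r (6,k) * (Y ^ k * tr [1,2,4])
          + r (7,k) * (Y ^ k * tr [2,3,4])))"
    by (intro sum.cong refl) (simp add: A_elem_def eval_nat_numeral)
  finally have "(\<Sum>k<N. (r (0,k) * X ^ k + r (1,k) * (X ^ k * Y) + r (2,k) * Y ^ (k + 2)
      + r (3,k) * (Y ^ (k + 2) * X)
      + r (4,k) * (X ^ k * tr [1,2,3]) + r (5,k) * (X ^ k * tr [1,3,4]) + r (6,k) * (Y ^ k * tr [1,2,4])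
          + r (7,k) * (Y ^ k * tr [2,3,4]))) = 0"
    using zero by simp
  then have rel: "(\<Sum>k<N. r (0,k) \<rho> * X \<rho> ^ k + r (1,k) \<rho> * (X \<rho> ^ k * Y \<rho>) + r (2,k) \<rho> * Y \<rho> ^ (k + 2)
      + r (3,k) \<rho> * (Y \<rho> ^ (k + 2) * X \<rho>)
      + r (4,k) \<rho> * (X \<rho> ^ k * tr [1,2,3] \<rho>) + r (5,k) \<rho> * (X \<rho> ^ k * tr [1,3,4] \<rho>)
          + r (6,k) \<rho> * (Y \<rho> ^ k * tr [1,2,4] \<rho>)
      + r (7,k) \<rho> * (Y \<rho> ^ k * tr [2,3,4] \<rho>)) = 0" (is "(\<Sum>k<N. ?F k \<rho>) = 0") for \<rho>
    by (drule_tac x = \<rho> in fun_cong) (simp only: sum_fun_apply fun_apply power_fun_apply)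
  \<comment> \<open>Subtracting the transposed relation keeps only the volumes.\<close>
  have odd: "(\<Sum>k<N. X \<rho> ^ k * (r (4,k) \<rho> * vol 1 2 3 \<rho> + r (5,k) \<rho> * vol 1 3 4 \<rho>))
      + (\<Sum>k<N. Y \<rho> ^ k * (r (6,k) \<rho> * vol 1 2 4 \<rho> + r (7,k) \<rho> * vol 2 3 4 \<rho>)) = 0" for \<rho>
  proof -
    have "0 = (\<Sum>k<N. ?F k \<rho>) - (\<Sum>k<N. ?F k (transp \<rho>))" by (simp only: rel diff_zero)
    also have "\<dots> = (\<Sum>k<N. X \<rho> ^ k * (r (4,k) \<rho> * vol 1 2 3 \<rho> + r (5,k) \<rho> * vol 1 3 4 \<rho>)
        + Y \<rho> ^ k * (r (6,k) \<rho> * vol 1 2 4 \<rho> + r (7,k) \<rho> * vol 2 3 4 \<rho>))"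
      unfolding sum_subtractf[symmetric] tr_transp Q_ring_transp[OF Q]
      by (intro sum.cong refl) (simp add: vol_def fun_apply algebra_simps)
    finally show ?thesis by (simp add: sum.distrib)
  qed
  have 4: "r (4,k) = 0 \<and> r (5,k) = 0" if "k < N" for k
    by (rule vol_terms_vanish_X[OF Q Q Q Q odd that])
  have 6: "r (6,k) = 0 \<and> r (7,k) = 0" if "k < N" for k
    by (rule vol_terms_vanish_Y[OF Q Q Q Q odd that])
  \<comment> \<open>The exponents of \<open>Y\<close> are shifted back by 2, with zero coefficients
    in degrees 0 and 1.\<close>
  define w where "w j = (if j < 2 then 0 else r (2, j - 2))" for j
  define z where "z j = (if j < 2 then 0 else r (3, j - 2))" for j
  have wz: "w j \<in> Q_ring" "z j \<in> Q_ring" for j by (auto simp: w_def z_def Q intro: Q_ring_intros)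
  have even: "(\<Sum>k<N. X \<rho> ^ k * (r (0,k) \<rho> + r (1,k) \<rho> * Y \<rho>)) + (\<Sum>k<N + 2. Y \<rho> ^ k * (w k \<rho>
      + z k \<rho> * X \<rho>)) = 0" for \<rho>
  proof -
    have "(\<Sum>k<N + 2. Y \<rho> ^ k * (w k \<rho> + z k \<rho> * X \<rho>)) = (\<Sum>k<N. Y \<rho> ^ (k + 2) * (r (2,k) \<rho> + r (3,k) \<rho> * X \<rho>))"
      by (simp add: sum.lessThan_Suc_shift w_def z_def fun_apply del: sum.lessThan_Suc power_Suc)
    then have "(\<Sum>k<N. X \<rho> ^ k * (r (0,k) \<rho> + r (1,k) \<rho> * Y \<rho>)) + (\<Sum>k<N + 2. Y \<rho> ^ k * (w k \<rho> + z k \<rho> * X \<rho>))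
       = (\<Sum>k<N. X \<rho> ^ k * (r (0,k) \<rho> + r (1,k) \<rho> * Y \<rho>) + Y \<rho> ^ (k + 2) * (r (2,k) \<rho> + r (3,k) \<rho> * X \<rho>))"
      by (simp add: sum.distrib)
    also have "\<dots> = (\<Sum>k<N. ?F k \<rho>)"
      using 4 6 by (intro sum.cong refl) (simp add: fun_apply algebra_simps)
    finally show ?thesis using rel by simp
  qed
  \<comment> \<open>Powers of \<open>Y\<close> from 2 on go first. The second sum is then empty,
    which frees all powers of \<open>X\<close>, including 0 and 1.\<close>
  have "w (k + 2) = 0 \<and> z (k + 2) = 0" if "k < N" for k
    by (rule even_terms_vanish_Y[OF Q Q wz even]) (use that in auto)
  then have 2: "r (2,k) = 0 \<and> r (3,k) = 0" if "k < N" for k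
    using that by (auto simp: w_def z_def)
  have wz0: "w j = 0 \<and> z j = 0" if "j < N + 2" for j
    using 2[of "j - 2"] that by (auto simp: w_def z_def)
  have even': "(\<Sum>k<N. X \<rho> ^ k * (r (0,k) \<rho> + r (1,k) \<rho> * Y \<rho>)) + (\<Sum>k<0. Y \<rho> ^ k * (w k \<rho>
      + z k \<rho> * X \<rho>)) = 0" for \<rho>
    using even[of \<rho>] wz0 by (simp add: fun_apply)
  have 0: "r (0,k) = 0 \<and> r (1,k) = 0" if "k < N" for k
    by (rule even_terms_vanish_X[OF Q Q wz even']) (use that in auto)
  have "c = 0 \<or> c = 1 \<or> c = 2 \<or> c = 3 \<or> c = 4 \<or> c = 5 \<or> c = 6 \<or> c = 7" using \<open>c < 8\<close> by arith
  then show ?thesis using 0 2 4 6 \<open>k < N\<close> by blast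
qed

abbreviation A_index where "A_index \<equiv> {..<8} \<times> (UNIV :: nat set)"

lemma A_elem_independent:
  assumes "finite K" "K \<subseteq> A_index" "\<And>i. i \<in> K \<Longrightarrow> r i \<in> Q_ring" "(\<Sum>i\<in>K. r i * A_elem i) = 0" "i \<in> K"
  shows "r i = 0"
proof -
  define N where "N = Suc (Max (snd ` K))"
  have N: "K \<subseteq> {..<8} \<times> {..<N}"
  proof (rule subsetI)
    fix i assume "i \<in> K"
    then have "snd i \<le> Max (snd ` K)" using assms(1) by (intro Max_ge) auto
    then show "i \<in> {..<8} \<times> {..<N}" using \<open>i \<in> K\<close> assms(2) by (auto simp: N_def mem_Times_iff)
  qed
  define r' where "r' i = (if i \<in> K then r i else 0)" for i
  have "(\<Sum>i\<in>{..<8}\<times>{..<N}. r' i * A_elem i) = (\<Sum>i\<in>K. r' i * A_elem i)"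
    using N by (intro sum.mono_neutral_right) (auto simp: r'_def)
  also have "\<dots> = 0" using assms(4) by (simp add: r'_def)
  finally have "r' (fst i, snd i) = 0"
    using N assms(3,5) by (intro A_elem_independent_rect) (auto simp: r'_def intro: Q_ring_intros)
  then show ?thesis using assms(5) by (simp add: r'_def)
qed

lemma A_set_eq: "A_set = A_elem ` A_index"
proof
  have in_A: "A_elem (c, k) \<in> A_elem ` A_index" if "c < 8" for c k using that by simp
  have XY: "X ^ k \<in> A_elem ` A_index" "X ^ k * Y \<in> A_elem ` A_index"
    "Y ^ (k + 2) \<in> A_elem ` A_index" "Y ^ (k
        + 2) * X \<in> A_elem ` A_index" "X ^ k * tr [1,2,3] \<in> A_elem ` A_index"
    "X ^ k * tr [1,3,4] \<in> A_elem ` A_index" "Y ^ k * tr [1,2,4] \<in> A_elem ` A_index"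
        "Y ^ k * tr [2,3,4] \<in> A_elem ` A_index" for k
    using in_A[of 0 k] in_A[of 1 k] in_A[of 2 k] in_A[of 3 k] in_A[of 4 k] in_A[of 5 k] in_A[of 6 k]
        in_A[of 7 k]
    by (simp_all add: A_elem_def del: image_iff)
  have "Y ^ k \<in> A_elem ` A_index" "Y ^ k * X \<in> A_elem ` A_index" if "2 \<le> k" for k
    using XY(3,4)[of "k - 2", unfolded le_add_diff_inverse2[OF that]] by blast+
  then show "A_set \<subseteq> A_elem ` A_index"
    unfolding A_set_def using XY XY(1)[of 0] XY(1)[of 1] XY(2)[of 0] XY(2)[of 1] by auto
next
  have "A_elem (c, k) \<in> A_set" if "c < 8" for c k
  proof -
    have "c = 0 \<or> c = 1 \<or> c = 2 \<or> c = 3 \<or> c = 4 \<or> c = 5 \<or> c = 6 \<or> c = 7" using that by arith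
    then show ?thesis using A_setI[of k] A_setI[of "k + 2"] by (elim disjE) (simp_all add: A_elem_def)
  qed
  then show "A_elem ` A_index \<subseteq> A_set" by auto
qed

subsection \<open>The module basis and the vector space basis\<close>

text \<open>Passes from an independent indexed family to the set of its members by choosing one
  index for each member. The product \<open>G\<close> is left open to serve both the module and the
  vector space.\<close>

lemma reindexed_sum_coefficients_zero:
  fixes b :: "'i \<Rightarrow> 'b" and G :: "'c \<Rightarrow> 'b \<Rightarrow> 'd::comm_monoid_add"
  assumes "\<And>K r. finite K \<Longrightarrow> K \<subseteq> I \<Longrightarrow> (\<And>i. i \<in> K \<Longrightarrow> r i \<in> R) \<Longrightarrow> (\<Sum>i\<in>K. G (r i) (b i)) = 0 \<Longrightarrow> \<forall>i\<in>K. r i = z"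
    and "finite T" "T \<subseteq> b ` I" "\<And>v. v \<in> T \<Longrightarrow> r v \<in> R" "(\<Sum>v\<in>T. G (r v) v) = 0" "v \<in> T"
  shows "r v = z"
proof -
  obtain K where K: "K \<subseteq> I" "inj_on b K" "T = b ` K"
    using assms(3) by (auto simp: subset_image_inj)
  have "finite K" using assms(2) K finite_imageD by blast
  moreover have "(\<Sum>i\<in>K. G ((r \<circ> b) i) (b i)) = 0"
    using assms(5) K by (simp add: sum.reindex)
  ultimately have "\<forall>i\<in>K. (r \<circ> b) i = z"
    using K assms(4) by (intro assms(1)) auto
  then show ?thesis using assms(6) K by auto
qed

lemma rspan_explicit:
  assumes "\<And>r s. r \<in> R \<Longrightarrow> s \<in> R \<Longrightarrow> r + s \<in> R" "0 \<in> R" "h \<in> rspan R V"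
  shows "\<exists>T r. h = (\<Sum>a\<in>T. r a * a) \<and> finite T \<and> T \<subseteq> V \<and> (\<forall>a\<in>T. r a \<in> R)"
  using assms(3)
proof induction
  case zero
  show ?case by (intro exI[of _ "{}"]) simp
next
  case (step q v h)
  then obtain T r where T: "h = (\<Sum>a\<in>T. r a * a)" "finite T" "T \<subseteq> V" "\<forall>a\<in>T. r a \<in> R" by blast
  \<comment> \<open>If \<open>v\<close> already occurs in \<open>T\<close>, its coefficients are
    added.\<close>
  define r' where "r' a = (if a \<in> T then r a else 0) + (if a = v then q else 0)" for a
  have "(\<Sum>a\<in>insert v T. r' a * a) = (\<Sum>a\<in>insert v T. (if a \<in> T then r a else 0) * a)
      + (\<Sum>a\<in>insert v T. (if a = v then q else 0) * a)"
    by (simp add: r'_def distrib_right sum.distrib)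
  also have "(\<Sum>a\<in>insert v T. (if a \<in> T then r a else 0) * a) = h"
    using T(2) unfolding T(1) by (intro sum.mono_neutral_cong_right) auto
  also have "(\<Sum>a\<in>insert v T. (if a = v then q else 0) * a) = q * v"
    using T(2) by (subst sum.mono_neutral_right[of _ "{v}"]) auto
  finally have "q * v + h = (\<Sum>a\<in>insert v T. r' a * a)" by (simp add: add.commute)
  moreover have "\<forall>a\<in>insert v T. r' a \<in> R" using T(4) step.hyps(1) assms(1,2) by (auto simp: r'_def)
  ultimately show ?case using T(2,3) step.hyps(2) by (intro exI[of _ "insert v T"] exI[of _ r']) auto
qed

lemma char_ring_intros:
  "f \<in> char_ring \<Longrightarrow> g \<in> char_ring \<Longrightarrow> f + g \<in> char_ring" "f \<in> char_ring \<Longrightarrow> g \<in> char_ring \<Longrightarrow> f * g \<in> char_ring"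
  "f \<in> char_ring \<Longrightarrow> f ^ n \<in> char_ring" "0 \<in> char_ring" "1 \<in> char_ring"
  unfolding char_ring_eq_trace_ring trace_ring_def by (rule hull_intros; assumption?)+

lemma Q_ring_subset_char_ring: "Q_ring \<subseteq> char_ring"
  unfolding Q_ring_def
proof (rule hull_minimal)
  show "set Q_gens \<subseteq> char_ring" by (auto simp: Q_gens_def tr_in_char_ring)
  show "complex_subalgebra char_ring"
    unfolding char_ring_eq_trace_ring trace_ring_def by (rule subalgebra_hull)
qed

lemma A_set_subset_char_ring: "A_set \<subseteq> char_ring"
  unfolding A_set_def by (auto intro!: char_ring_intros tr_in_char_ring)

lemma char_ring_subset_rspan: "char_ring \<subseteq> rspan Q_ring A_set"
proof -
  have "trace_ring \<subseteq> fund_ring"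
    unfolding trace_ring_def using tr_in_fund_ring
    by (intro hull_minimal) (auto simp: fund_ring_def subalgebra_hull)
  then show ?thesis using fund_ring_subset_span char_ring_eq_trace_ring by blast
qed

lemma char_ring_sum: "(\<And>i. i \<in> I \<Longrightarrow> F i \<in> char_ring) \<Longrightarrow> sum F I \<in> char_ring"
  by (induction I rule: infinite_finite_induct) (auto intro: char_ring_intros)

lemma free_module_A_set: "is_free_module_basis Q_ring A_set char_ring"
  unfolding is_free_module_basis_def
proof (intro conjI allI impI ballI)
  show "char_ring = {\<Sum>a\<in>T. r a * a | T r. finite T \<and> T \<subseteq> A_set \<and> (\<forall>a\<in>T. r a \<in> Q_ring)}"
  proof
    show "char_ring \<subseteq> {\<Sum>a\<in>T. r a * a | T r. finite T \<and> T \<subseteq> A_set \<and> (\<forall>a\<in>T. r a \<in> Q_ring)}"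
      using rspan_explicit[OF Q_ring_intros(2,4)] char_ring_subset_rspan by blast
    show "{\<Sum>a\<in>T. r a * a | T r. finite T \<and> T \<subseteq> A_set \<and> (\<forall>a\<in>T. r a \<in> Q_ring)} \<subseteq> char_ring"
      using Q_ring_subset_char_ring A_set_subset_char_ring by (auto intro!: char_ring_sum char_ring_intros)
  qed
next
  fix T r a assume "finite T \<and> T \<subseteq> A_set \<and> (\<forall>a\<in>T. r a \<in> Q_ring) \<and> (\<Sum>a\<in>T. r a * a) = 0" "a \<in> T"
  then show "r a = 0"
    using A_elem_independent unfolding A_set_eq
    by (intro reindexed_sum_coefficients_zero[where b = A_elem and I = A_index and R = Q_ring and T = T
        and r = r and G = "(*)"]) blast+
qed

lemma polynomial_ring_Q: "is_polynomial_ring_in Q_ring Q_gens"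
  unfolding is_polynomial_ring_in_def length_Q_gens bij_betw_def
proof
  show "poly_eval ((!) Q_gens) ` polynomials_in {..<8} = Q_ring" by (simp add: Q_ring_eq_poly_eval)
  show "inj_on (poly_eval ((!) Q_gens)) (polynomials_in {..<8})"
  proof (rule inj_onI)
    fix p q assume pq: "p \<in> polynomials_in {..<8}" "q \<in> polynomials_in {..<8}"
        "poly_eval ((!) Q_gens) p = poly_eval ((!) Q_gens) q"
    have "poly_eval ((!) Q_gens) p = poly_eval ((!) Q_gens) (p - q) + poly_eval ((!) Q_gens) q"
      by (simp flip: poly_eval_add)
    then have "poly_eval ((!) Q_gens) (p - q) = 0" using pq(3) by simp
    moreover have "p - q \<in> polynomials_in {..<8}"
      using pq(1,2) Poly_Mapping.keys_diff[of p q] unfolding polynomials_in_def by blast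
    ultimately have "p - q = 0" by (intro Q_poly_zero) (simp_all add: fun_apply)
    then show "p = q" by simp
  qed
qed

section \<open>Monomials in the eight generators, and the basis over the complex numbers\<close>

definition Q_monom :: "(nat \<Rightarrow>\<^sub>0 nat) \<Rightarrow> rep \<Rightarrow> complex"
  where "Q_monom m = monomial (\<lambda>i. Q_gens ! i) m"

abbreviation "exponents \<equiv> {m :: nat \<Rightarrow>\<^sub>0 nat. Poly_Mapping.keys m \<subseteq> {..<8}}"

lemma poly_eval_sum: "poly_eval V (sum F I) = (\<Sum>i\<in>I. poly_eval V (F i))"
  by (induction I rule: infinite_finite_induct) (simp_all add: poly_eval_0 poly_eval_add)

lemma Q_monom_independent:
  assumes "finite K" "K \<subseteq> exponents" "(\<Sum>m\<in>K. fun_scale (c m) (Q_monom m)) = 0" "m \<in> K"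
  shows "c m = 0"
proof -
  define p where "p = (\<Sum>m\<in>K. Poly_Mapping.single m (c m))"
  have lookup: "Poly_Mapping.lookup p m' = (if m' \<in> K then c m' else 0)" for m'
    using assms(1) by (simp add: p_def lookup_sum lookup_single when_def)
  have "poly_eval ((!) Q_gens) p = 0"
    using assms(3) by (simp add: p_def poly_eval_sum poly_eval_single Q_monom_def)
  moreover have "p \<in> polynomials_in {..<8}"
    using assms(2) by (auto simp: polynomials_in_def in_keys_iff lookup split: if_splits)
  ultimately have "p = 0" by (intro Q_poly_zero) (simp_all add: fun_apply)
  then show ?thesis using lookup[of m] assms(4) by simp
qed

lemma Q_monom_in: "m \<in> exponents \<Longrightarrow> Q_monom m \<in> Q_ring"
  unfolding Q_monom_def Q_ring_def
  by (intro hull_prod hull_power hull_inc nth_mem) (auto simp: length_Q_gens)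

lemma Q_monom_eq:
  "m \<in> exponents \<Longrightarrow> Q_monom m = (\<Prod>i<8. (Q_gens ! i) ^ Poly_Mapping.lookup m i)"
  unfolding Q_monom_def by (rule monomial_superset) auto

definition B_elem :: "(nat \<Rightarrow>\<^sub>0 nat) \<times> nat \<times> nat \<Rightarrow> rep \<Rightarrow> complex"
  where "B_elem x = Q_monom (fst x) * A_elem (snd x)"

lemma B_set_eq: "B_set = B_elem ` (exponents \<times> A_index)"
proof -
  let ?mon = "\<lambda>i1 i2 i3 i4 i5 i6 i7 i8. tr [1] ^ i1 * tr [2] ^ i2 * tr [3] ^ i3 * tr [4] ^ i4 *
     tr [1,2] ^ i5 * tr [2,3] ^ i6 * tr [3,4] ^ i7 * tr [1,4] ^ i8"
  have prod8: "(\<Prod>i<8. (Q_gens ! i) ^ e i) = ?mon (e 0) (e 1) (e 2) (e 3) (e 4) (e 5) (e 6) (e 7)" for e ::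
      "nat \<Rightarrow> nat"
    by (simp add: eval_nat_numeral Q_gens_def)
  have "\<exists>m\<in>exponents. Q_monom m = ?mon i1 i2 i3 i4 i5 i6 i7 i8" for i1 i2 i3 i4 i5 i6 i7 i8
  proof -
    define e where "e i = (if i < 8 then [i1, i2, i3, i4, i5, i6, i7, i8] ! i else 0)" for i :: nat
    define m where "m = Abs_poly_mapping e"
    have fin: "finite {i. e i \<noteq> 0}" by (rule finite_subset[of _ "{..<8}"]) (auto simp: e_def)
    have look: "Poly_Mapping.lookup m = e" unfolding m_def using fin by (rule lookup_Abs_poly_mapping)
    have m: "m \<in> exponents" by (auto simp: in_keys_iff look e_def split: if_splits)
    then have "Q_monom m = ?mon i1 i2 i3 i4 i5 i6 i7 i8"
      unfolding Q_monom_eq[OF m] look prod8 by (simp add: e_def eval_nat_numeral)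
    then show ?thesis using m by blast
  qed
  note mon = this
  show ?thesis
  proof (intro subset_antisym subsetI)
    fix b assume "b \<in> B_set"
    then obtain i1 i2 i3 i4 i5 i6 i7 i8 a where b: "b = ?mon i1 i2 i3 i4 i5 i6 i7 i8 * a" "a \<in> A_set"
      unfolding B_set_def by blast
    obtain m where m: "m \<in> exponents" "Q_monom m = ?mon i1 i2 i3 i4 i5 i6 i7 i8" using mon by blast
    obtain i where "i \<in> A_index" "a = A_elem i" using b(2) unfolding A_set_eq by blast
    then show "b \<in> B_elem ` (exponents \<times> A_index)"
      using m(1) unfolding b(1) m(2)[symmetric]
          by (intro image_eqI[of _ _ "(m, i)"]) (simp_all add: B_elem_def)
  next
    fix b assume "b \<in> B_elem ` (exponents \<times> A_index)"
    then obtain m i where "m \<in> exponents" "i \<in> A_index" and b: "b = Q_monom m * A_elem i"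
      unfolding B_elem_def by force
    then have "A_elem i \<in> A_set" by (auto simp: A_set_eq)
    then show "b \<in> B_set"
      unfolding b Q_monom_eq[OF \<open>m \<in> exponents\<close>] prod8 B_set_def by blast
  qed
qed

text \<open>Grouping terms by the element of \<open>A_set\<close> makes the inner sums coefficients
  in \<open>Q_ring\<close>; freeness of the module kills them, and then the monomials are
  independent.\<close>

lemma B_elem_independent:
  assumes "finite K" "K \<subseteq> exponents \<times> A_index" "(\<Sum>x\<in>K. fun_scale (c x) (B_elem x)) = 0" "x \<in> K"
  shows "c x = 0"
proof -
  define M where "M = fst ` K"
  define I where "I = snd ` K"
  have fin: "finite M" "finite I" and sub: "K \<subseteq> M \<times> I" "M \<subseteq> exponents" "I \<subseteq> A_index"
    using assms(1,2) by (force simp: M_def I_def)+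
  \<comment> \<open>Extension by zero to a full rectangle \<open>M \<times> I\<close>, so that the
    double sum can be grouped.\<close>
  define c' where "c' x = (if x \<in> K then c x else 0)" for x
  have "(\<Sum>i\<in>I. (\<Sum>m\<in>M. fun_scale (c' (m, i)) (Q_monom m)) * A_elem i) = (\<Sum>m\<in>M. \<Sum>i\<in>I. fun_scale (c' (m,
      i)) (Q_monom m * A_elem i))"
    by (subst sum.swap) (simp add: sum_distrib_right fun_scale_eq mult.assoc)
  also have "\<dots> = (\<Sum>(m, i)\<in>M \<times> I. fun_scale (c' (m, i)) (Q_monom m * A_elem i))"
    by (rule sum.cartesian_product)
  also have "\<dots> = (\<Sum>(m, i)\<in>K. fun_scale (c' (m, i)) (Q_monom m * A_elem i))"
    using fin sub by (intro sum.mono_neutral_right) (auto simp: c'_def)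
  also have "\<dots> = 0"
    using assms(3) by (simp add: c'_def split_def B_elem_def)
  finally have zero: "(\<Sum>i\<in>I. (\<Sum>m\<in>M. fun_scale (c' (m, i)) (Q_monom m)) * A_elem i) = 0" .
  have "(\<Sum>m\<in>M. fun_scale (c' (m, snd x)) (Q_monom m)) = 0"
  proof (rule A_elem_independent[OF fin(2) sub(3) _ zero])
    show "(\<Sum>m\<in>M. fun_scale (c' (m, i)) (Q_monom m)) \<in> Q_ring" for i
      using sub(2) Q_monom_in unfolding Q_ring_def fun_scale_eq
          by (auto intro!: hull_sum hull_mult hull_const)
    show "snd x \<in> I" using assms(4) by (simp add: I_def)
  qed
  from Q_monom_independent[OF fin(1) sub(2) this, of "fst x"] show ?thesis
    using assms(4) by (simp add: c'_def M_def)
qed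

lemma B_set_independent: "\<not> fun_vs.dependent B_set"
proof
  assume "fun_vs.dependent B_set"
  then obtain T u v where T: "finite T" "T \<subseteq> B_set" "(\<Sum>v\<in>T. fun_scale (u v) v) = 0" "v \<in> T" "u v \<noteq> 0"
    unfolding fun_vs.dependent_explicit by blast
  have "u v = 0"
  proof (rule reindexed_sum_coefficients_zero[where b = B_elem and I =
      "exponents \<times> A_index" and R = UNIV and G = fun_scale and T = T
        and r = u and v = v and z = 0])
    fix K and c :: "(nat \<Rightarrow>\<^sub>0 nat) \<times> nat \<times> nat \<Rightarrow> complex"
    assume "finite K" "K \<subseteq> exponents \<times> A_index" "(\<Sum>x\<in>K. fun_scale (c x) (B_elem x)) = 0"
    then show "\<forall>x\<in>K. c x = 0" using B_elem_independent by blast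
  next
    show "T \<subseteq> B_elem ` (exponents \<times> A_index)" using T(2) by (simp only: B_set_eq)
  qed (use T in simp_all)
  then show False using T by simp
qed

lemma B_set_span: "fun_vs.span B_set = char_ring"
proof
  show "fun_vs.span B_set \<subseteq> char_ring"
  proof (rule fun_vs.span_minimal)
    show "B_set \<subseteq> char_ring"
      unfolding B_set_eq
    proof (rule image_subsetI)
      fix x :: "(nat \<Rightarrow>\<^sub>0 nat) \<times> nat \<times> nat" assume x: "x \<in> exponents \<times> A_index"
      then have "Q_monom (fst x) \<in> char_ring" using Q_monom_in Q_ring_subset_char_ring
          by (auto simp: mem_Times_iff)
      moreover have "A_elem (snd x) \<in> char_ring"
        using x A_set_subset_char_ring unfolding A_set_eq by (auto simp: mem_Times_iff)
      ultimately show "B_elem x \<in> char_ring" unfolding B_elem_def by (rule char_ring_intros)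
    qed
    have "(\<lambda>_. c) \<in> char_ring" for c
      using Q_ring_intros(1) Q_ring_subset_char_ring by blast
    then show "fun_vs.subspace char_ring"
      by (auto simp: fun_vs.subspace_def fun_scale_eq intro: char_ring_intros)
  qed
  have "h \<in> fun_vs.span B_set" if "h \<in> rspan Q_ring A_set" for h
    using that
  proof induction
    case zero
    show ?case by (rule fun_vs.span_zero)
  next
    case (step r v h)
    obtain i where i: "v = A_elem i" "i \<in> A_index" using step.hyps(2) by (auto simp: A_set_eq)
    obtain p where p: "p \<in> polynomials_in {..<8}" "r = poly_eval ((!) Q_gens) p"
      using step.hyps(1) by (auto simp: Q_ring_eq_poly_eval)
    have "r * v = (\<Sum>m\<in>Poly_Mapping.keys p. fun_scale (Poly_Mapping.lookup p m) (Q_monom m * v))"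
      unfolding p(2) poly_eval_def by (simp add: sum_distrib_right fun_scale_eq mult.assoc Q_monom_def)
    also have "\<dots> \<in> fun_vs.span B_set"
    proof (intro fun_vs.span_sum fun_vs.span_scale fun_vs.span_base)
      fix m assume "m \<in> Poly_Mapping.keys p"
      then have "m \<in> exponents" using p(1) by (auto simp: polynomials_in_def)
      then show "Q_monom m * v \<in> B_set" unfolding B_set_eq i(1) using i(2)
          by (intro image_eqI[of _ _ "(m, i)"]) (simp_all add: B_elem_def)
    qed
    finally show ?case using step.IH by (rule fun_vs.span_add)
  qed
  then show "char_ring \<subseteq> fun_vs.span B_set" using char_ring_subset_rspan by blast
qed

theorem theorem3p4:
  shows "is_polynomial_ring_in Q_ring Q_gens
    \<and> is_free_module_basis Q_ring A_set char_ring
    \<and> \<not> fun_vs.dependent B_set \<and> fun_vs.span B_set = char_ring"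
  using polynomial_ring_Q free_module_A_set B_set_independent B_set_span by blast

end
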